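(* Let $\mathfrak{g}=L_{25}$ be the 25-dimensional complex Lie algebra defined in the context (Benayadi's Lie algebra). Then $H^1(\mathfrak{g},\mathbb{C})=H^0(\mathfrak{g},\mathfrak{g})=H^1(\mathfrak{g},\mathfrak{g})=0$ and $\dim H^2(\mathfrak{g},\mathfrak{g})=1$.
   Context: $H^n(\mathfrak{g},M)$ denotes Chevalley–Eilenberg cohomology; $\mathbb{C}$ is the trivial module and $\mathfrak{g}$ as a coefficient module is the adjoint module. The Lie algebra $L_{25}$ has basis $e_1,\dots,e_{25}$. All brackets of basis vectors not determined by the following and skew-symmetry are zero. (i) $[e_1,e_2]=e_3$, $[e_1,e_3]=-2e_1$, $[e_2,e_3]=2e_2$ (so $\langle e_1,e_2,e_3\rangle\cong\mathfrak{sl}_2(\mathbb{C})$). (ii) Put $\mathfrak{g}_1=\langle e_4,\dots,e_{10}\rangle$, $\mathfrak{g}_2=\langle e_{11},\dots,e_{15}\rangle$, $\mathfrak{g}_3=\langle e_{16},\dots,e_{22}\rangle$, $\mathfrak{g}_4=\langle e_{23},e_{24},e_{25}\rangle$. For each of these subspaces, writing its listed basis in order as $f_0,f_1,\dots,f_m$ (with $m=6,4,6,2$ respectively) and $f_{-1}=f_{m+1}=0$: $[e_1,f_i]=i f_{i-1}$, $[e_2,f_i]=(m-i)f_{i+1}$, $[e_3,f_i]=(m-2i)f_i$. (iii) $[\mathfrak{g}_1,\mathfrak{g}_1]$: $[e_4,e_7]=3e_{16}$, $[e_4,e_8]=12e_{17}$, $[e_4,e_9]=30e_{18}$, $[e_4,e_{10}]=60e_{19}$,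 $[e_5,e_6]=-2e_{16}$, $[e_5,e_7]=-3e_{17}$, $[e_5,e_9]=10e_{19}$, $[e_5,e_{10}]=30e_{20}$, $[e_6,e_7]=-3e_{18}$, $[e_6,e_8]=-4e_{19}$, $[e_6,e_{10}]=12e_{21}$, $[e_7,e_8]=-3e_{20}$, $[e_7,e_9]=-3e_{21}$, $[e_7,e_{10}]=3e_{22}$, $[e_8,e_9]=-2e_{22}$. (iv) $[\mathfrak{g}_1,\mathfrak{g}_2]$: $[e_4,e_{15}]=60e_{23}$, $[e_5,e_{14}]=-10e_{23}$, $[e_5,e_{15}]=20e_{24}$, $[e_6,e_{13}]=4e_{23}$, $[e_6,e_{14}]=-8e_{24}$, $[e_6,e_{15}]=4e_{25}$, $[e_7,e_{12}]=-3e_{23}$, $[e_7,e_{13}]=6e_{24}$, $[e_7,e_{14}]=-3e_{25}$, $[e_8,e_{11}]=4e_{23}$, $[e_8,e_{12}]=-8e_{24}$, $[e_8,e_{13}]=4e_{25}$, $[e_9,e_{11}]=20e_{24}$, $[e_9,e_{12}]=-10e_{25}$, $[e_{10},e_{11}]=60e_{25}$. (v) $[\mathfrak{g}_2,\mathfrak{g}_2]$: $[e_{11},e_{14}]=2e_{23}$, $[e_{11},e_{15}]=8e_{24}$, $[e_{12},e_{13}]=-e_{23}$, $[e_{12},e_{14}]=-e_{24}$, $[e_{12},e_{15}]=2e_{25}$, $[e_{13},e_{14}]=-e_{25}$. (vi) $[\mathfrak{g}_1,\mathfrak{g}_3]$: $[e_4,e_{21}]=15e_{23}$, $[e_4,e_{22}]=90e_{24}$,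 $[e_5,e_{20}]=-5e_{23}$, $[e_5,e_{21}]=-10e_{24}$, $[e_5,e_{22}]=15e_{25}$, $[e_6,e_{19}]=3e_{23}$, $[e_6,e_{20}]=2e_{24}$, $[e_6,e_{21}]=-5e_{25}$, $[e_7,e_{18}]=-3e_{23}$, $[e_7,e_{20}]=3e_{25}$, $[e_8,e_{17}]=5e_{23}$, $[e_8,e_{18}]=-2e_{24}$, $[e_8,e_{19}]=-3e_{25}$, $[e_9,e_{16}]=-15e_{23}$, $[e_9,e_{17}]=10e_{24}$, $[e_9,e_{18}]=5e_{25}$, $[e_{10},e_{16}]=-90e_{24}$, $[e_{10},e_{17}]=-15e_{25}$. *)

theory Defs
  imports "HOL-Analysis.Analysis" "HOL-Algebra.QuotRing" "Jordan_Normal_Form.VS_Connect"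
begin

no_notation vec_index (infixl "$" 100)

section \<open>Lie algebras and their modules\<close>

locale lie_algebra = vector_space scale
  for scale :: "'k::field \<Rightarrow> 'g::ab_group_add \<Rightarrow> 'g" +
  fixes bracket :: "'g \<Rightarrow> 'g \<Rightarrow> 'g"
  assumes linear_bracket_right: "Vector_Spaces.linear scale scale (bracket x)"
    and linear_bracket_left: "Vector_Spaces.linear scale scale (\<lambda>x. bracket x y)"
    and bracket_self: "bracket x x = 0"
    and jacobi: "bracket x (bracket y z) + bracket y (bracket z x) + bracket z (bracket x y) = 0"

locale lie_module = lie_algebra scale bracket + M: vector_space scaleM
  for scale :: "'k::field \<Rightarrow> 'g::ab_group_add \<Rightarrow> 'g" and bracket :: "'g \<Rightarrow> 'g \<Rightarrow> 'g"
    and scaleM :: "'k \<Rightarrow> 'm::ab_group_add \<Rightarrow> 'm" +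
  fixes act :: "'g \<Rightarrow> 'm \<Rightarrow> 'm"
  assumes linear_act_right: "Vector_Spaces.linear scaleM scaleM (act x)"
    and linear_act_left: "Vector_Spaces.linear scale scaleM (\<lambda>x. act x m)"
    and act_bracket: "act (bracket x y) m = act x (act y m) - act y (act x m)"

context lie_algebra
begin

lemma bracket_add:
  "bracket x (y + z) = bracket x y + bracket x z"
  "bracket (y + z) x = bracket y x + bracket z x"
  using linear_bracket_right[of x] linear_bracket_left[of x]
  by (auto simp: Vector_Spaces.linear_iff_module_hom dest: module_hom.add)

lemma bracket_scale:
  "bracket x (scale c y) = scale c (bracket x y)"
  "bracket (scale c y) x = scale c (bracket y x)"
  using linear_bracket_right[of x] linear_bracket_left[of x]
  by (auto simp: Vector_Spaces.linear_iff_module_hom dest: module_hom.scale)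

lemma bracket_skew: "bracket x y = - bracket y x"
proof -
  have "bracket x y + bracket y x = 0"
    using bracket_self[of "x + y"] unfolding bracket_add by (simp add: bracket_self add.commute)
  then show ?thesis
    by (simp add: eq_neg_iff_add_eq_0)
qed

lemma bracket_minus_right: "bracket x (- y) = - bracket x y"
proof -
  have "bracket x (- y) + bracket x y = bracket x 0"
    by (simp flip: bracket_add)
  then show ?thesis
    using bracket_scale(1)[of x 0 0] by (simp add: eq_neg_iff_add_eq_0)
qed

lemma adjoint_module: "lie_module scale bracket scale bracket"
proof unfold_locales
  show "bracket (bracket x y) m = bracket x (bracket y m) - bracket y (bracket x m)" for x y m
    using jacobi[of x y m] bracket_skew[of m "bracket x y"] bracket_skew[of m x] bracket_minus_right[of y "bracket x m"]
    by (simp add: algebra_simps)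
qed (auto simp: bracket_add bracket_scale)

lemma trivial_module: "vector_space scaleM \<Longrightarrow> lie_module scale bracket scaleM (\<lambda>_ _. 0)"
proof -
  assume "vector_space scaleM"
  then interpret M: vector_space scaleM .
  show ?thesis
    by unfold_locales auto
qed

end

section \<open>Quotients of modules\<close>

text \<open>The quotient of \<open>M\<close> by a submodule \<open>N\<close>, built from cosets in the same way as
  \<^const>\<open>FactRing\<close>. A module record inherits the fields \<open>mult\<close> and \<open>one\<close> from ring records;
  they play no role for modules and are filled arbitrarily.\<close>

definition quot_module :: "('a, 'b, 'c) module_scheme \<Rightarrow> 'b set \<Rightarrow> ('a, 'b set) module" where
  "quot_module M N =
    \<lparr>carrier = a_rcosets\<^bsub>M\<^esub> N, mult = (\<lambda>_ _. N), one = N, zero = N, add = set_add M,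
     smult = (\<lambda>c X. \<Union>x\<in>X. N +>\<^bsub>M\<^esub> (c \<odot>\<^bsub>M\<^esub> x))\<rparr>"

section \<open>Chevalley--Eilenberg cohomology\<close>

context lie_module
begin

text \<open>An \<open>n\<close>-cochain is an alternating \<open>n\<close>-linear map. Its \<open>n\<close> arguments are passed as a list;
  it is set to zero on lists of any other length, so that equality of cochains is equality
  of functions.\<close>

definition cochains :: "nat \<Rightarrow> ('g list \<Rightarrow> 'm) set" where
  "cochains n = {\<omega>.
     (\<forall>xs. length xs \<noteq> n \<longrightarrow> \<omega> xs = 0) \<and>
     (\<forall>xs i. length xs = n \<longrightarrow> i < n \<longrightarrow> Vector_Spaces.linear scale scaleM (\<lambda>v. \<omega> (xs[i := v]))) \<and>
     (\<forall>xs. length xs = n \<longrightarrow> \<not> distinct xs \<longrightarrow> \<omega> xs = 0)}"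

text \<open>The arguments are \<open>x\<^sub>0, \<dots>, x\<^sub>n\<close>; the list \<open>nths xs (- I)\<close> is \<open>xs\<close> with
  the positions in \<open>I\<close> omitted.\<close>

definition coboundary :: "nat \<Rightarrow> ('g list \<Rightarrow> 'm) \<Rightarrow> 'g list \<Rightarrow> 'm" where
  "coboundary n \<omega> xs =
    (if length xs = Suc n then
       (\<Sum>i\<le>n. scaleM ((-1) ^ i) (act (xs ! i) (\<omega> (nths xs (- {i}))))) +
       (\<Sum>j\<le>n. \<Sum>i<j. scaleM ((-1) ^ (i + j)) (\<omega> (bracket (xs ! i) (xs ! j) # nths xs (- {i, j}))))
     else 0)"

definition cocycles :: "nat \<Rightarrow> ('g list \<Rightarrow> 'm) set" where
  "cocycles n = {\<omega> \<in> cochains n. coboundary n \<omega> = (\<lambda>_. 0)}"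

definition coboundaries :: "nat \<Rightarrow> ('g list \<Rightarrow> 'm) set" where
  "coboundaries n = (case n of 0 \<Rightarrow> {\<lambda>_. 0} | Suc m \<Rightarrow> coboundary m ` cochains m)"

definition cocycle_module :: "nat \<Rightarrow> ('k, 'g list \<Rightarrow> 'm) module" where
  "cocycle_module n =
    \<lparr>carrier = cocycles n, mult = (\<lambda>_ _ _. 0), one = (\<lambda>_. 0), zero = (\<lambda>_. 0),
     add = (\<lambda>\<phi> \<psi> xs. \<phi> xs + \<psi> xs), smult = (\<lambda>c \<phi> xs. scaleM c (\<phi> xs))\<rparr>"

definition cohomology :: "nat \<Rightarrow> ('k, ('g list \<Rightarrow> 'm) set) module" where
  "cohomology n = quot_module (cocycle_module n) (coboundaries n)"

end

section \<open>The Lie algebra $L_{25}$\<close>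

text \<open>The index type \<open>25\<close> is the integers modulo 25, so \<open>e\<^sub>2\<^sub>5\<close> is the basis vector
  with index \<open>0\<close>.\<close>

definition L25_e :: "nat \<Rightarrow> complex ^ 25" where
  "L25_e i = axis (of_nat i) 1"

text \<open>A tuple \<open>(i, j, c, k)\<close> in the lists below stands for \<open>[e\<^sub>i, e\<^sub>j] = c e\<^sub>k\<close>.
  For an irreducible summand \<open>f\<^sub>0 = e\<^sub>s, \<dots>, f\<^sub>m\<close> of \<open>L\<^sub>2\<^sub>5\<close> under \<open>\<langle>e\<^sub>1, e\<^sub>2, e\<^sub>3\<rangle>\<close>, the terms
  with \<open>f\<^bsub>-1\<^esub>\<close> and \<open>f\<^bsub>m+1\<^esub>\<close> have coefficient zero.\<close>

definition L25_sl2_action :: "nat \<Rightarrow> nat \<Rightarrow> (nat \<times> nat \<times> int \<times> nat) list" where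
  "L25_sl2_action s m = concat (map (\<lambda>i.
     [(1, s + i, int i, s + i - 1),
      (2, s + i, int m - int i, s + i + 1),
      (3, s + i, int m - 2 * int i, s + i)]) [0..<m + 1])"

definition L25_table :: "(nat \<times> nat \<times> int \<times> nat) list" where
  "L25_table =
     [(1,2,1,3), (1,3,-2,1), (2,3,2,2)] @
     L25_sl2_action 4 6 @ L25_sl2_action 11 4 @ L25_sl2_action 16 6 @ L25_sl2_action 23 2 @
     [(4,7,3,16), (4,8,12,17), (4,9,30,18), (4,10,60,19), (5,6,-2,16),
      (5,7,-3,17), (5,9,10,19), (5,10,30,20), (6,7,-3,18), (6,8,-4,19),
      (6,10,12,21), (7,8,-3,20), (7,9,-3,21), (7,10,3,22), (8,9,-2,22)] @
     [(4,15,60,23), (5,14,-10,23), (5,15,20,24), (6,13,4,23), (6,14,-8,24),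
      (6,15,4,25), (7,12,-3,23), (7,13,6,24), (7,14,-3,25), (8,11,4,23),
      (8,12,-8,24), (8,13,4,25), (9,11,20,24), (9,12,-10,25), (10,11,60,25)] @
     [(11,14,2,23), (11,15,8,24), (12,13,-1,23), (12,14,-1,24), (12,15,2,25),
      (13,14,-1,25)] @
     [(4,21,15,23), (4,22,90,24), (5,20,-5,23), (5,21,-10,24), (5,22,15,25),
      (6,19,3,23), (6,20,2,24), (6,21,-5,25), (7,18,-3,23), (7,20,3,25),
      (8,17,5,23), (8,18,-2,24), (8,19,-3,25), (9,16,-15,23), (9,17,10,24),
      (9,18,5,25), (10,16,-90,24), (10,17,-15,25)]"

definition L25_bracket :: "complex ^ 25 \<Rightarrow> complex ^ 25 \<Rightarrow> complex ^ 25" where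
  "L25_bracket x y = (\<Sum>(i, j, c, k)\<leftarrow>L25_table.
     (of_int c * (x $ of_nat i * y $ of_nat j - x $ of_nat j * y $ of_nat i)) *s L25_e k)"

lemma bij_L25_index: "bij_betw (of_nat :: nat \<Rightarrow> 25) {1..25} UNIV"
proof -
  have *: "x = y" if "(of_nat x :: 25) = of_nat y" "x \<le> y" "x \<in> {1..25}" "y \<in> {1..25}" for x y
  proof -
    have "25 dvd y - x"
      using that of_nat_eq_iff_char_dvd[where 'a = 25, of x y] by (cases "x = y") auto
    then show "x = y"
      using that by (auto dest!: dvd_imp_le)
  qed
  have "inj_on (of_nat :: nat \<Rightarrow> 25) {1..25}"
    by (rule inj_onI) (metis * nle_le)
  moreover from this have "(of_nat :: nat \<Rightarrow> 25) ` {1..25} = UNIV"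
    by (intro card_subset_eq) (auto simp: card_image)
  ultimately show ?thesis
    by (simp add: bij_betw_def)
qed

lemma L25_vec_eqI:
  fixes x y :: "'a ^ 25"
  assumes "\<And>m. m \<in> {1..25} \<Longrightarrow> x $ of_nat m = y $ of_nat m"
  shows "x = y"
proof -
  have "x $ n = y $ n" for n
  proof -
    obtain m where "m \<in> {1..25}" "n = of_nat m"
      using bij_L25_index unfolding bij_betw_def by blast
    then show ?thesis
      using assms by simp
  qed
  then show ?thesis
    by (simp add: Finite_Cartesian_Product.vec_eq_iff)
qed

lemma L25_e_nth: "m \<in> {1..25} \<Longrightarrow> k \<in> {1..25} \<Longrightarrow> L25_e k $ of_nat m = (if k = m then 1 else 0)"
  using bij_betw_imp_inj_on[OF bij_L25_index] by (auto simp: L25_e_def axis_def dest: inj_onD)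

context
  notes upt_rec [simp] L25_table_def [simp] L25_sl2_action_def [simp]
begin

lemma L25_table_range: "list_all (\<lambda>(i, j, c, k). i \<in> {1..25} \<and> j \<in> {1..25} \<and> (c = 0 \<or> k \<in> {1..25})) L25_table"
  by simp

lemma L25_table_less: "list_all (\<lambda>(i, j, c, k). i < j) L25_table"
  by simp

lemma distinct_L25_table: "distinct (map (\<lambda>(i, j, c, k). (i, j)) L25_table)"
  by simp

end

lemma L25_bracket_nth:
  assumes "m \<in> {1..25}"
  shows "L25_bracket x y $ of_nat m = (\<Sum>(i, j, c, k)\<leftarrow>L25_table.
    if k = m then of_int c * (x $ of_nat i * y $ of_nat j - x $ of_nat j * y $ of_nat i) else 0)"
proof -
  have *: "(\<Sum>t\<leftarrow>ts. f t) $ n = (\<Sum>t\<leftarrow>ts. f t $ n)" for f :: "'t \<Rightarrow> complex ^ 25" and ts n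
    by (induction ts) auto
  show ?thesis
    unfolding L25_bracket_def *
  proof (intro arg_cong[of _ _ sum_list] map_cong refl, clarify)
    fix i j c k assume "(i, j, c, k) \<in> set L25_table"
    then have "c = 0 \<or> k \<in> {1..25}"
      using L25_table_range by (auto simp: list_all_iff)
    then show "((of_int c * (x $ of_nat i * y $ of_nat j - x $ of_nat j * y $ of_nat i)) *s L25_e k) $ of_nat m =
        (if k = m then of_int c * (x $ of_nat i * y $ of_nat j - x $ of_nat j * y $ of_nat i) else 0)"
      using assms by (auto simp: L25_e_nth)
  qed
qed

context
  notes upt_rec [simp] L25_table_def [simp] L25_sl2_action_def [simp]
begin

lemmas L25_bracket_nth_simps =
  L25_bracket_nth[of 1, simplified] L25_bracket_nth[of 2, simplified]
  L25_bracket_nth[of 3, simplified] L25_bracket_nth[of 4, simplified]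
  L25_bracket_nth[of 5, simplified] L25_bracket_nth[of 6, simplified]
  L25_bracket_nth[of 7, simplified] L25_bracket_nth[of 8, simplified]
  L25_bracket_nth[of 9, simplified] L25_bracket_nth[of 10, simplified]
  L25_bracket_nth[of 11, simplified] L25_bracket_nth[of 12, simplified]
  L25_bracket_nth[of 13, simplified] L25_bracket_nth[of 14, simplified]
  L25_bracket_nth[of 15, simplified] L25_bracket_nth[of 16, simplified]
  L25_bracket_nth[of 17, simplified] L25_bracket_nth[of 18, simplified]
  L25_bracket_nth[of 19, simplified] L25_bracket_nth[of 20, simplified]
  L25_bracket_nth[of 21, simplified] L25_bracket_nth[of 22, simplified]
  L25_bracket_nth[of 23, simplified] L25_bracket_nth[of 24, simplified]
  L25_bracket_nth[of 25, simplified]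

end

lemma L25_jacobi:
  "L25_bracket x (L25_bracket y z) + L25_bracket y (L25_bracket z x) + L25_bracket z (L25_bracket x y) = 0"
  (is "?J = 0")
proof -
  have "?J $ 1 = 0" "?J $ 2 = 0" "?J $ 3 = 0" "?J $ 4 = 0" "?J $ 5 = 0"
    "?J $ 6 = 0" "?J $ 7 = 0" "?J $ 8 = 0" "?J $ 9 = 0" "?J $ 10 = 0"
    "?J $ 11 = 0" "?J $ 12 = 0" "?J $ 13 = 0" "?J $ 14 = 0" "?J $ 15 = 0"
    "?J $ 16 = 0" "?J $ 17 = 0" "?J $ 18 = 0" "?J $ 19 = 0" "?J $ 20 = 0"
    "?J $ 21 = 0" "?J $ 22 = 0" "?J $ 23 = 0" "?J $ 24 = 0" "?J $ 25 = 0"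
    unfolding vector_add_component L25_bracket_nth_simps by Groebner_Basis.algebra+
  then have "list_all (\<lambda>m. ?J $ of_nat m = 0) [1..<26]"
    by (simp add: upt_rec)
  then have "?J $ of_nat m = 0 $ of_nat m" if "m \<in> {1..25}" for m
    using that by (auto simp: list_all_iff)
  then show ?thesis
    by (rule L25_vec_eqI)
qed

lemma L25_bracket_self: "L25_bracket x x = 0"
proof -
  have "(\<Sum>(i, j, c, k)\<leftarrow>ts. (of_int c * (x $ of_nat i * x $ of_nat j - x $ of_nat j * x $ of_nat i)) *s L25_e k) = 0" for ts
    by (induction ts) auto
  then show ?thesis
    by (simp add: L25_bracket_def)
qed

lemma L25_bracket_add:
  "L25_bracket x (y + z) = L25_bracket x y + L25_bracket x z"
  "L25_bracket (y + z) x = L25_bracket y x + L25_bracket z x"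
  unfolding L25_bracket_def sum_list_addf[symmetric]
  by (intro arg_cong[of _ _ sum_list] map_cong refl; force simp: algebra_simps vector_add_ldistrib Finite_Cartesian_Product.vec_eq_iff)+

lemma L25_bracket_scale:
  "L25_bracket x (a *s y) = a *s L25_bracket x y"
  "L25_bracket (a *s y) x = a *s L25_bracket y x"
proof -
  have *: "a *s (\<Sum>t\<leftarrow>ts. f t) = (\<Sum>t\<leftarrow>ts. a *s f t)" for f :: "'t \<Rightarrow> complex ^ 25" and ts
    by (induction ts) (auto simp: vector_add_ldistrib)
  show "L25_bracket x (a *s y) = a *s L25_bracket x y" "L25_bracket (a *s y) x = a *s L25_bracket y x"
    unfolding L25_bracket_def *
    by (intro arg_cong[of _ _ sum_list] map_cong refl; force simp: algebra_simps Finite_Cartesian_Product.vec_eq_iff)+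
qed

lemma L25_bracket_e:
  assumes "i \<in> {1..25}" "j \<in> {1..25}"
  shows "L25_bracket (L25_e i) (L25_e j) = (\<Sum>(i', j', c, k)\<leftarrow>L25_table.
    (if (i', j') = (i, j) then of_int c *s L25_e k else 0) -
    (if (i', j') = (j, i) then of_int c *s L25_e k else 0))"
  unfolding L25_bracket_def
proof (intro arg_cong[of _ _ sum_list] map_cong refl, clarify)
  fix i' j' c k assume "(i', j', c, k) \<in> set L25_table"
  then have "i' \<in> {1..25}" "j' \<in> {1..25}" "i' < j'"
    using L25_table_range L25_table_less by (auto simp: list_all_iff)
  then show "(of_int c * (L25_e i $ of_nat i' * L25_e j $ of_nat j' - L25_e i $ of_nat j' * L25_e j $ of_nat i')) *s L25_e k =
      (if (i', j') = (i, j) then of_int c *s L25_e k else 0) - (if (i', j') = (j, i) then of_int c *s L25_e k else 0)"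
    using assms by (simp only: L25_e_nth) (auto simp: Finite_Cartesian_Product.vec_eq_iff)
qed

lemma L25_bracket_table:
  assumes "(i, j, c, k) \<in> set L25_table"
  shows "L25_bracket (L25_e i) (L25_e j) = of_int c *s L25_e k"
proof -
  define f where "f = (\<lambda>(i', j', c, k).
    (if (i', j') = (i, j) then of_int c *s L25_e k else 0) -
    (if (i', j') = (j, i) then of_int c *s L25_e k else 0))"
  have "L25_bracket (L25_e i) (L25_e j) = sum_list (map f L25_table)"
    unfolding f_def using L25_table_range assms by (intro L25_bracket_e) (auto simp: list_all_iff)
  also have "\<dots> = sum f (set L25_table)"
    using distinct_L25_table by (intro sum_list_distinct_conv_sum_set) (simp add: distinct_map)
  also have "\<dots> = sum f {(i, j, c, k)}"
  proof (rule sum.mono_neutral_right)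
    show "\<forall>t\<in>set L25_table - {(i, j, c, k)}. f t = 0"
    proof
      fix t assume t: "t \<in> set L25_table - {(i, j, c, k)}"
      obtain i' j' c' k' where t_eq: "t = (i', j', c', k')"
        by (cases t)
      have inj: "inj_on (\<lambda>(i, j, c, k). (i, j)) (set L25_table)"
        using distinct_L25_table by (simp add: distinct_map)
      have "(i', j') \<noteq> (i, j)"
        using inj_onD[OF inj _ _ assms, of t] t by (auto simp: t_eq)
      moreover have "i < j" "i' < j'"
        using t assms L25_table_less by (auto simp: t_eq list_all_iff)
      ultimately show "f t = 0"
        by (auto simp: t_eq f_def)
    qed
  qed (use assms in auto)
  also have "\<dots> = of_int c *s L25_e k"
  proof -
    have "i < j"
      using L25_table_less assms by (auto simp: list_all_iff)
    then show ?thesis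
      by (simp add: f_def)
  qed
  finally show ?thesis .
qed

lemma L25_bracket_not_table:
  assumes "i \<in> {1..25}" "j \<in> {1..25}"
    and "\<forall>c k. (i, j, c, k) \<notin> set L25_table \<and> (j, i, c, k) \<notin> set L25_table"
  shows "L25_bracket (L25_e i) (L25_e j) = 0"
proof -
  have *: "sum_list (map f ts) = 0" if "\<And>t. t \<in> set ts \<Longrightarrow> f t = 0" for f :: "'t \<Rightarrow> complex ^ 25" and ts
    using that by (induction ts) auto
  show ?thesis
    unfolding L25_bracket_e[OF assms(1,2)]
  proof (rule *, clarify)
    fix i' j' c k assume "(i', j', c, k) \<in> set L25_table"
    then have "(i', j') \<noteq> (i, j)" "(i', j') \<noteq> (j, i)"
      using assms(3) by blast+
    then show "(if (i', j') = (i, j) then of_int c *s L25_e k else 0) -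
        (if (i', j') = (j, i) then of_int c *s L25_e k else 0) = 0"
      by (simp only: if_False diff_self)
  qed
qed

lemma lie_algebra_L25: "lie_algebra (*s) L25_bracket"
  by unfold_locales (auto simp: L25_bracket_add L25_bracket_scale L25_bracket_self L25_jacobi)

interpretation L25_trivial: lie_module "(*s)" L25_bracket "(*) :: complex \<Rightarrow> complex \<Rightarrow> complex" "\<lambda>_ _. 0"
  by (rule lie_algebra.trivial_module[OF lie_algebra_L25]) (unfold_locales, auto simp: algebra_simps)

interpretation L25_adjoint: lie_module "(*s)" L25_bracket "(*s)" L25_bracket
  by (rule lie_algebra.adjoint_module[OF lie_algebra_L25])

end

theory Submission
  imports Defs "HOL-Library.Function_Algebras"
begin

text \<open>The subalgebra \<open>\<langle>e\<^sub>1, e\<^sub>2, e\<^sub>3\<rangle>\<close> is \<open>\<ss>\<ll>\<^sub>2\<close>, and Cartan's formula makes its action on cohomology trivial.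
  Since cochains decompose into finitely many weights, every cocycle is therefore cohomologous to an
  \<open>\<ss>\<ll>\<^sub>2\<close>-invariant one. As an \<open>\<ss>\<ll>\<^sub>2\<close>-module, \<open>L\<^sub>2\<^sub>5\<close> is a sum of five irreducible modules, so an invariant cochain
  is a linear combination of transvectants and amounts to one number for each admissible triple of summands. In degree two
  there are 56 such numbers; the cocycle condition leaves ten of them free, and invariant coboundaries account for nine.\<close>

section \<open>One-dimensional quotients\<close>

text \<open>A 2-cochain with adjoint values on a 25-dimensional algebra has 7500 coefficients, far
  too many to eliminate directly; invariance makes the linear system small enough to be solved one
  equation at a time. Complete reducibility is not invoked for this. The projection to invariants is
  an explicit product of factors in \<open>H\<close> and \<open>F E\<close>, and on a cocycle
  Cartan's formula turns every subtracted term into a coboundary, so that the class is preserved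
  along the way. The number nine is the dimension of the space of invariant endomorphisms: the
  highest weights of the five blocks are 2, 6, 4, 6, 2, which gives 4 + 4 + 1 scalars, and no
  nonzero invariant endomorphism is a derivation. These scalars can be chosen to cancel nine of the
  ten free couplings; the remaining one, at the blocks \<open>(2, 3, 4)\<close>, then measures the
  multiple of \<open>L25_omega\<close>. The invariant equations only bound the dimension by one;
  that \<open>L25_omega\<close> is not a coboundary is checked against arbitrary linear
  maps.\<close>

lemma module_quot_module:
  assumes "module R M" and "abelian_subgroup N M"
    and smult_N: "\<And>c x. c \<in> carrier R \<Longrightarrow> x \<in> N \<Longrightarrow> c \<odot>\<^bsub>M\<^esub> x \<in> N"
  shows "module R (quot_module M N)"
    and "\<And>c x. c \<in> carrier R \<Longrightarrow> x \<in> carrier M \<Longrightarrow>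
      c \<odot>\<^bsub>quot_module M N\<^esub> (N +>\<^bsub>M\<^esub> x) = N +>\<^bsub>M\<^esub> (c \<odot>\<^bsub>M\<^esub> x)"
proof -
  interpret module R M by fact
  interpret N: abelian_subgroup N M by fact
  let ?Q = "quot_module M N"
  have N_sub: "N \<subseteq> carrier M"
    by (rule N.a_subset)
  have carrier_Q: "carrier ?Q = a_rcosets\<^bsub>M\<^esub> N" and add_Q: "X \<oplus>\<^bsub>?Q\<^esub> Y = X <+>\<^bsub>M\<^esub> Y" and zero_Q: "\<zero>\<^bsub>?Q\<^esub> = N" for X Y
    by (simp_all add: quot_module_def)
  have coset: "\<exists>x\<in>carrier M. X = N +>\<^bsub>M\<^esub> x" if "X \<in> carrier ?Q" for X
    using that by (auto simp: carrier_Q A_RCOSETS_def' )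
  have cosetI: "N +>\<^bsub>M\<^esub> x \<in> carrier ?Q" if "x \<in> carrier M" for x
    using that N_sub a_rcosetsI by (auto simp: carrier_Q)
  show smult_coset: "c \<odot>\<^bsub>?Q\<^esub> (N +>\<^bsub>M\<^esub> x) = N +>\<^bsub>M\<^esub> (c \<odot>\<^bsub>M\<^esub> x)"
    if c: "c \<in> carrier R" and x: "x \<in> carrier M" for c x
  proof -
    \<comment> \<open>The scalar multiple of a coset is defined as a union over all its
      representatives. They all yield the same coset, so the union is that coset and scalars can be
      applied to any representative.\<close>
    have "N +>\<^bsub>M\<^esub> (c \<odot>\<^bsub>M\<^esub> y) = N +>\<^bsub>M\<^esub> (c \<odot>\<^bsub>M\<^esub> x)" if y: "y \<in> N +>\<^bsub>M\<^esub> x" for y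
    proof -
      obtain h where h: "h \<in> N" "y = h \<oplus>\<^bsub>M\<^esub> x"
        using y by (auto simp: a_r_coset_def')
      have "c \<odot>\<^bsub>M\<^esub> y = c \<odot>\<^bsub>M\<^esub> h \<oplus>\<^bsub>M\<^esub> c \<odot>\<^bsub>M\<^esub> x"
        using h c x N_sub by (auto simp: smult_r_distr)
      then have "c \<odot>\<^bsub>M\<^esub> y \<in> N +>\<^bsub>M\<^esub> (c \<odot>\<^bsub>M\<^esub> x)"
        using smult_N[OF c h(1)] by (auto simp: a_r_coset_def')
      then show ?thesis
        using N.a_repr_independence' c x by auto
    qed
    moreover have "x \<in> N +>\<^bsub>M\<^esub> x"
      using x N.a_rcos_self by auto
    ultimately have "(\<Union>y\<in>N +>\<^bsub>M\<^esub> x. N +>\<^bsub>M\<^esub> (c \<odot>\<^bsub>M\<^esub> y)) = N +>\<^bsub>M\<^esub> (c \<odot>\<^bsub>M\<^esub> x)"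
      by blast
    then show ?thesis
      by (simp add: quot_module_def)
  qed
  have add_coset: "(N +>\<^bsub>M\<^esub> x) \<oplus>\<^bsub>?Q\<^esub> (N +>\<^bsub>M\<^esub> y) = N +>\<^bsub>M\<^esub> (x \<oplus>\<^bsub>M\<^esub> y)"
    if "x \<in> carrier M" "y \<in> carrier M" for x y
    using that by (simp add: add_Q N.a_rcos_sum)
  have zero_coset: "\<zero>\<^bsub>?Q\<^esub> = N +>\<^bsub>M\<^esub> \<zero>\<^bsub>M\<^esub>"
    using N_sub by (simp add: zero_Q)
  have ab: "abelian_group ?Q"
  proof (rule abelian_groupI)
    show "X \<oplus>\<^bsub>?Q\<^esub> Y \<in> carrier ?Q" if "X \<in> carrier ?Q" "Y \<in> carrier ?Q" for X Y
      using coset[OF that(1)] coset[OF that(2)] by (auto simp: add_coset intro!: cosetI)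
    show "\<zero>\<^bsub>?Q\<^esub> \<in> carrier ?Q"
      by (simp add: zero_coset cosetI)
    show "(X \<oplus>\<^bsub>?Q\<^esub> Y) \<oplus>\<^bsub>?Q\<^esub> Z = X \<oplus>\<^bsub>?Q\<^esub> (Y \<oplus>\<^bsub>?Q\<^esub> Z)"
      if "X \<in> carrier ?Q" "Y \<in> carrier ?Q" "Z \<in> carrier ?Q" for X Y Z
      using coset[OF that(1)] coset[OF that(2)] coset[OF that(3)] by (auto simp: add_coset M.a_assoc)
    show "X \<oplus>\<^bsub>?Q\<^esub> Y = Y \<oplus>\<^bsub>?Q\<^esub> X" if "X \<in> carrier ?Q" "Y \<in> carrier ?Q" for X Y
      using coset[OF that(1)] coset[OF that(2)] by (auto simp: add_coset M.a_comm)
    show "\<zero>\<^bsub>?Q\<^esub> \<oplus>\<^bsub>?Q\<^esub> X = X" if "X \<in> carrier ?Q" for X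
      using coset[OF that] by (auto simp: zero_coset add_coset)
    show "\<exists>Y\<in>carrier ?Q. Y \<oplus>\<^bsub>?Q\<^esub> X = \<zero>\<^bsub>?Q\<^esub>" if X: "X \<in> carrier ?Q" for X
    proof -
      obtain x where x: "x \<in> carrier M" "X = N +>\<^bsub>M\<^esub> x"
        using coset[OF X] by blast
      then have "(N +>\<^bsub>M\<^esub> (\<ominus>\<^bsub>M\<^esub> x)) \<oplus>\<^bsub>?Q\<^esub> X = \<zero>\<^bsub>?Q\<^esub>"
        by (simp add: zero_coset add_coset M.l_neg)
      then show ?thesis
        using cosetI x by blast
    qed
  qed
  show "module R ?Q"
  proof (rule moduleI[OF R.is_cring ab])
    show "c \<odot>\<^bsub>?Q\<^esub> X \<in> carrier ?Q" if c: "c \<in> carrier R" and X: "X \<in> carrier ?Q" for c X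
      using coset[OF X] c cosetI smult_coset by (metis smult_closed)
    show "(a \<oplus>\<^bsub>R\<^esub> b) \<odot>\<^bsub>?Q\<^esub> X = a \<odot>\<^bsub>?Q\<^esub> X \<oplus>\<^bsub>?Q\<^esub> b \<odot>\<^bsub>?Q\<^esub> X"
      if "a \<in> carrier R" "b \<in> carrier R" and X: "X \<in> carrier ?Q" for a b X
      using coset[OF X] that by (auto simp: smult_coset add_coset smult_l_distr)
    show "a \<odot>\<^bsub>?Q\<^esub> (X \<oplus>\<^bsub>?Q\<^esub> Y) = a \<odot>\<^bsub>?Q\<^esub> X \<oplus>\<^bsub>?Q\<^esub> a \<odot>\<^bsub>?Q\<^esub> Y"
      if "a \<in> carrier R" and X: "X \<in> carrier ?Q" and Y: "Y \<in> carrier ?Q" for a X Y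
      using coset[OF X] coset[OF Y] that by (auto simp: smult_coset add_coset smult_r_distr)
    show "(a \<otimes>\<^bsub>R\<^esub> b) \<odot>\<^bsub>?Q\<^esub> X = a \<odot>\<^bsub>?Q\<^esub> (b \<odot>\<^bsub>?Q\<^esub> X)"
      if "a \<in> carrier R" "b \<in> carrier R" and X: "X \<in> carrier ?Q" for a b X
      using coset[OF X] that by (auto simp: smult_coset smult_assoc1)
    show "\<one>\<^bsub>R\<^esub> \<odot>\<^bsub>?Q\<^esub> X = X" if X: "X \<in> carrier ?Q" for X
      using coset[OF X] by (auto simp: smult_coset)
  qed
qed

lemma (in vectorspace) dim_eq_1:
  assumes v: "v \<in> carrier V" "v \<noteq> \<zero>\<^bsub>V\<^esub>"
    and span_v: "\<And>w. w \<in> carrier V \<Longrightarrow> \<exists>c\<in>carrier K. w = c \<odot>\<^bsub>V\<^esub> v"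
  shows "fin_dim \<and> dim = 1"
proof -
  have "carrier V \<subseteq> span {v}"
  proof
    fix w assume "w \<in> carrier V"
    then obtain c where c: "c \<in> carrier K" "w = c \<odot>\<^bsub>V\<^esub> v"
      using span_v by blast
    have "lincomb (\<lambda>_. c) {v} = w"
      using c v by (simp add: lincomb_def)
    then show "w \<in> span {v}"
      using c unfolding span_def by (auto intro!: exI[of _ "\<lambda>_. c"] exI[of _ "{v}"])
  qed
  then have gen: "gen_set {v}"
    using span_is_subset2[of "{v}"] v by auto
  then have fd: fin_dim
    using v unfolding fin_dim_def by blast
  have "dim \<le> 1"
    using gen_ge_dim[of "{v}"] gen v by simp
  moreover have "dim \<noteq> 0"
  proof
    assume "dim = 0"
    obtain A where A: "finite A" "basis A"
      using finite_basis_exists[OF fd] by blast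
    then have "A = {}"
      using dim_basis[OF A] \<open>dim = 0\<close> by simp
    then have "carrier V = span {}"
      using A by (simp add: basis_def)
    then show False
      using v by (auto simp: span_def lincomb_def)
  qed
  ultimately show ?thesis
    using fd by simp
qed

section \<open>Cochain modules\<close>

context lie_module
begin

lemma act_add: "act x (m + m') = act x m + act x m'" "act (x + y) m = act x m + act y m"
  using linear_act_right[of x] linear_act_left[of m]
  by (auto simp: Vector_Spaces.linear_iff_module_hom dest: module_hom.add)

lemma act_scale: "act x (scaleM c m) = scaleM c (act x m)" "act (scale c x) m = scaleM c (act x m)"
  using linear_act_right[of x] linear_act_left[of m]
  by (auto simp: Vector_Spaces.linear_iff_module_hom dest: module_hom.scale)

lemma act_zero: "act x 0 = 0" "act 0 m = 0"
  using act_scale[where c = 0] by auto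

lemma act_minus: "act x (- m) = - act x m" "act (- x) m = - act x m"
  using act_add(1)[of x m "- m"] act_add(2)[of x "- x" m] by (simp_all add: act_zero eq_neg_iff_add_eq_0 add.commute)

lemma act_diff: "act x (m - m') = act x m - act x m'"
  using act_add(1)[of x m "- m'"] by (simp add: act_minus)

lemma linear_addI: "Vector_Spaces.linear scale scaleM f \<Longrightarrow> Vector_Spaces.linear scale scaleM g \<Longrightarrow>
    Vector_Spaces.linear scale scaleM (\<lambda>x. f x + g x)"
  by (simp add: Vector_Spaces.linear_iff M.scale_right_distrib vector_space_axioms M.vector_space_axioms algebra_simps)

lemma linear_scaleI: "Vector_Spaces.linear scale scaleM f \<Longrightarrow> Vector_Spaces.linear scale scaleM (\<lambda>x. scaleM c (f x))"
  by (simp add: Vector_Spaces.linear_iff M.scale_right_distrib vector_space_axioms M.vector_space_axioms mult.commute)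

lemma linear_zeroI: "Vector_Spaces.linear scale scaleM (\<lambda>x. 0)"
  by (simp add: Vector_Spaces.linear_iff vector_space_axioms M.vector_space_axioms)

lemma cochains_add: "\<phi> \<in> cochains n \<Longrightarrow> \<psi> \<in> cochains n \<Longrightarrow> (\<lambda>xs. \<phi> xs + \<psi> xs) \<in> cochains n"
  by (auto simp: cochains_def intro!: linear_addI)

lemma cochains_scale: "\<phi> \<in> cochains n \<Longrightarrow> (\<lambda>xs. scaleM c (\<phi> xs)) \<in> cochains n"
  by (auto simp: cochains_def intro!: linear_scaleI)

lemma cochains_zero: "(\<lambda>_. 0) \<in> cochains n"
  by (auto simp: cochains_def intro!: linear_zeroI)

lemma coboundary_add:
  "coboundary n (\<lambda>xs. \<phi> xs + \<psi> xs) = (\<lambda>xs. coboundary n \<phi> xs + coboundary n \<psi> xs)"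
  by (rule ext) (simp add: coboundary_def act_add M.scale_right_distrib sum.distrib)

lemma coboundary_scale:
  "coboundary n (\<lambda>xs. scaleM c (\<phi> xs)) = (\<lambda>xs. scaleM c (coboundary n \<phi> xs))"
  by (rule ext) (simp add: coboundary_def act_scale M.scale_sum_right M.scale_right_distrib mult.commute)

lemma coboundary_zero: "coboundary n (\<lambda>_. 0) = (\<lambda>_. 0)"
  by (rule ext) (simp add: coboundary_def act_zero)

lemma cocycles_add: "\<phi> \<in> cocycles n \<Longrightarrow> \<psi> \<in> cocycles n \<Longrightarrow> (\<lambda>xs. \<phi> xs + \<psi> xs) \<in> cocycles n"
  by (auto simp: cocycles_def cochains_add coboundary_add)

lemma cocycles_scale: "\<phi> \<in> cocycles n \<Longrightarrow> (\<lambda>xs. scaleM c (\<phi> xs)) \<in> cocycles n"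
  by (auto simp: cocycles_def cochains_scale coboundary_scale)

lemma cocycles_zero: "(\<lambda>_. 0) \<in> cocycles n"
  by (auto simp: cocycles_def cochains_zero coboundary_zero)

lemma coboundaries_add: "\<phi> \<in> coboundaries n \<Longrightarrow> \<psi> \<in> coboundaries n \<Longrightarrow> (\<lambda>xs. \<phi> xs + \<psi> xs) \<in> coboundaries n"
  by (auto simp: coboundaries_def coboundary_add[symmetric] cochains_add split: nat.splits)

lemma coboundaries_scale: "\<phi> \<in> coboundaries n \<Longrightarrow> (\<lambda>xs. scaleM c (\<phi> xs)) \<in> coboundaries n"
  by (auto simp: coboundaries_def coboundary_scale[symmetric] cochains_scale split: nat.splits)

lemma coboundaries_zero: "(\<lambda>_. 0) \<in> coboundaries n"
  using coboundary_zero[symmetric] cochains_zero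
  by (auto simp: coboundaries_def split: nat.splits)

section \<open>The module of cocycles and criteria for its quotient\<close>

lemma module_cocycle_module: "module class_ring (cocycle_module n)"
proof (rule moduleI)
  show "abelian_group (cocycle_module n)"
  proof (rule abelian_groupI)
    show "\<exists>\<psi>\<in>carrier (cocycle_module n). \<psi> \<oplus>\<^bsub>cocycle_module n\<^esub> \<phi> = \<zero>\<^bsub>cocycle_module n\<^esub>"
      if "\<phi> \<in> carrier (cocycle_module n)" for \<phi>
      using that by (intro bexI[of _ "\<lambda>xs. scaleM (- 1) (\<phi> xs)"]) (use that cocycles_scale[of \<phi> n "- 1"] in \<open>auto simp: cocycle_module_def\<close>)
  qed (auto simp: cocycle_module_def cocycles_add cocycles_zero algebra_simps)
qed (auto simp: cocycle_module_def cocycles_add cocycles_scale M.scale_left_distrib M.scale_right_distrib class_cring.is_cring)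

text \<open>The inclusion is a hypothesis because \<open>d d = 0\<close> is verified only in the
  degrees that occur, by \<open>coboundaries_1_subset\<close> and
  \<open>coboundaries_2_subset\<close>; in degree 0 the only coboundary is zero.\<close>

lemma abelian_subgroup_coboundaries:
  assumes "coboundaries n \<subseteq> cocycles n"
  shows "abelian_subgroup (coboundaries n) (cocycle_module n)"
proof -
  interpret Z: module "class_ring :: 'k ring" "cocycle_module n"
    by (rule module_cocycle_module)
  show ?thesis
  proof (rule abelian_subgroupI3)
    have "subgroup (coboundaries n) (add_monoid (cocycle_module n))"
    proof (rule group.subgroupI[OF Z.M.a_group])
      show "coboundaries n \<subseteq> carrier (add_monoid (cocycle_module n))" "coboundaries n \<noteq> {}"
        using assms coboundaries_zero by (auto simp: cocycle_module_def)
      fix \<phi> assume \<phi>: "\<phi> \<in> coboundaries n"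
      have "inv\<^bsub>add_monoid (cocycle_module n)\<^esub> \<phi> = (\<lambda>xs. scaleM (- 1) (\<phi> xs))"
        using \<phi> assms cocycles_scale[of \<phi> n "- 1"]
        by (intro group.inv_equality[OF Z.M.a_group]) (auto simp: cocycle_module_def)
      then show "inv\<^bsub>add_monoid (cocycle_module n)\<^esub> \<phi> \<in> coboundaries n"
        using coboundaries_scale[OF \<phi>, of "- 1"] by simp
      fix \<psi> assume "\<psi> \<in> coboundaries n"
      then show "\<phi> \<otimes>\<^bsub>add_monoid (cocycle_module n)\<^esub> \<psi> \<in> coboundaries n"
        using \<phi> by (simp add: cocycle_module_def coboundaries_add)
    qed
    then show "additive_subgroup (coboundaries n) (cocycle_module n)"
      by (rule additive_subgroup.intro)
  qed (rule Z.M.abelian_group_axioms)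
qed

lemma cohomology_eq_0I:
  assumes "coboundaries n \<subseteq> cocycles n" "cocycles n \<subseteq> coboundaries n"
  shows "carrier (cohomology n) = {\<zero>\<^bsub>cohomology n\<^esub>}"
proof -
  interpret abelian_subgroup "coboundaries n" "cocycle_module n"
    by (rule abelian_subgroup_coboundaries[OF assms(1)])
  have "coboundaries n +>\<^bsub>cocycle_module n\<^esub> \<phi> = coboundaries n" if "\<phi> \<in> cocycles n" for \<phi>
    using that assms(2) by (intro a_rcos_const) auto
  then have "a_rcosets\<^bsub>cocycle_module n\<^esub> coboundaries n = {coboundaries n}"
    using cocycles_zero unfolding A_RCOSETS_def' by (auto simp: cocycle_module_def)
  then show ?thesis
    by (simp add: cohomology_def quot_module_def)
qed

lemma dim_cohomology_eq_1I:
  assumes sub: "coboundaries n \<subseteq> cocycles n"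
    and \<omega>: "\<omega> \<in> cocycles n" "\<omega> \<notin> coboundaries n"
    and span: "\<And>\<phi>. \<phi> \<in> cocycles n \<Longrightarrow> \<exists>c. \<exists>\<beta>\<in>coboundaries n. \<phi> = (\<lambda>xs. \<beta> xs + scaleM c (\<omega> xs))"
  shows "vectorspace.fin_dim class_ring (cohomology n) \<and> vectorspace.dim class_ring (cohomology n) = 1"
proof -
  interpret N: abelian_subgroup "coboundaries n" "cocycle_module n"
    by (rule abelian_subgroup_coboundaries[OF sub])
  have smult: "c \<odot>\<^bsub>cocycle_module n\<^esub> \<phi> \<in> coboundaries n" if "\<phi> \<in> coboundaries n" for c \<phi>
    using coboundaries_scale[OF that] by (simp add: cocycle_module_def)
  have carrier: "carrier (cohomology n) = {coboundaries n +>\<^bsub>cocycle_module n\<^esub> \<phi> | \<phi>. \<phi> \<in> cocycles n}"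
    by (auto simp: cohomology_def quot_module_def A_RCOSETS_def' cocycle_module_def)
  note quot = module_quot_module[OF module_cocycle_module abelian_subgroup_coboundaries[OF sub] smult, folded cohomology_def]
  interpret V: vectorspace class_ring "cohomology n"
    using quot(1) by (simp add: vectorspace_def class_field)
  show ?thesis
  proof (rule V.dim_eq_1)
    show "coboundaries n +>\<^bsub>cocycle_module n\<^esub> \<omega> \<in> carrier (cohomology n)"
      using \<omega> by (auto simp: carrier)
    show "coboundaries n +>\<^bsub>cocycle_module n\<^esub> \<omega> \<noteq> \<zero>\<^bsub>cohomology n\<^esub>"
      using N.a_rcos_self[of \<omega>] \<omega> by (auto simp: cohomology_def quot_module_def cocycle_module_def)
    fix X assume "X \<in> carrier (cohomology n)"
    then obtain \<phi> where \<phi>: "\<phi> \<in> cocycles n" "X = coboundaries n +>\<^bsub>cocycle_module n\<^esub> \<phi>"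
      by (auto simp: carrier)
    obtain c \<beta> where c: "\<beta> \<in> coboundaries n" "\<phi> = (\<lambda>xs. \<beta> xs + scaleM c (\<omega> xs))"
      using span[OF \<phi>(1)] by blast
    then have "\<phi> \<in> coboundaries n +>\<^bsub>cocycle_module n\<^esub> (\<lambda>xs. scaleM c (\<omega> xs))"
      by (auto simp: a_r_coset_def' cocycle_module_def)
    then have "X = coboundaries n +>\<^bsub>cocycle_module n\<^esub> (\<lambda>xs. scaleM c (\<omega> xs))"
      using N.a_repr_independence' \<phi>(2) cocycles_scale[OF \<omega>(1), of c] by (simp add: cocycle_module_def)
    then show "\<exists>c\<in>carrier class_ring. X = c \<odot>\<^bsub>cohomology n\<^esub> (coboundaries n +>\<^bsub>cocycle_module n\<^esub> \<omega>)"
      using quot(2)[of c \<omega>] \<omega> by (auto simp: cocycle_module_def)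
  qed
qed

end

section \<open>Cochains of degree one and two as maps\<close>

context lie_module
begin

abbreviation linear_map :: "('g \<Rightarrow> 'm) \<Rightarrow> bool" where
  "linear_map \<equiv> Vector_Spaces.linear scale scaleM"

lemma linear_map_iff: "linear_map f \<longleftrightarrow> (\<forall>x y. f (x + y) = f x + f y) \<and> (\<forall>c x. f (scale c x) = scaleM c (f x))"
  by (simp add: Vector_Spaces.linear_iff vector_space_axioms M.vector_space_axioms)

definition alternating_map :: "('g \<Rightarrow> 'g \<Rightarrow> 'm) \<Rightarrow> bool" where
  "alternating_map w \<longleftrightarrow> (\<forall>x. linear_map (w x)) \<and> (\<forall>y. linear_map (\<lambda>x. w x y)) \<and> (\<forall>x. w x x = 0)"

text \<open>The Chevalley-Eilenberg differential on curried cochains. Lists are left behind once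
  \<open>coboundary_1\<close> and \<open>coboundary_2\<close> identify the two forms; all later
  computations use \<open>diff1\<close> and \<open>diff2\<close>.\<close>

definition diff1 :: "('g \<Rightarrow> 'm) \<Rightarrow> 'g \<Rightarrow> 'g \<Rightarrow> 'm" where
  "diff1 f x y = act x (f y) - act y (f x) - f (bracket x y)"

definition diff2 :: "('g \<Rightarrow> 'g \<Rightarrow> 'm) \<Rightarrow> 'g \<Rightarrow> 'g \<Rightarrow> 'g \<Rightarrow> 'm" where
  "diff2 w x y z = act x (w y z) - act y (w x z) + act z (w x y)
     - w (bracket x y) z + w (bracket x z) y - w (bracket y z) x"

definition cochain1 :: "('g \<Rightarrow> 'm) \<Rightarrow> 'g list \<Rightarrow> 'm" where
  "cochain1 f xs = (case xs of [x] \<Rightarrow> f x | _ \<Rightarrow> 0)"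

definition cochain2 :: "('g \<Rightarrow> 'g \<Rightarrow> 'm) \<Rightarrow> 'g list \<Rightarrow> 'm" where
  "cochain2 w xs = (case xs of [x, y] \<Rightarrow> w x y | _ \<Rightarrow> 0)"

lemma cochains_0: "\<phi> \<in> cochains 0 \<longleftrightarrow> (\<forall>xs. xs \<noteq> [] \<longrightarrow> \<phi> xs = 0)"
  by (auto simp: cochains_def)

lemma cochain1_eq: "length xs \<noteq> 1 \<Longrightarrow> cochain1 f xs = 0" "cochain1 f [x] = f x"
  by (auto simp: cochain1_def split: list.splits)

lemma cochain2_eq: "length xs \<noteq> 2 \<Longrightarrow> cochain2 w xs = 0" "cochain2 w [x, y] = w x y"
  by (auto simp: cochain2_def split: list.splits)

lemma length_2_iff: "length xs = 2 \<longleftrightarrow> (\<exists>x y. xs = [x, y])"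
  by (auto simp: numeral_2_eq_2 length_Suc_conv)

lemma length_3_iff: "length xs = 3 \<longleftrightarrow> (\<exists>x y z. xs = [x, y, z])"
  by (auto simp: numeral_3_eq_3 length_Suc_conv)

lemma cochains_1: "cochains 1 = cochain1 ` {f. linear_map f}"
proof (intro equalityI subsetI)
  fix \<phi> assume \<phi>: "\<phi> \<in> cochains 1"
  then have "linear_map (\<lambda>v. \<phi> (xs[i := v]))" if "length xs = 1" "i < 1" for xs i
    using that unfolding cochains_def by blast
  from this[of "[0]" 0] have *: "linear_map (\<lambda>v. \<phi> [v])"
    by simp
  have "\<phi> = cochain1 (\<lambda>x. \<phi> [x])"
    using \<phi> by (auto simp: fun_eq_iff cochain1_def cochains_def split: list.splits)
  then show "\<phi> \<in> cochain1 ` {f. linear_map f}"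
    using * by auto
next
  fix \<phi> assume "\<phi> \<in> cochain1 ` {f. linear_map f}"
  then show "\<phi> \<in> cochains 1"
    by (auto simp: cochains_def cochain1_eq length_Suc_conv)
qed

lemma cochains_2: "cochains 2 = cochain2 ` {w. alternating_map w}"
proof (intro equalityI subsetI)
  fix \<phi> assume \<phi>: "\<phi> \<in> cochains 2"
  then have lin: "linear_map (\<lambda>v. \<phi> (xs[i := v]))" if "length xs = 2" "i < 2" for xs i
    using that unfolding cochains_def by blast
  have "linear_map (\<lambda>v. \<phi> [x, v])" "linear_map (\<lambda>v. \<phi> [v, x])" for x
    using lin[of "[x, 0]" 1] lin[of "[0, x]" 0] by simp_all
  moreover have "\<phi> [x, x] = 0" for x
    using \<phi> by (auto simp: cochains_def)
  moreover have "\<phi> = cochain2 (\<lambda>x y. \<phi> [x, y])"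
    using \<phi> by (auto simp: fun_eq_iff cochain2_def cochains_def split: list.splits)
  ultimately show "\<phi> \<in> cochain2 ` {w. alternating_map w}"
    by (auto simp: alternating_map_def)
next
  fix \<phi> assume "\<phi> \<in> cochain2 ` {w. alternating_map w}"
  then show "\<phi> \<in> cochains 2"
    by (auto simp: cochains_def cochain2_eq length_2_iff alternating_map_def less_2_cases_iff)
qed

lemma coboundary_0: "coboundary 0 \<phi> = cochain1 (\<lambda>x. act x (\<phi> []))"
  by (rule ext) (auto simp: coboundary_def cochain1_eq length_Suc_conv nths_def)

lemma coboundary_1: "coboundary 1 (cochain1 f) = cochain2 (diff1 f)"
proof
  fix xs
  show "coboundary 1 (cochain1 f) xs = cochain2 (diff1 f) xs"
  proof (cases "length xs = 2")
    case True
    then show ?thesis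
      by (auto simp: length_2_iff coboundary_def cochain1_eq cochain2_eq nths_Cons diff1_def
          atMost_Suc lessThan_Suc)
  qed (simp add: coboundary_def cochain2_eq)
qed

lemma coboundary_2:
  "coboundary 2 (cochain2 w) xs = (case xs of [x, y, z] \<Rightarrow> diff2 w x y z | _ \<Rightarrow> 0)"
proof (cases "length xs = 3")
  case True
  then show ?thesis
    by (auto simp: length_3_iff coboundary_def cochain2_eq nths_Cons diff2_def numeral_2_eq_2
          atMost_Suc lessThan_Suc)
next
  case False
  then show ?thesis
    by (auto simp: coboundary_def split: list.splits)
qed

lemma cocycles_1: "cocycles 1 = cochain1 ` {f. linear_map f \<and> (\<forall>x y. diff1 f x y = 0)}"
proof -
  have "(cochain2 w = (\<lambda>_. 0)) = (\<forall>x y. w x y = 0)" for w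
    by (auto simp: fun_eq_iff cochain2_def split: list.splits)
  then have "coboundary 1 (cochain1 f) = (\<lambda>_. 0) \<longleftrightarrow> (\<forall>x y. diff1 f x y = 0)" for f
    unfolding coboundary_1 .
  then show ?thesis
    unfolding cocycles_def cochains_1 by blast
qed

lemma cocycles_2: "cocycles 2 = cochain2 ` {w. alternating_map w \<and> (\<forall>x y z. diff2 w x y z = 0)}"
proof -
  have "(coboundary 2 (cochain2 w) = (\<lambda>_. 0)) = (\<forall>x y z. diff2 w x y z = 0)" for w
    by (auto simp: fun_eq_iff coboundary_2 split: list.splits)
  then show ?thesis
    by (auto simp: cocycles_def cochains_2)
qed

lemma coboundaries_1: "coboundaries 1 = cochain1 ` range (\<lambda>m x. act x m)"
proof -
  have "(\<lambda>\<phi>. \<phi> []) ` cochains 0 = UNIV"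
  proof -
    have "m \<in> (\<lambda>\<phi>. \<phi> []) ` cochains 0" for m
      by (rule image_eqI[of _ _ "\<lambda>xs. if xs = [] then m else 0"]) (simp_all add: cochains_0)
    then show ?thesis
      by blast
  qed
  then have "range (\<lambda>m x. act x m) = (\<lambda>\<phi> x. act x (\<phi> [])) ` cochains 0"
    by (simp add: image_image flip: \<open>_ = UNIV\<close>)
  then show ?thesis
    by (simp add: coboundaries_def coboundary_0 image_image)
qed

lemma coboundaries_2: "coboundaries 2 = cochain2 ` diff1 ` {f. linear_map f}"
  using coboundary_1 cochains_1 by (simp add: coboundaries_def numeral_2_eq_2 image_image)

lemma linear_mapD:
  assumes "linear_map f"
  shows "f (x + y) = f x + f y" "f (scale c x) = scaleM c (f x)" "f 0 = 0" "f (- x) = - f x" "f (x - y) = f x - f y"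
  using assms module_hom.zero[of scale scaleM f] module_hom.neg[of scale scaleM f] module_hom.diff[of scale scaleM f]
  by (auto simp: linear_map_iff[symmetric] Vector_Spaces.linear_iff_module_hom dest: module_hom.add module_hom.scale)

lemma alternating_mapD:
  assumes "alternating_map w"
  shows "linear_map (w x)" "linear_map (\<lambda>x. w x y)" "w x x = 0" "w y x = - w x y"
proof -
  show lin: "linear_map (w x)" "linear_map (\<lambda>x. w x y)" "w x x = 0" for x y
    using assms by (auto simp: alternating_map_def)
  have "w (x + y) (x + y) = w x y + w y x"
    unfolding linear_mapD(1)[OF lin(1)] linear_mapD(1)[OF lin(2)] by (simp add: lin(3))
  then have "w x y + w y x = 0"
    unfolding lin(3) by (rule sym)
  then show "w y x = - w x y"
    by (simp add: eq_neg_iff_add_eq_0 add.commute)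
qed

section \<open>Coboundaries are cocycles in degrees one and two\<close>

lemma alternating_diff1:
  assumes "linear_map f"
  shows "alternating_map (diff1 f)"
  by (auto simp: alternating_map_def linear_map_iff diff1_def act_add act_scale bracket_add bracket_scale
      bracket_self linear_mapD[OF assms] M.scale_right_diff_distrib)

lemma diff2_diff1:
  assumes "linear_map f"
  shows "diff2 (diff1 f) x y z = 0"
proof -
  note f = linear_mapD[OF assms]
  \<comment> \<open>This is what survives in \<open>diff2 (diff1 f)\<close> after
    \<open>act_bracket\<close> has cancelled every term containing the action: \<open>f\<close>
    applied to a Jacobi sum.\<close>
  have "f (bracket (bracket x y) z) - f (bracket (bracket x z) y) + f (bracket (bracket y z) x) = 0"
  proof -
    have "bracket (bracket x y) z - bracket (bracket x z) y + bracket (bracket y z) x = 0"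
      using jacobi[of x y z] bracket_skew[of x "bracket y z"] bracket_skew[of z "bracket x y"]
        bracket_skew[of y "bracket z x"] bracket_skew[of z x] bracket_minus_right[of y "bracket x z"]
        bracket_skew[of y "bracket x z"] bracket_skew[of "- bracket x z" y]
      by (simp add: algebra_simps)
    then show ?thesis
      by (metis f(1,3,5))
  qed
  then show ?thesis
    by (simp add: diff2_def diff1_def act_add act_diff act_bracket algebra_simps)
qed

lemma coboundaries_1_subset: "coboundaries 1 \<subseteq> cocycles 1"
  unfolding coboundaries_1 cocycles_1
  by (intro image_mono) (auto simp: linear_act_left diff1_def act_bracket)

lemma coboundaries_2_subset: "coboundaries 2 \<subseteq> cocycles 2"
  unfolding coboundaries_2 cocycles_2
  by (intro image_mono) (auto simp: alternating_diff1 diff2_diff1)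

end

section \<open>Averaging over $\mathfrak{sl}_2$\<close>

text \<open>Finite dimension is replaced by what the argument uses: functionals that separate the
  points of \<open>V\<close> and are eigenfunctionals of \<open>H\<close> with integer weights
  bounded by \<open>N\<close>. \<open>V\<close> is a set so that linear maps and alternating maps
  can be taken inside a function type, with \<open>E\<close>, \<open>F\<close>, \<open>H\<close>
  linear only on it.\<close>

locale sl2_weight_module = vector_space smul
  for smul :: "complex \<Rightarrow> 'v::ab_group_add \<Rightarrow> 'v" +
  fixes V :: "'v set" and E F H :: "'v \<Rightarrow> 'v"
    and I :: "'i set" and weight :: "'i \<Rightarrow> int" and coord :: "'i \<Rightarrow> 'v \<Rightarrow> complex" and N :: nat
  assumes V_add: "v \<in> V \<Longrightarrow> w \<in> V \<Longrightarrow> v + w \<in> V"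
    and V_smul: "v \<in> V \<Longrightarrow> smul c v \<in> V"
    and E_V: "v \<in> V \<Longrightarrow> E v \<in> V" and F_V: "v \<in> V \<Longrightarrow> F v \<in> V" and H_V: "v \<in> V \<Longrightarrow> H v \<in> V"
    and E_add: "v \<in> V \<Longrightarrow> w \<in> V \<Longrightarrow> E (v + w) = E v + E w"
    and F_add: "v \<in> V \<Longrightarrow> w \<in> V \<Longrightarrow> F (v + w) = F v + F w"
    and H_add: "v \<in> V \<Longrightarrow> w \<in> V \<Longrightarrow> H (v + w) = H v + H w"
    and E_smul: "v \<in> V \<Longrightarrow> E (smul c v) = smul c (E v)"
    and F_smul: "v \<in> V \<Longrightarrow> F (smul c v) = smul c (F v)"
    and H_smul: "v \<in> V \<Longrightarrow> H (smul c v) = smul c (H v)"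
    and E_F: "v \<in> V \<Longrightarrow> E (F v) = F (E v) + H v"
    and H_E: "v \<in> V \<Longrightarrow> H (E v) = E (H v) + smul 2 (E v)"
    and H_F: "v \<in> V \<Longrightarrow> H (F v) = F (H v) + smul (- 2) (F v)"
    and coord_add: "v \<in> V \<Longrightarrow> w \<in> V \<Longrightarrow> coord i (v + w) = coord i v + coord i w"
    and coord_smul: "v \<in> V \<Longrightarrow> coord i (smul c v) = c * coord i v"
    and coord_H: "i \<in> I \<Longrightarrow> v \<in> V \<Longrightarrow> coord i (H v) = of_int (weight i) * coord i v"
    and coord_eq_0: "v \<in> V \<Longrightarrow> (\<And>i. i \<in> I \<Longrightarrow> coord i v = 0) \<Longrightarrow> v = 0"
    and weight_le: "i \<in> I \<Longrightarrow> \<bar>weight i\<bar> \<le> int N"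
begin

lemma V_diff: "v \<in> V \<Longrightarrow> w \<in> V \<Longrightarrow> v - smul c w \<in> V"
  using V_add[of v "smul (- c) w"] V_smul[of w "- c"] by simp

lemma E_diff: "v \<in> V \<Longrightarrow> w \<in> V \<Longrightarrow> E (v - smul c w) = E v - smul c (E w)"
  using E_add[of v "smul (- c) w"] E_smul[of w "- c"] V_smul[of w "- c"] by simp

lemma H_diff: "v \<in> V \<Longrightarrow> w \<in> V \<Longrightarrow> H (v - smul c w) = H v - smul c (H w)"
  using H_add[of v "smul (- c) w"] H_smul[of w "- c"] V_smul[of w "- c"] by simp

lemma coord_diff: "v \<in> V \<Longrightarrow> w \<in> V \<Longrightarrow> coord i (v - smul c w) = coord i v - c * coord i w"
  using coord_add[of v "smul (- c) w"] coord_smul[of w _ "- c"] V_smul[of w "- c"] by simp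

lemma map_0: assumes "v \<in> V" shows "E 0 = 0" "F 0 = 0" "H 0 = 0"
  using E_smul[OF assms, of 0] F_smul[OF assms, of 0] H_smul[OF assms, of 0] by simp_all

lemma E_pow_V: "v \<in> V \<Longrightarrow> (E ^^ n) v \<in> V"
  by (induction n) (auto intro: E_V)

lemma F_pow_V: "v \<in> V \<Longrightarrow> (F ^^ n) v \<in> V"
  by (induction n) (auto intro: F_V)

lemma E_pow_add: "v \<in> V \<Longrightarrow> w \<in> V \<Longrightarrow> (E ^^ n) (v + w) = (E ^^ n) v + (E ^^ n) w"
  by (induction n) (auto simp: E_add E_pow_V)

lemma E_pow_smul: "v \<in> V \<Longrightarrow> (E ^^ n) (smul c v) = smul c ((E ^^ n) v)"
  by (induction n) (auto simp: E_smul E_pow_V)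

lemma E_pow_diff: "v \<in> V \<Longrightarrow> w \<in> V \<Longrightarrow> (E ^^ n) (v - smul c w) = (E ^^ n) v - smul c ((E ^^ n) w)"
  by (induction n) (auto simp: E_diff E_pow_V)

section \<open>Commutation relations for powers of E and F\<close>

lemma H_E_pow:
  assumes "v \<in> V" "H v = smul c v"
  shows "H ((E ^^ n) v) = smul (c + 2 * of_nat n) ((E ^^ n) v)"
proof (induction n)
  case (Suc n)
  have "H ((E ^^ Suc n) v) = E (smul (c + 2 * of_nat n) ((E ^^ n) v)) + smul 2 ((E ^^ Suc n) v)"
    using assms by (simp add: H_E E_pow_V Suc.IH)
  also have "\<dots> = smul (c + 2 * of_nat n) ((E ^^ Suc n) v) + smul 2 ((E ^^ Suc n) v)"
    using assms by (simp add: E_smul E_pow_V)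
  finally show ?case
    by (simp only: scale_left_distrib[symmetric]) (simp add: algebra_simps)
qed (use assms in simp)

lemma H_F_pow:
  assumes "v \<in> V" "H v = smul c v"
  shows "H ((F ^^ n) v) = smul (c - 2 * of_nat n) ((F ^^ n) v)"
proof (induction n)
  case (Suc n)
  have "H ((F ^^ Suc n) v) = F (smul (c - 2 * of_nat n) ((F ^^ n) v)) + smul (- 2) ((F ^^ Suc n) v)"
    using assms by (simp add: H_F F_pow_V Suc.IH)
  also have "\<dots> = smul (c - 2 * of_nat n) ((F ^^ Suc n) v) + smul (- 2) ((F ^^ Suc n) v)"
    using assms by (simp add: F_smul F_pow_V)
  finally show ?case
    by (simp only: scale_left_distrib[symmetric]) (simp add: algebra_simps)
qed (use assms in simp)

text \<open>A coordinate of an \<open>H\<close>-eigenvector can be nonzero only if its weight is the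
  eigenvalue. This bound makes \<open>E\<close> and \<open>F\<close> nilpotent on weight
  vectors.\<close>

lemma large_weight_eq_0:
  assumes "v \<in> V" "H v = smul (of_int c) v" "\<bar>c\<bar> > int N"
  shows "v = 0"
proof (rule coord_eq_0[OF assms(1)])
  fix i assume i: "i \<in> I"
  then have "of_int (weight i) * coord i v = coord i (H v)"
    by (simp add: coord_H[OF _ assms(1)])
  also have "\<dots> = of_int c * coord i v"
    using coord_smul assms by simp
  finally have "of_int (weight i) * coord i v = of_int c * coord i v" .
  moreover have "of_int (weight i) \<noteq> (of_int c :: complex)"
    using weight_le[OF i] assms(3) by auto
  ultimately show "coord i v = 0"
    by simp
qed

text \<open>Moving \<open>F\<close> to the left past \<open>n\<close> copies of \<open>E\<close>
  picks up the weights \<open>c, c + 2, ..., c + 2 (n - 1)\<close> once each, and they add up to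
  \<open>n (c + n - 1)\<close>. For \<open>n = 0\<close> the coefficient is zero, so the truncated
  exponent does no harm.\<close>

lemma E_pow_F:
  assumes "v \<in> V" "H v = smul c v"
  shows "(E ^^ n) (F v) = F ((E ^^ n) v) + smul (of_nat n * (c + of_nat n - 1)) ((E ^^ (n - 1)) v)"
  using assms
proof (induction n arbitrary: v c)
  case (Suc n)
  have EV: "E v \<in> V" "H (E v) = smul (c + 2) (E v)"
    using Suc.prems H_E_pow[of v c 1] by (auto intro: E_V)
  have "(E ^^ Suc n) (F v) = (E ^^ n) (F (E v) + smul c v)"
    using Suc.prems by (simp add: funpow_Suc_right E_F del: funpow.simps)
  also have "\<dots> = (E ^^ n) (F (E v)) + smul c ((E ^^ n) v)"
    using Suc.prems EV by (simp add: E_pow_add E_pow_smul F_V V_smul)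
  also have "(E ^^ n) (F (E v)) = F ((E ^^ n) (E v)) + smul (of_nat n * (c + 2 + of_nat n - 1)) ((E ^^ (n - 1)) (E v))"
    by (rule Suc.IH[OF EV])
  also have "(E ^^ n) (E v) = (E ^^ Suc n) v"
    by (simp add: funpow_Suc_right del: funpow.simps)
  also have "smul (of_nat n * (c + 2 + of_nat n - 1)) ((E ^^ (n - 1)) (E v)) = smul (of_nat n * (c + of_nat n + 1)) ((E ^^ n) v)"
    by (cases n) (auto simp: funpow_Suc_right simp del: funpow.simps)
  finally have "(E ^^ Suc n) (F v) = F ((E ^^ Suc n) v)
      + smul (of_nat n * (c + of_nat n + 1) + c) ((E ^^ n) v)"
    by (simp only: add.assoc scale_left_distrib)
  moreover have "of_nat n * (c + of_nat n + 1) + c = of_nat (Suc n) * (c + of_nat (Suc n) - 1)"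
    by (simp add: algebra_simps)
  ultimately show ?case
    by (simp only: diff_Suc_1)
qed auto

text \<open>Here the collected weights are \<open>0, -2, ..., -2 n\<close>, with sum
  \<open>- n (n + 1)\<close>. This is nonzero for \<open>n > 0\<close>, which is what the descent at
  the end of \<open>exists_invariant\<close> needs.\<close>

lemma E_F_pow:
  assumes "v \<in> V" "H v = 0" "E v = 0"
  shows "E ((F ^^ Suc n) v) = smul (- (of_nat n * of_nat (Suc n))) ((F ^^ n) v)"
proof (induction n)
  case 0
  then show ?case
    using assms by (simp add: E_F map_0)
next
  case (Suc n)
  have "E ((F ^^ Suc (Suc n)) v) = F (E ((F ^^ Suc n) v)) + H ((F ^^ Suc n) v)"
    using E_F[of "(F ^^ Suc n) v"] F_pow_V[OF assms(1), of "Suc n"] by simp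
  also have "\<dots> = smul (- (of_nat n * of_nat (Suc n))) ((F ^^ Suc n) v) + smul (0 - 2 * of_nat (Suc n)) ((F ^^ Suc n) v)"
    using H_F_pow[OF assms(1), of 0 "Suc n"] assms(2) F_pow_V[OF assms(1), of n]
      F_smul[of "(F ^^ n) v" "- (of_nat n * of_nat (Suc n))"]
    by (simp only: Suc.IH) simp
  finally show ?case
    by (simp only: scale_left_distrib[symmetric]) (simp add: algebra_simps)
qed

text \<open>First the nonzero weights are removed. On weight zero, \<open>F E\<close> acts on the isotypic component of
  highest weight \<open>2k\<close> as \<open>k (k + 1)\<close>; hence the factors \<open>1 - F E / (k (k + 1))\<close> remove everything but the invariants.\<close>

lemma exists_invariant:
  assumes "v \<in> V" "P v"
    and P_H: "\<And>c v. v \<in> V \<Longrightarrow> P v \<Longrightarrow> P (v - smul c (H v))"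
    and P_FE: "\<And>c v. v \<in> V \<Longrightarrow> P v \<Longrightarrow> P (v - smul c (F (E v)))"
  shows "\<exists>w\<in>V. P w \<and> E w = 0 \<and> F w = 0 \<and> H w = 0"
proof -
  \<comment> \<open>The vector is changed only by subtracting multiples of \<open>H v\<close> and of
    \<open>F (E v)\<close>, the operations that preserve \<open>P\<close>. In the applications
    \<open>P\<close> says that the vector is a cocycle in a fixed cohomology class.\<close>
  have "\<exists>w\<in>V. P w \<and> H w = 0"
    if "finite S" "v \<in> V" "P v" "\<And>i. i \<in> I \<Longrightarrow> coord i v \<noteq> 0 \<Longrightarrow> weight i \<in> insert 0 S" for S v
    using that
  proof (induction S arbitrary: v rule: finite_induct)
    case empty
    have "H v = 0"
      using empty by (intro coord_eq_0) (auto simp: coord_H H_V)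
    then show ?case
      using empty by auto
  next
    case (insert c S)
    show ?case
    proof (cases "c = 0")
      case False
      \<comment> \<open>The factor \<open>1 - H / c\<close> annihilates weight \<open>c\<close>,
        fixes weight zero and introduces no new weight.\<close>
      let ?w = "v - smul (1 / of_int c) (H v)"
      have "coord i ?w = (1 - of_int (weight i) / of_int c) * coord i v" if "i \<in> I" for i
        using that insert.prems by (simp add: coord_diff coord_H H_V algebra_simps)
      then have hS: "weight i \<in> insert 0 S" if "i \<in> I" "coord i ?w \<noteq> 0" for i
        using that insert.prems(3)[of i] False by auto
      show ?thesis
        by (rule insert.IH[OF V_diff[OF insert.prems(1) H_V[OF insert.prems(1)]] P_H[OF insert.prems(1,2)] hS])
    next
      case True
      then show ?thesis
        using insert.prems by (intro insert.IH) simp_all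
    qed
  qed
  moreover have "weight ` I \<subseteq> {- int N..int N}"
    using weight_le by (fastforce simp: abs_le_iff)
  then have "finite (weight ` I)"
    by (rule finite_subset) simp
  ultimately have "\<exists>w\<in>V. P w \<and> H w = 0"
    using assms(1,2) by simp
  then obtain v0 where v0: "v0 \<in> V" "P v0" "H v0 = 0"
    by blast
  have "\<exists>w\<in>V. P w \<and> H w = 0 \<and> E w = 0"
    if "v \<in> V" "P v" "H v = 0" "(E ^^ Suc n) v = 0" for n v
    using that
  proof (induction n arbitrary: v)
    case (Suc n)
    \<comment> \<open>If \<open>v\<close> has weight zero and \<open>E^(n+2) v = 0\<close>, then
      \<open>E v\<close> has weight 2 and \<open>E_pow_F\<close> gives
      \<open>E^(n+1) (F (E v)) = (n + 1) (n + 2) E^(n+1) v\<close>. With this constant the new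
      vector is already killed by \<open>E^(n+1)\<close>.\<close>
    let ?c = "1 / (of_nat (Suc n) * of_nat (Suc (Suc n))) :: complex"
    let ?w = "v - smul ?c (F (E v))"
    have EV: "E v \<in> V" "H (E v) = smul 2 (E v)"
      using Suc.prems by (auto simp: H_E map_0 intro: E_V)
    have w: "?w \<in> V" "P ?w"
      using Suc.prems by (auto intro!: V_diff E_V F_V P_FE)
    have "H (F (E v)) = 0"
      using EV by (simp add: H_F F_smul)
    then have Hw: "H ?w = 0"
      using Suc.prems EV by (simp add: H_diff F_V)
    have "(E ^^ Suc n) (F (E v)) = F ((E ^^ Suc (Suc n)) v) + smul (of_nat (Suc n) * (2 + of_nat (Suc n) - 1)) ((E ^^ Suc n) v)"
      using E_pow_F[OF EV, of "Suc n"] by (simp add: funpow_Suc_right del: funpow.simps)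
    also have "\<dots> = smul (of_nat (Suc n) * of_nat (Suc (Suc n))) ((E ^^ Suc n) v)"
    proof -
      have "2 + of_nat (Suc n) - 1 = (of_nat (Suc (Suc n)) :: complex)"
        by simp
      then show ?thesis
        by (simp only: Suc.prems(4) map_0[OF Suc.prems(1)] add_0)
    qed
    finally have "(E ^^ Suc n) ?w = (E ^^ Suc n) v - smul ?c (smul (of_nat (Suc n) * of_nat (Suc (Suc n))) ((E ^^ Suc n) v))"
      by (simp only: E_pow_diff[OF Suc.prems(1) F_V[OF EV(1)]])
    also have "\<dots> = 0"
      by (simp del: funpow.simps of_nat_Suc)
    finally have "(E ^^ Suc n) ?w = 0" .
    then show ?case
      by (rule Suc.IH[OF w Hw])
  qed auto
  \<comment> \<open>The descent can start here: the weight \<open>2 (N + 1)\<close> exceeds the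
    bound \<open>N\<close>.\<close>
  moreover have "(E ^^ Suc N) v0 = 0"
    using H_E_pow[OF v0(1), of 0 "Suc N"] v0 E_pow_V[of v0 "Suc N"]
    by (intro large_weight_eq_0[of _ "2 * int (Suc N)"]) (simp_all del: funpow.simps)
  ultimately have "\<exists>w\<in>V. P w \<and> H w = 0 \<and> E w = 0"
    using v0 by (simp del: funpow.simps)
  then obtain w where w: "w \<in> V" "P w" "H w = 0" "E w = 0"
    by blast
  \<comment> \<open>Applying \<open>E\<close> to \<open>F^(n+2) w = 0\<close> returns a nonzero
    multiple of \<open>F^(n+1) w\<close>. The descent stops at \<open>F w\<close>, since
    \<open>E (F w)\<close> has coefficient zero; \<open>w\<close> itself may survive.\<close>
  have "(F ^^ Suc n) w = 0 \<Longrightarrow> F w = 0" for n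
  proof (induction n)
    case (Suc n)
    have "smul (- (of_nat (Suc n) * of_nat (Suc (Suc n)))) ((F ^^ Suc n) w) = 0"
      using E_F_pow[OF w(1,3,4), of "Suc n"] Suc.prems w(1) by (simp add: map_0 del: of_nat_Suc)
    then show ?case
      using Suc.IH by (simp del: of_nat_Suc)
  qed simp
  moreover have "(F ^^ Suc N) w = 0"
    using H_F_pow[OF w(1), of 0 "Suc N"] w F_pow_V[of w "Suc N"]
    by (intro large_weight_eq_0[of _ "- 2 * int (Suc N)"]) (simp_all del: funpow.simps)
  ultimately show ?thesis
    using w by blast
qed

end

section \<open>The decomposition of $L_{25}$ into irreducible $\mathfrak{sl}_2$-modules\<close>

text \<open>Block \<open>0\<close> is \<open>\<ss>\<ll>\<^sub>2\<close> itself. Its basis \<open>e\<^sub>1, - e\<^sub>3 / 2, - e\<^sub>2\<close> is scaled so that \<open>\<ss>\<ll>\<^sub>2\<close> acts on it by the same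
  formulas as on the four other blocks.\<close>

definition block_top :: "nat \<Rightarrow> nat" where
  "block_top A = [2, 6, 4, 6, 2] ! A"

definition block_vec :: "nat \<Rightarrow> nat \<Rightarrow> complex ^ 25" where
  "block_vec A i = (if i > block_top A then 0
     else if A = 0 then [L25_e 1, (- 1 / 2) *s L25_e 3, - L25_e 2] ! i
     else L25_e ([1, 4, 11, 16, 23] ! A + i))"

text \<open>The functionals dual to \<open>block_vec\<close>, hence the reciprocal factors
  \<open>- 2\<close> and \<open>- 1\<close> in block 0. Like \<open>block_vec\<close>, they are zero
  beyond the end of the block, so that the formulas for the action need no separate case
  there.\<close>

definition block_coord :: "nat \<Rightarrow> nat \<Rightarrow> complex ^ 25 \<Rightarrow> complex" where
  "block_coord A k v = (if k > block_top A then 0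
     else if A = 0 then [v $ 1, - 2 * v $ 3, - v $ 2] ! k
     else v $ of_nat ([1, 4, 11, 16, 23] ! A + k))"

lemma all_blocks:
  "(\<forall>A<5. \<forall>k\<le>block_top A. P A k) \<longleftrightarrow>
    P 0 0 \<and> P 0 1 \<and> P 0 2 \<and> P 1 0 \<and> P 1 1 \<and> P 1 2 \<and> P 1 3 \<and> P 1 4
    \<and> P 1 5 \<and> P 1 6 \<and> P 2 0 \<and> P 2 1 \<and> P 2 2 \<and> P 2 3 \<and> P 2 4 \<and> P
    3 0 \<and> P 3 1 \<and> P 3 2 \<and> P 3 3 \<and> P 3 4 \<and> P 3 5 \<and> P 3 6 \<and> P 4 0
    \<and> P 4 1 \<and> P 4 2"
  by (simp add: block_top_def numeral_eq_Suc All_less_Suc conj_ac flip: less_Suc_eq_le)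

lemma block_coord_simps:
  "block_coord 0 0 v = v $ 1" "block_coord 0 (Suc 0) v = - 2 * v $ 3" "block_coord 0 2 v = - v $ 2"
  "A \<noteq> 0 \<Longrightarrow> k \<le> block_top A \<Longrightarrow> block_coord A k v = v $ of_nat ([1, 4, 11, 16, 23] ! A + k)"
  by (simp_all add: block_coord_def block_top_def)

lemma block_vec_simps:
  "block_vec 0 0 = L25_e 1" "block_vec 0 (Suc 0) = (- 1 / 2) *s L25_e 3" "block_vec 0 2 = - L25_e 2"
  "A \<noteq> 0 \<Longrightarrow> k \<le> block_top A \<Longrightarrow> block_vec A k = L25_e ([1, 4, 11, 16, 23] ! A + k)"
  by (simp_all add: block_vec_def block_top_def)

lemma block_coord_eqI:
  assumes "\<And>A k. A < 5 \<Longrightarrow> k \<le> block_top A \<Longrightarrow> block_coord A k v = block_coord A k w"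
  shows "v = w"
proof (rule L25_vec_eqI)
  have "\<forall>A<5. \<forall>k\<le>block_top A. block_coord A k v = block_coord A k w"
    using assms by blast
  then have "list_all (\<lambda>m. v $ of_nat m = w $ of_nat m) [1..<26]"
    unfolding all_blocks by (simp add: block_coord_simps block_top_def upt_rec)
  then show "v $ of_nat m = w $ of_nat m" if "m \<in> {1..25}" for m
    using that by (auto simp: list_all_iff)
qed

lemma block_coord_vec:
  assumes "A < 5" "B < 5" "i \<le> block_top B"
  shows "block_coord A k (block_vec B i) = (if A = B \<and> k = i then 1 else 0)"
proof (cases "k \<le> block_top A")
  case True
  have "\<forall>B<5. \<forall>i\<le>block_top B. \<forall>A<5. \<forall>k\<le>block_top A. block_coord A k (block_vec B i) = (if A = B \<and> k = i then 1 else 0)"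
    unfolding all_blocks by (simp add: block_coord_simps block_vec_simps block_top_def L25_e_def axis_def)
  then show ?thesis
    using True assms by blast
next
  case False
  then show ?thesis
    using assms by (auto simp: block_coord_def)
qed

text \<open>The action is first computed in dual form on an arbitrary vector, where the component
  formulas of the bracket apply directly; \<open>bracket_block_vec\<close> recovers the action on
  basis vectors by duality.\<close>

lemma block_coord_bracket:
  assumes "A < 5" "k \<le> block_top A"
  shows "block_coord A k (L25_bracket (L25_e 1) v) = of_nat (k + 1) * block_coord A (k + 1) v"
    and "block_coord A k (L25_bracket (L25_e 2) v) = of_nat (block_top A + 1 - k) * (if k = 0 then 0 else block_coord A (k - 1) v)"
    and "block_coord A k (L25_bracket (L25_e 3) v) = of_int (int (block_top A) - 2 * int k) * block_coord A k v"
proof -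
  have "\<forall>A<5. \<forall>k\<le>block_top A. block_coord A k (L25_bracket (L25_e 1) v) = of_nat (k + 1) * block_coord A (k + 1) v"
    unfolding all_blocks
    by (simp add: block_coord_def block_top_def L25_e_def axis_def L25_bracket_nth_simps)
  then show "block_coord A k (L25_bracket (L25_e 1) v) = of_nat (k + 1) * block_coord A (k + 1) v"
    using assms by blast
  have "\<forall>A<5. \<forall>k\<le>block_top A. block_coord A k (L25_bracket (L25_e 2) v) = of_nat (block_top A + 1 - k) * (if k = 0 then 0 else block_coord A (k - 1) v)"
    unfolding all_blocks
    by (simp add: block_coord_def block_top_def L25_e_def axis_def L25_bracket_nth_simps)
  then show "block_coord A k (L25_bracket (L25_e 2) v) = of_nat (block_top A + 1 - k) * (if k = 0 then 0 else block_coord A (k - 1) v)"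
    using assms by blast
  have "\<forall>A<5. \<forall>k\<le>block_top A. block_coord A k (L25_bracket (L25_e 3) v) = of_int (int (block_top A) - 2 * int k) * block_coord A k v"
    unfolding all_blocks
    by (simp add: block_coord_def block_top_def L25_e_def axis_def L25_bracket_nth_simps)
  then show "block_coord A k (L25_bracket (L25_e 3) v) = of_int (int (block_top A) - 2 * int k) * block_coord A k v"
    using assms by blast
qed

section \<open>Lie derivatives and Cartan's formula\<close>

context lie_module
begin

definition lie1 :: "'g \<Rightarrow> ('g \<Rightarrow> 'm) \<Rightarrow> 'g \<Rightarrow> 'm" where
  "lie1 a f x = act a (f x) - f (bracket a x)"

definition lie2 :: "'g \<Rightarrow> ('g \<Rightarrow> 'g \<Rightarrow> 'm) \<Rightarrow> 'g \<Rightarrow> 'g \<Rightarrow> 'm" where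
  "lie2 a w x y = act a (w x y) - w (bracket a x) y - w x (bracket a y)"

text \<open>Cartan's formula \<open>L_a = i_a d + d i_a\<close>, where the contraction
  \<open>f a\<close> is a 0-cochain with differential \<open>act x (f a)\<close>. On a cocycle only
  this coboundary remains; \<open>cartan_lie2\<close> is the same formula one degree higher.\<close>

lemma cartan_lie1: "lie1 a f x = diff1 f a x + act x (f a)"
  by (simp add: lie1_def diff1_def)

lemma cartan_lie2:
  assumes "alternating_map w"
  shows "lie2 a w x y = diff2 w a x y + diff1 (w a) x y"
  using alternating_mapD(4)[OF assms, of "bracket a y" x] alternating_mapD(4)[OF assms, of "bracket x y" a]
  by (simp add: lie2_def diff1_def diff2_def)

lemma bracket_act_bracket: "bracket (bracket a b) x = bracket a (bracket b x) - bracket b (bracket a x)"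
  by (rule lie_module.act_bracket[OF adjoint_module])

lemma linear_lie1: "linear_map f \<Longrightarrow> linear_map (lie1 a f)"
  by (auto simp: linear_map_iff lie1_def act_add act_scale bracket_add bracket_scale M.scale_right_diff_distrib)

lemma alternating_lie2:
  assumes "alternating_map w"
  shows "alternating_map (lie2 a w)"
proof -
  note w = alternating_mapD(1,2)[OF assms]
  have "lie2 a w x x = 0" for x
    using alternating_mapD(4)[OF assms, of "bracket a x" x] by (simp add: lie2_def alternating_mapD(3)[OF assms] act_zero)
  then show ?thesis
    by (auto simp: alternating_map_def linear_map_iff lie2_def act_add act_scale bracket_add bracket_scale
        M.scale_right_diff_distrib linear_mapD[OF w(1)] linear_mapD[OF w(2)])
qed

lemma lie1_bracket:
  assumes "linear_map f"
  shows "lie1 (bracket a b) f x = lie1 a (lie1 b f) x - lie1 b (lie1 a f) x"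
  by (simp add: lie1_def act_diff act_bracket bracket_act_bracket linear_mapD[OF assms])

lemma lie2_bracket:
  assumes "alternating_map w"
  shows "lie2 (bracket a b) w x y = lie2 a (lie2 b w) x y - lie2 b (lie2 a w) x y"
  by (simp add: lie2_def act_diff act_bracket bracket_act_bracket
      linear_mapD[OF alternating_mapD(1)[OF assms]] linear_mapD[OF alternating_mapD(2)[OF assms]])

lemma lie2_diff1:
  assumes "linear_map f"
  shows "lie2 a (diff1 f) x y = diff1 (lie1 a f) x y"
  by (simp add: lie1_def lie2_def diff1_def act_diff act_bracket bracket_act_bracket linear_mapD[OF assms])

end

section \<open>Linearity of coordinates and expansion in the block basis\<close>

lemma block_coord_add: "block_coord A k (v + w) = block_coord A k v + block_coord A k w"
  and block_coord_scale: "block_coord A k (c *s v) = c * block_coord A k v"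
  and block_coord_zero: "block_coord A k 0 = 0"
proof -
  have "[x, y, z] ! k + [x', y', z'] ! k = [x + x', y + y', z + z'] ! k"
       "c * [x, y, z] ! k = [c * x, c * y, c * z] ! k"
       "[0, 0, 0] ! k = (0 :: complex)"
    if "k \<le> 2" for x y z x' y' z' c :: complex
    using that by (auto simp: le_Suc_eq numeral_2_eq_2)
  then show "block_coord A k (v + w) = block_coord A k v + block_coord A k w"
    "block_coord A k (c *s v) = c * block_coord A k v" "block_coord A k 0 = 0"
    by (auto simp: block_coord_def block_top_def algebra_simps)
qed

lemma block_coord_minus: "block_coord A k (- v) = - block_coord A k v"
  using block_coord_scale[of A k "- 1" v] by simp

lemma block_coord_diff: "block_coord A k (v - w) = block_coord A k v - block_coord A k w"
  using block_coord_add[of A k v "- w"] by (simp add: block_coord_minus)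

lemma block_coord_sum: "block_coord A k (sum f S) = (\<Sum>x\<in>S. block_coord A k (f x))"
  by (induction S rule: infinite_finite_induct) (auto simp: block_coord_zero block_coord_add)

lemmas block_coord_linear = block_coord_add block_coord_scale block_coord_zero block_coord_minus block_coord_diff block_coord_sum

lemma block_vec_0 [simp]: "i > block_top A \<Longrightarrow> block_vec A i = 0"
  by (simp add: block_vec_def)

lemma block_coord_0 [simp]: "k > block_top A \<Longrightarrow> block_coord A k v = 0"
  by (simp add: block_coord_def)

lemma block_expansion: "v = (\<Sum>A<5. \<Sum>i\<le>block_top A. block_coord A i v *s block_vec A i)"
proof (rule block_coord_eqI)
  fix A k assume A: "A < 5" "k \<le> block_top A"
  have "block_coord A k (\<Sum>B<5. \<Sum>i\<le>block_top B. block_coord B i v *s block_vec B i) =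
      (\<Sum>B<5. \<Sum>i\<le>block_top B. if A = B \<and> k = i then block_coord B i v else 0)"
    using A by (auto simp: block_coord_linear block_coord_vec intro!: sum.cong)
  also have "\<dots> = (\<Sum>B<5. if A = B then \<Sum>i\<le>block_top B. if k = i then block_coord B i v else 0 else 0)"
    by (intro sum.cong) auto
  also have "\<dots> = block_coord A k v"
    using A by simp
  finally show "block_coord A k v = block_coord A k (\<Sum>B<5. \<Sum>i\<le>block_top B. block_coord B i v *s block_vec B i)"
    by simp
qed

definition block_weight :: "nat \<Rightarrow> nat \<Rightarrow> int" where
  "block_weight A i = int (block_top A) - 2 * int i"

lemma bracket_block_vec:
  assumes "A < 5" "i \<le> block_top A"
  shows "L25_bracket (L25_e 1) (block_vec A i) = of_nat i *s block_vec A (i - 1)"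
    and "L25_bracket (L25_e 2) (block_vec A i) = of_nat (block_top A - i) *s block_vec A (i + 1)"
    and "L25_bracket (L25_e 3) (block_vec A i) = of_int (block_weight A i) *s block_vec A i"
proof -
  show "L25_bracket (L25_e 1) (block_vec A i) = of_nat i *s block_vec A (i - 1)"
  proof (rule block_coord_eqI)
    fix B k assume "B < 5" "k \<le> block_top B"
    then show "block_coord B k (L25_bracket (L25_e 1) (block_vec A i)) = block_coord B k (of_nat i *s block_vec A (i - 1))"
      using assms by (cases i) (auto simp: block_coord_bracket(1) block_coord_vec block_coord_linear simp del: One_nat_def)
  qed
  show "L25_bracket (L25_e 2) (block_vec A i) = of_nat (block_top A - i) *s block_vec A (i + 1)"
  proof (rule block_coord_eqI)
    fix B k assume "B < 5" "k \<le> block_top B"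
    then show "block_coord B k (L25_bracket (L25_e 2) (block_vec A i)) = block_coord B k (of_nat (block_top A - i) *s block_vec A (i + 1))"
      using assms by (cases "i = block_top A") (auto simp: block_coord_bracket(2) block_coord_vec block_coord_linear)
  qed
  show "L25_bracket (L25_e 3) (block_vec A i) = of_int (block_weight A i) *s block_vec A i"
  proof (rule block_coord_eqI)
    fix B k assume "B < 5" "k \<le> block_top B"
    then show "block_coord B k (L25_bracket (L25_e 3) (block_vec A i)) = block_coord B k (of_int (block_weight A i) *s block_vec A i)"
      using assms by (auto simp: block_coord_bracket(3) block_coord_vec block_coord_linear block_weight_def)
  qed
qed

abbreviation L25_linear :: "(complex ^ 25 \<Rightarrow> complex ^ 25) \<Rightarrow> bool" where
  "L25_linear \<equiv> Vector_Spaces.linear (*s) (*s)"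

lemma linear_block_eq_0:
  assumes "L25_linear f" "\<And>A i. A < 5 \<Longrightarrow> i \<le> block_top A \<Longrightarrow> f (block_vec A i) = 0"
  shows "f x = 0"
proof -
  note f = L25_adjoint.linear_mapD[OF assms(1)]
  have sum: "f (sum g S) = (\<Sum>x\<in>S. f (g x))" for g :: "'x \<Rightarrow> complex ^ 25" and S
    by (induction S rule: infinite_finite_induct) (auto simp: f)
  have "f x = f (\<Sum>A<5. \<Sum>i\<le>block_top A. block_coord A i x *s block_vec A i)"
    using block_expansion[of x] by simp
  also have "\<dots> = 0"
    using assms(2) by (simp add: sum f)
  finally show ?thesis .
qed

lemma block_weight_le:
  assumes "A < 5" "i \<le> block_top A"
  shows "\<bar>block_weight A i\<bar> \<le> 6"
proof -
  have "\<forall>A<5. \<forall>i\<le>block_top A. \<bar>block_weight A i\<bar> \<le> 6"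
    unfolding all_blocks by (simp add: block_weight_def block_top_def)
  then show ?thesis
    using assms by blast
qed

section \<open>Cochains as weight modules\<close>

lemma L25_e_brackets:
  "L25_bracket (L25_e 1) (L25_e 2) = L25_e 3"
  "L25_bracket (L25_e 3) (L25_e 1) = 2 *s L25_e 1"
  "L25_bracket (L25_e 3) (L25_e 2) = - 2 *s L25_e 2"
proof -
  show "L25_bracket (L25_e 1) (L25_e 2) = L25_e 3"
    using L25_bracket_table[of 1 2 1 3] by (simp add: L25_table_def)
  show "L25_bracket (L25_e 3) (L25_e 1) = 2 *s L25_e 1"
    using L25_bracket_table[of 1 3 "- 2" 1] lie_algebra.bracket_skew[OF lie_algebra_L25, of "L25_e 3" "L25_e 1"] by (simp add: L25_table_def)
  show "L25_bracket (L25_e 3) (L25_e 2) = - 2 *s L25_e 2"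
    using L25_bracket_table[of 2 3 2 2] lie_algebra.bracket_skew[OF lie_algebra_L25, of "L25_e 3" "L25_e 2"] by (simp add: L25_table_def)
qed

text \<open>A matrix entry from \<open>(A, i)\<close> to \<open>(C, k)\<close> carries the
  difference of the two weights. Each of these is at most 6 in absolute value, hence the bound
  12.\<close>

lemma sl2_weight_module_lie1:
  "sl2_weight_module (\<lambda>c (f :: complex ^ 25 \<Rightarrow> complex ^ 25) x. c *s f x) {f. L25_linear f}
    (L25_adjoint.lie1 (L25_e 1)) (L25_adjoint.lie1 (L25_e 2)) (L25_adjoint.lie1 (L25_e 3))
    {(A, i, C, k). A < 5 \<and> i \<le> block_top A \<and> C < 5 \<and> k \<le> block_top C}
    (\<lambda>(A, i, C, k). block_weight C k - block_weight A i)
    (\<lambda>(A, i, C, k) f. block_coord C k (f (block_vec A i))) 12"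
  (is "sl2_weight_module ?s ?V ?E ?F ?H ?I ?w ?c 12")
proof -
  have vs: "vector_space ?s"
    by unfold_locales (auto simp: fun_eq_iff vector_add_ldistrib vector_sadd_rdistrib vector_smult_assoc)
  have comm: "L25_adjoint.lie1 (L25_bracket a b) f = (\<lambda>x. L25_adjoint.lie1 a (L25_adjoint.lie1 b f) x - L25_adjoint.lie1 b (L25_adjoint.lie1 a f) x)"
    if "L25_linear f" for a b f
    by (rule ext) (rule L25_adjoint.lie1_bracket[OF that])
  have scale: "L25_adjoint.lie1 (c *s a) f = (\<lambda>x. c *s L25_adjoint.lie1 a f x)" if "L25_linear f" for c a f
    by (rule ext) (simp add: L25_adjoint.lie1_def L25_bracket_scale L25_adjoint.linear_mapD[OF that] vector_ssub_ldistrib)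
  show ?thesis
  proof (intro sl2_weight_module.intro vs sl2_weight_module_axioms.intro)
    fix f assume f: "f \<in> ?V"
    then have lin: "L25_linear f"
      by simp
    show "?E (?F f) = ?F (?E f) + ?H f"
      using comm[OF lin, of "L25_e 1" "L25_e 2"] by (simp add: L25_e_brackets fun_eq_iff del: One_nat_def)
    show "?H (?E f) = ?E (?H f) + ?s 2 (?E f)"
      using comm[OF lin, of "L25_e 3" "L25_e 1"] scale[OF lin, of 2 "L25_e 1"] by (simp add: L25_e_brackets fun_eq_iff algebra_simps del: One_nat_def)
    show "?H (?F f) = ?F (?H f) + ?s (- 2) (?F f)"
      using comm[OF lin, of "L25_e 3" "L25_e 2"] scale[OF lin, of "- 2" "L25_e 2"] by (simp add: L25_e_brackets fun_eq_iff algebra_simps del: One_nat_def)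
    show "?c i (?H f) = of_int (?w i) * ?c i f" if "i \<in> ?I" for i
      using that by (auto simp: L25_adjoint.lie1_def block_coord_linear block_coord_bracket(3) bracket_block_vec(3)
          L25_adjoint.linear_mapD[OF lin] block_weight_def algebra_simps)
    show "f = 0" if "\<And>i. i \<in> ?I \<Longrightarrow> ?c i f = 0"
    proof
      fix x
      have "f (block_vec A i) = 0" if "A < 5" "i \<le> block_top A" for A i
      proof (rule block_coord_eqI)
        fix C k assume "C < 5" "k \<le> block_top C"
        then show "block_coord C k (f (block_vec A i)) = block_coord C k 0"
          using \<open>\<And>i. i \<in> ?I \<Longrightarrow> ?c i f = 0\<close>[of "(A, i, C, k)"] that by (simp add: block_coord_zero)
      qed
      then show "f x = 0 x"
        using linear_block_eq_0[OF lin] by simp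
    qed
  next
    show "\<bar>?w i\<bar> \<le> int 12" if "i \<in> ?I" for i
    proof -
      obtain A j C k where i: "i = (A, j, C, k)" by (cases i)
      show ?thesis
        using that block_weight_le[of A j] block_weight_le[of C k] by (auto simp: i)
    qed
  qed (auto simp: L25_adjoint.linear_map_iff L25_adjoint.lie1_def fun_eq_iff L25_bracket_add L25_bracket_scale
      vector_add_ldistrib vector_ssub_ldistrib block_coord_linear mult.commute)
qed

text \<open>A coordinate now involves three basis vectors, two of them as arguments with negated
  weight, hence the bound 18.\<close>

lemma sl2_weight_module_lie2:
  "sl2_weight_module (\<lambda>c (w :: complex ^ 25 \<Rightarrow> complex ^ 25 \<Rightarrow> complex ^ 25) x y. c *s w x y) {w. L25_adjoint.alternating_map w}
    (L25_adjoint.lie2 (L25_e 1)) (L25_adjoint.lie2 (L25_e 2)) (L25_adjoint.lie2 (L25_e 3))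
    {(A, i, B, j, C, k). A < 5 \<and> i \<le> block_top A \<and> B < 5 \<and> j \<le> block_top B \<and> C < 5 \<and> k \<le> block_top C}
    (\<lambda>(A, i, B, j, C, k). block_weight C k - block_weight A i - block_weight B j)
    (\<lambda>(A, i, B, j, C, k) w. block_coord C k (w (block_vec A i) (block_vec B j))) 18"
  (is "sl2_weight_module ?s ?V ?E ?F ?H ?I ?w ?c 18")
proof -
  have vs: "vector_space ?s"
    by unfold_locales (auto simp: fun_eq_iff vector_add_ldistrib vector_sadd_rdistrib vector_smult_assoc)
  have comm: "L25_adjoint.lie2 (L25_bracket a b) f = (\<lambda>x y. L25_adjoint.lie2 a (L25_adjoint.lie2 b f) x y - L25_adjoint.lie2 b (L25_adjoint.lie2 a f) x y)"
    if "L25_adjoint.alternating_map f" for a b f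
    by (intro ext) (rule L25_adjoint.lie2_bracket[OF that])
  have scale: "L25_adjoint.lie2 (c *s a) f = (\<lambda>x y. c *s L25_adjoint.lie2 a f x y)" if "L25_adjoint.alternating_map f" for c a f
    by (intro ext) (simp add: L25_adjoint.lie2_def L25_bracket_scale vector_ssub_ldistrib
        L25_adjoint.linear_mapD[OF L25_adjoint.alternating_mapD(1)[OF that]] L25_adjoint.linear_mapD[OF L25_adjoint.alternating_mapD(2)[OF that]])
  show ?thesis
  proof (intro sl2_weight_module.intro vs sl2_weight_module_axioms.intro)
    fix f assume f: "f \<in> ?V"
    then have alt: "L25_adjoint.alternating_map f"
      by simp
    note lin = L25_adjoint.linear_mapD[OF L25_adjoint.alternating_mapD(1)[OF alt]]
      L25_adjoint.linear_mapD[OF L25_adjoint.alternating_mapD(2)[OF alt]]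
    show "?E f \<in> ?V" "?F f \<in> ?V" "?H f \<in> ?V"
      using L25_adjoint.alternating_lie2[OF alt] by simp_all
    show "?E (?F f) = ?F (?E f) + ?H f"
      using comm[OF alt, of "L25_e 1" "L25_e 2"] by (simp add: L25_e_brackets fun_eq_iff del: One_nat_def)
    show "?H (?E f) = ?E (?H f) + ?s 2 (?E f)"
      using comm[OF alt, of "L25_e 3" "L25_e 1"] scale[OF alt, of 2 "L25_e 1"] by (simp add: L25_e_brackets fun_eq_iff algebra_simps del: One_nat_def)
    show "?H (?F f) = ?F (?H f) + ?s (- 2) (?F f)"
      using comm[OF alt, of "L25_e 3" "L25_e 2"] scale[OF alt, of "- 2" "L25_e 2"] by (simp add: L25_e_brackets fun_eq_iff algebra_simps del: One_nat_def)
    show "?c i (?H f) = of_int (?w i) * ?c i f" if "i \<in> ?I" for i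
      using that by (auto simp: L25_adjoint.lie2_def block_coord_linear block_coord_bracket(3) bracket_block_vec(3)
          lin block_weight_def algebra_simps)
    show "f = 0" if "\<And>i. i \<in> ?I \<Longrightarrow> ?c i f = 0"
    proof (intro ext)
      fix x y
      have "f (block_vec A i) (block_vec B j) = 0" if "A < 5" "i \<le> block_top A" "B < 5" "j \<le> block_top B" for A i B j
      proof (rule block_coord_eqI)
        fix C k assume "C < 5" "k \<le> block_top C"
        then show "block_coord C k (f (block_vec A i) (block_vec B j)) = block_coord C k 0"
          using \<open>\<And>i. i \<in> ?I \<Longrightarrow> ?c i f = 0\<close>[of "(A, i, B, j, C, k)"] that by (simp add: block_coord_zero)
      qed
      then have "f (block_vec A i) y = 0" if "A < 5" "i \<le> block_top A" for A i
        using linear_block_eq_0[OF L25_adjoint.alternating_mapD(1)[OF alt]] that by blast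
      then show "f x y = 0 x y"
        using linear_block_eq_0[OF L25_adjoint.alternating_mapD(2)[OF alt]] by simp
    qed
  next
    show "\<bar>?w i\<bar> \<le> int 18" if "i \<in> ?I" for i
    proof -
      obtain A a B b C c where i: "i = (A, a, B, b, C, c)" by (cases i)
      show ?thesis
        using that block_weight_le[of A a] block_weight_le[of B b] block_weight_le[of C c] by (auto simp: i)
    qed
  qed (auto simp: L25_adjoint.alternating_map_def L25_adjoint.linear_map_iff L25_adjoint.lie2_def fun_eq_iff L25_bracket_add L25_bracket_scale
      vector_add_ldistrib vector_ssub_ldistrib block_coord_linear mult.commute)
qed

section \<open>Invariant cochains\<close>

definition invariant1 :: "(complex ^ 25 \<Rightarrow> complex ^ 25) \<Rightarrow> bool" where
  "invariant1 f \<longleftrightarrow> L25_linear f \<and> (\<forall>a\<in>{1, 2, 3}. \<forall>x. L25_bracket (L25_e a) (f x) = f (L25_bracket (L25_e a) x))"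

definition invariant2 :: "(complex ^ 25 \<Rightarrow> complex ^ 25 \<Rightarrow> complex ^ 25) \<Rightarrow> bool" where
  "invariant2 w \<longleftrightarrow> L25_adjoint.alternating_map w \<and> (\<forall>a\<in>{1, 2, 3}. \<forall>x y.
     L25_bracket (L25_e a) (w x y) = w (L25_bracket (L25_e a) x) y + w x (L25_bracket (L25_e a) y))"

lemma even_block_top: "A < 5 \<Longrightarrow> even (block_top A)"
proof -
  assume "A < 5"
  then have "A = 0 \<or> A = 1 \<or> A = 2 \<or> A = 3 \<or> A = 4"
    by linarith
  then show ?thesis
    by (auto simp: block_top_def)
qed

section \<open>Matrix entries of invariant linear maps: Schur's lemma\<close>

lemma invariant1_coord_E:
  assumes f: "invariant1 f" and "A < 5" "i \<le> block_top A" "C < 5" "k \<le> block_top C"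
  shows "of_nat (k + 1) * block_coord C (k + 1) (f (block_vec A i)) = of_nat i * block_coord C k (f (block_vec A (i - 1)))"
proof -
  have "block_coord C k (L25_bracket (L25_e 1) (f (block_vec A i))) = block_coord C k (f (L25_bracket (L25_e 1) (block_vec A i)))"
    using f by (simp add: invariant1_def)
  then show ?thesis
    using f assms(2-) L25_adjoint.linear_mapD(2)[of f]
    by (simp add: invariant1_def block_coord_bracket(1) bracket_block_vec(1) block_coord_linear del: One_nat_def)
qed

lemma invariant1_coord_F:
  assumes f: "invariant1 f" and "A < 5" "i \<le> block_top A" "C < 5" "k \<le> block_top C"
  shows "of_nat (block_top A - i) * block_coord C k (f (block_vec A (i + 1))) =
    of_nat (block_top C + 1 - k) * (if k = 0 then 0 else block_coord C (k - 1) (f (block_vec A i)))"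
proof -
  have "block_coord C k (L25_bracket (L25_e 2) (f (block_vec A i))) = block_coord C k (f (L25_bracket (L25_e 2) (block_vec A i)))"
    using f by (simp add: invariant1_def)
  then show ?thesis
    using f assms(2-) L25_adjoint.linear_mapD(2)[of f]
    by (simp add: invariant1_def block_coord_bracket(2) bracket_block_vec(2) block_coord_linear del: of_nat_diff)
qed

lemma invariant1_coord_H:
  assumes f: "invariant1 f" and "A < 5" "i \<le> block_top A" "C < 5" "k \<le> block_top C"
    and "block_weight C k \<noteq> block_weight A i"
  shows "block_coord C k (f (block_vec A i)) = 0"
proof -
  have "block_coord C k (L25_bracket (L25_e 3) (f (block_vec A i))) = block_coord C k (f (L25_bracket (L25_e 3) (block_vec A i)))"
    using f by (simp add: invariant1_def)
  then have "of_int (block_weight C k) * block_coord C k (f (block_vec A i)) = of_int (block_weight A i) * block_coord C k (f (block_vec A i))"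
    using f assms(2-) L25_adjoint.linear_mapD(2)[of f]
    by (simp add: invariant1_def block_coord_bracket(3) bracket_block_vec(3) block_coord_linear flip: block_weight_def)
  then show ?thesis
    using assms(6) by simp
qed

text \<open>Schur's lemma. The relation for \<open>E\<close> forces the image of \<open>f_0\<close>
  to consist of highest weight vectors, the one for \<open>H\<close> selects the blocks of equal
  top, and the one for \<open>F\<close> carries the same scalar along the block.\<close>

lemma invariant1_coord:
  assumes f: "invariant1 f" and A: "A < 5" and C: "C < 5" and "i \<le> block_top A" "k \<le> block_top C"
  shows "block_coord C k (f (block_vec A i)) =
    (if block_top A = block_top C \<and> i = k then block_coord C 0 (f (block_vec A 0)) else 0)"
  using assms(4,5)
proof (induction i arbitrary: k)
  case 0
  show ?case
  proof (cases k)
    case 0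
    then show ?thesis
      using invariant1_coord_H[OF f A _ C, of 0 0] by (auto simp: block_weight_def)
  next
    case (Suc l)
    then show ?thesis
      using invariant1_coord_E[OF f A _ C, of 0 l] "0.prems" by (simp del: of_nat_Suc)
  qed
next
  case (Suc i)
  have "of_nat (block_top A - i) * block_coord C k (f (block_vec A (Suc i))) =
      of_nat (block_top C + 1 - k) * (if k = 0 then 0 else block_coord C (k - 1) (f (block_vec A i)))"
    using invariant1_coord_F[OF f A _ C, of i k] Suc.prems by simp
  moreover have "(of_nat (block_top A - i) :: complex) \<noteq> 0"
    using Suc.prems by simp
  ultimately show ?case
    using Suc.prems Suc.IH[of "k - 1"] by (cases k) (auto simp del: of_nat_Suc of_nat_diff)
qed

section \<open>Coefficients of invariant alternating maps: transvectants\<close>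

lemma invariant2_coord_E:
  assumes w: "invariant2 w" and "A < 5" "i \<le> block_top A" "B < 5" "j \<le> block_top B" "C < 5" "k \<le> block_top C"
  shows "of_nat (k + 1) * block_coord C (k + 1) (w (block_vec A i) (block_vec B j)) =
    of_nat i * block_coord C k (w (block_vec A (i - 1)) (block_vec B j)) +
    of_nat j * block_coord C k (w (block_vec A i) (block_vec B (j - 1)))"
proof -
  have "block_coord C k (L25_bracket (L25_e 1) (w (block_vec A i) (block_vec B j))) =
     block_coord C k (w (L25_bracket (L25_e 1) (block_vec A i)) (block_vec B j) + w (block_vec A i) (L25_bracket (L25_e 1) (block_vec B j)))"
    using w by (simp add: invariant2_def)
  then show ?thesis
    using w assms(2-) L25_adjoint.linear_mapD(2)[OF L25_adjoint.alternating_mapD(1)[of w]]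
      L25_adjoint.linear_mapD(2)[OF L25_adjoint.alternating_mapD(2)[of w]]
    by (simp add: invariant2_def block_coord_bracket(1) bracket_block_vec(1) block_coord_linear del: One_nat_def)
qed

lemma invariant2_coord_F:
  assumes w: "invariant2 w" and "A < 5" "i \<le> block_top A" "B < 5" "j \<le> block_top B" "C < 5" "k \<le> block_top C"
  shows "of_nat (block_top C + 1 - k) * (if k = 0 then 0 else block_coord C (k - 1) (w (block_vec A i) (block_vec B j))) =
    of_nat (block_top A - i) * block_coord C k (w (block_vec A (i + 1)) (block_vec B j)) +
    of_nat (block_top B - j) * block_coord C k (w (block_vec A i) (block_vec B (j + 1)))"
proof -
  have "block_coord C k (L25_bracket (L25_e 2) (w (block_vec A i) (block_vec B j))) =
     block_coord C k (w (L25_bracket (L25_e 2) (block_vec A i)) (block_vec B j) + w (block_vec A i) (L25_bracket (L25_e 2) (block_vec B j)))"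
    using w by (simp add: invariant2_def)
  then show ?thesis
    using w assms(2-) L25_adjoint.linear_mapD(2)[OF L25_adjoint.alternating_mapD(1)[of w]]
      L25_adjoint.linear_mapD(2)[OF L25_adjoint.alternating_mapD(2)[of w]]
    by (simp add: invariant2_def block_coord_bracket(2) bracket_block_vec(2) block_coord_linear del: of_nat_diff)
qed

lemma invariant2_coord_H:
  assumes w: "invariant2 w" and "A < 5" "i \<le> block_top A" "B < 5" "j \<le> block_top B" "C < 5" "k \<le> block_top C"
    and "block_weight C k \<noteq> block_weight A i + block_weight B j"
  shows "block_coord C k (w (block_vec A i) (block_vec B j)) = 0"
proof -
  have "block_coord C k (L25_bracket (L25_e 3) (w (block_vec A i) (block_vec B j))) =
     block_coord C k (w (L25_bracket (L25_e 3) (block_vec A i)) (block_vec B j) + w (block_vec A i) (L25_bracket (L25_e 3) (block_vec B j)))"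
    using w by (simp add: invariant2_def)
  then have "of_int (block_weight C k) * block_coord C k (w (block_vec A i) (block_vec B j)) =
     of_int (block_weight A i + block_weight B j) * block_coord C k (w (block_vec A i) (block_vec B j))"
    using w assms(2-) L25_adjoint.linear_mapD(2)[OF L25_adjoint.alternating_mapD(1)[of w]]
      L25_adjoint.linear_mapD(2)[OF L25_adjoint.alternating_mapD(2)[of w]]
    by (simp add: invariant2_def block_coord_bracket(3) bracket_block_vec(3) block_coord_linear distrib_right flip: block_weight_def)
  then show ?thesis
    using assms(8) by (metis mult_cancel_right of_int_eq_iff)
qed

text \<open>Up to a scalar there is at most one equivariant map from the tensor product of the irreducible modules
  of highest weights \<open>a\<close> and \<open>b\<close> to the one of highest weight \<open>c = a + b - 2 n\<close>; if it sends
  \<open>f\<^sub>0 \<otimes> f\<^sub>n\<close> to \<open>f\<^sub>0\<close>, then it sends \<open>f\<^sub>i \<otimes> f\<^sub>j\<close> to \<open>transvectant a b c n i j\<close> times \<open>f\<^bsub>i+j-n\<^esub>\<close>.\<close>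

fun transvectant :: "nat \<Rightarrow> nat \<Rightarrow> nat \<Rightarrow> nat \<Rightarrow> nat \<Rightarrow> nat \<Rightarrow> complex" where
  "transvectant a b c n 0 j = of_nat (j choose n)"
| "transvectant a b c n (Suc i) j =
     ((of_nat c + of_nat n - of_nat i - of_nat j) * transvectant a b c n i j
      - (of_nat b - of_nat j) * transvectant a b c n i (Suc j)) / (of_nat a - of_nat i)"

text \<open>The target index \<open>i + j - n\<close> would be negative. This makes the recursion
  agree with the relation for \<open>F\<close> at \<open>k = 0\<close>, where the entry with index
  \<open>k - 1\<close> is replaced by zero.\<close>

lemma transvectant_eq_0: "i + j < n \<Longrightarrow> transvectant a b c n i j = 0"
  by (induction i arbitrary: j) auto

text \<open>By truncation, \<open>coupling_degree\<close> is zero for inadmissible triples with \<open>c > a + b\<close>; hence the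
  second condition in \<open>coupled_coord\<close>.\<close>

definition coupling_degree :: "nat \<Rightarrow> nat \<Rightarrow> nat \<Rightarrow> nat" where
  "coupling_degree A B C = (block_top A + block_top B - block_top C) div 2"

definition coupling :: "(complex ^ 25 \<Rightarrow> complex ^ 25 \<Rightarrow> complex ^ 25) \<Rightarrow> nat \<Rightarrow> nat \<Rightarrow> nat \<Rightarrow> complex" where
  "coupling w A B C = block_coord C 0 (w (block_vec A 0) (block_vec B (coupling_degree A B C)))"

definition coupled_coord :: "(nat \<Rightarrow> nat \<Rightarrow> nat \<Rightarrow> complex) \<Rightarrow> nat \<Rightarrow> nat \<Rightarrow> nat \<Rightarrow> nat \<Rightarrow> nat \<Rightarrow> nat \<Rightarrow> complex" where
  "coupled_coord p A i B j C k =
    (if i + j = k + coupling_degree A B C \<and> block_top C \<le> block_top A + block_top B \<and> k \<le> block_top C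
     then p A B C * transvectant (block_top A) (block_top B) (block_top C) (coupling_degree A B C) i j else 0)"

text \<open>The relation for \<open>H\<close> leaves only entries of matching weight. Along the row
  \<open>i = 0\<close> the relation for \<open>E\<close> produces binomial coefficients, and the
  relation for \<open>F\<close> then gives each further row by the recursion of
  \<open>transvectant\<close>. Thus the single number \<open>coupling w A B C\<close> determines the
  whole component.\<close>

lemma invariant2_coord:
  assumes w: "invariant2 w" and A: "A < 5" and B: "B < 5" and C: "C < 5"
    and "i \<le> block_top A" "j \<le> block_top B" "k \<le> block_top C"
  shows "block_coord C k (w (block_vec A i) (block_vec B j)) = coupled_coord (coupling w) A i B j C k"
proof -
  let ?n = "coupling_degree A B C"
  let ?c = "\<lambda>i j k. block_coord C k (w (block_vec A i) (block_vec B j))"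
  have n: "block_top C \<le> block_top A + block_top B \<Longrightarrow> block_top A + block_top B = block_top C + 2 * ?n"
    using even_block_top[OF A] even_block_top[OF B] even_block_top[OF C] by (auto simp: coupling_degree_def elim!: evenE)
  have off: "?c i j k = 0" if "i \<le> block_top A" "j \<le> block_top B" "k \<le> block_top C"
    "block_top C \<le> block_top A + block_top B" "i + j \<noteq> k + ?n" for i j k
  proof (rule invariant2_coord_H[OF w A that(1) B that(2) C that(3)])
    show "block_weight C k \<noteq> block_weight A i + block_weight B j"
      using n[OF that(4)] that(5) unfolding block_weight_def by linarith
  qed
  \<comment> \<open>Since \<open>E\<close> kills \<open>f_0\<close> of block \<open>A\<close>, the
    relation for \<open>E\<close> connects only neighbouring entries of this row; their ratio is
    that of consecutive binomial coefficients.\<close>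
  have row_0: "?c 0 j k = coupled_coord (coupling w) A 0 B j C k" if "j \<le> block_top B" "k \<le> block_top C" for j k
  proof (cases "block_top C \<le> block_top A + block_top B")
    case le: True
    show ?thesis
    proof (cases "j = k + ?n")
      case True
      have "?c 0 (k + ?n) k = coupling w A B C * of_nat ((k + ?n) choose ?n)"
        using that unfolding True
      proof (induction k)
        case 0
        then show ?case
          by (simp add: coupling_def)
      next
        case (Suc k)
        have "of_nat (Suc k) * ?c 0 (Suc k + ?n) (Suc k) = of_nat (Suc k + ?n) * ?c 0 (k + ?n) k"
          using invariant2_coord_E[OF w A _ B _ C, of 0 "Suc k + ?n" k] Suc.prems by (simp del: of_nat_Suc)
        also have "?c 0 (k + ?n) k = coupling w A B C * of_nat ((k + ?n) choose ?n)"
          using Suc.prems by (intro Suc.IH) auto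
        also have "of_nat (Suc k + ?n) * (coupling w A B C * of_nat ((k + ?n) choose ?n)) =
            coupling w A B C * of_nat ((Suc k + ?n) * ((Suc k + ?n - 1) choose ?n))"
          by (simp only: of_nat_mult mult_ac add_Suc diff_Suc_1)
        also have "(Suc k + ?n) * ((Suc k + ?n - 1) choose ?n) = Suc k * ((Suc k + ?n) choose ?n)"
          using binomial_absorb_comp[of "Suc k + ?n" ?n] by simp
        finally have "of_nat (Suc k) * ?c 0 (Suc k + ?n) (Suc k) = of_nat (Suc k) * (coupling w A B C * of_nat ((Suc k + ?n) choose ?n))"
          by (simp only: of_nat_mult mult_ac)
        then show ?case
          by (simp del: of_nat_Suc)
      qed
      then show ?thesis
        using True le that by (simp add: coupled_coord_def)
    next
      case False
      then show ?thesis
        using off[of 0 j k] that le by (simp add: coupled_coord_def)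
    qed
  next
    case False
    \<comment> \<open>The highest weight of \<open>C\<close> is now larger than every weight of the
      tensor product. The entries with \<open>k = 0\<close> vanish by weight, and the relation for
      \<open>E\<close> reduces the others to smaller \<open>j\<close> and \<open>k\<close>.\<close>
    have "?c 0 j k = 0"
      using that
    proof (induction j arbitrary: k)
      case 0
      show ?case
      proof (cases k)
        case 0
        then show ?thesis
          using False by (intro invariant2_coord_H[OF w A _ B _ C]) (auto simp: block_weight_def)
      next
        case (Suc l)
        then show ?thesis
          using invariant2_coord_E[OF w A _ B _ C, of 0 0 l] "0.prems" by (simp del: of_nat_Suc)
      qed
    next
      case (Suc j)
      show ?case
      proof (cases k)
        case 0
        then show ?thesis
          using False Suc.prems by (intro invariant2_coord_H[OF w A _ B _ C]) (auto simp: block_weight_def)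
      next
        case (Suc l)
        then show ?thesis
          using invariant2_coord_E[OF w A _ B _ C, of 0 "Suc j" l] Suc.prems Suc.IH[of l] by (simp del: of_nat_Suc)
      qed
    qed
    then show ?thesis
      using False by (simp add: coupled_coord_def)
  qed
  show ?thesis
    using assms(5-)
  proof (induction i arbitrary: j k)
    case 0
    then show ?case
      by (intro row_0) auto
  next
    case (Suc i)
    have i: "i \<le> block_top A" "i < block_top A"
      using Suc.prems by auto
    have F: "(of_nat (block_top A) - of_nat i) * ?c (Suc i) j k =
        of_nat (block_top C + 1 - k) * (if k = 0 then 0 else ?c i j (k - 1)) - (of_nat (block_top B) - of_nat j) * ?c i (Suc j) k"
      using invariant2_coord_F[OF w A i(1) B Suc.prems(2) C Suc.prems(3)] i Suc.prems(2) by (simp add: of_nat_diff algebra_simps)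
    have ne: "(of_nat (block_top A) - of_nat i :: complex) \<noteq> 0"
      using i by simp
    \<comment> \<open>At \<open>j = block_top B\<close> the induction hypothesis says nothing about
      \<open>Suc j\<close>, but there the common factor is zero.\<close>
    have next_j: "(of_nat (block_top B) - of_nat j) * ?c i (Suc j) k = (of_nat (block_top B) - of_nat j) * coupled_coord (coupling w) A i B (Suc j) C k"
      using Suc.IH[of "Suc j" k] i Suc.prems by (cases "j = block_top B") auto
    show ?case
    proof (cases "block_top C \<le> block_top A + block_top B \<and> Suc i + j = k + ?n")
      case True
      have "of_nat (block_top C + 1 - k) * (if k = 0 then 0 else ?c i j (k - 1)) =
          coupling w A B C * ((of_nat (block_top C) + of_nat ?n - of_nat i - of_nat j) * transvectant (block_top A) (block_top B) (block_top C) ?n i j)"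
      proof (cases k)
        case 0
        then show ?thesis
          using True by (simp add: transvectant_eq_0)
      next
        case (Suc l)
        have "of_nat (block_top C + 1 - k) = (of_nat (block_top C) + of_nat ?n - of_nat i - of_nat j :: complex)"
        proof -
          have "block_top C + 1 - k + i + j = block_top C + ?n"
            using True Suc.prems Suc \<open>k \<le> block_top C\<close> by linarith
          then have "of_nat (block_top C + 1 - k) + of_nat i + of_nat j = (of_nat (block_top C) + of_nat ?n :: complex)"
            by (metis of_nat_add)
          then show ?thesis
            by (simp add: algebra_simps)
        qed
        moreover have "?c i j (k - 1) = coupling w A B C * transvectant (block_top A) (block_top B) (block_top C) ?n i j"
          using Suc.IH[of j "k - 1"] True Suc i \<open>j \<le> block_top B\<close> \<open>k \<le> block_top C\<close> by (simp add: coupled_coord_def)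
        ultimately show ?thesis
          using Suc by simp
      qed
      then have "(of_nat (block_top A) - of_nat i) * ?c (Suc i) j k =
          coupling w A B C * ((of_nat (block_top C) + of_nat ?n - of_nat i - of_nat j) * transvectant (block_top A) (block_top B) (block_top C) ?n i j
           - (of_nat (block_top B) - of_nat j) * transvectant (block_top A) (block_top B) (block_top C) ?n i (Suc j))"
        unfolding F next_j using True Suc.prems by (simp add: coupled_coord_def algebra_simps)
      then have "?c (Suc i) j k = coupling w A B C * transvectant (block_top A) (block_top B) (block_top C) ?n (Suc i) j"
        using ne by (simp add: field_simps)
      then show ?thesis
        using True Suc.prems by (simp add: coupled_coord_def del: transvectant.simps)
    next
      case False
      show ?thesis
      proof (cases "block_top C \<le> block_top A + block_top B")
        case True
        then show ?thesis
          using off[of "Suc i" j k] Suc.prems False by (simp add: coupled_coord_def)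
      next
        case gt: False
        then have "(of_nat (block_top A) - of_nat i) * ?c (Suc i) j k = 0"
          unfolding F next_j using Suc.IH[of j "k - 1"] i Suc.prems by (simp add: coupled_coord_def)
        then show ?thesis
          using ne gt by (simp add: coupled_coord_def)
      qed
    qed
  qed
qed

section \<open>The nontrivial class\<close>

text \<open>Entries are read as in \<^const>\<open>L25_table\<close>. This is the solution of the cocycle equations
  whose only nonzero couplings, in the sense of the constant \<open>coupling\<close>, are \<open>45\<close>, \<open>20\<close>, \<open>6\<close>, \<open>- 40\<close>
  at the triples of blocks \<open>(1, 2, 2)\<close>, \<open>(1, 2, 3)\<close>, \<open>(2, 2, 3)\<close>, \<open>(2, 3, 4)\<close>.\<close>

definition L25_omega_table :: "(nat \<times> nat \<times> int \<times> nat) list" where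
  "L25_omega_table =
     [(11,20,-40,23), (11,21,-200,24), (11,22,-600,25), (12,19,30,23), (12,20,80,24), (12,21,100,25),
      (13,18,-40,23), (13,19,-60,24), (13,20,-40,25), (14,17,100,23), (14,18,80,24), (14,19,30,25),
      (15,16,-600,23), (15,17,-200,24), (15,18,-40,25), (4,14,45,11), (4,15,180,12), (5,13,-15,11),
      (5,15,90,13), (6,12,9,11), (6,13,-12,12), (6,14,-18,13), (6,15,36,14), (7,11,-9,11),
      (7,12,18,12), (7,14,-18,14), (7,15,9,15), (8,11,-36,12), (8,12,18,13), (8,13,12,14),
      (8,14,-9,15), (9,11,-90,13), (9,13,15,15), (10,11,-180,14), (10,12,-45,15), (4,13,20,16),
      (4,14,60,17), (4,15,120,18), (5,12,-10,16), (5,14,30,18), (5,15,80,19), (6,11,8,16),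
      (6,12,-12,17), (6,13,-12,18), (6,14,8,19), (6,15,48,20), (7,11,24,17), (7,12,-6,18),
      (7,13,-16,19), (7,14,-6,20), (7,15,24,21), (8,11,48,18), (8,12,8,19), (8,13,-12,20),
      (8,14,-12,21), (8,15,8,22), (9,11,80,19), (9,12,30,20), (9,14,-10,22), (10,11,120,20),
      (10,12,60,21), (10,13,20,22), (11,12,6,16), (11,13,12,17), (11,14,18,18), (11,15,24,19),
      (12,13,6,18), (12,14,12,19), (12,15,18,20), (13,14,6,20), (13,15,12,21), (14,15,6,22)]"

definition L25_omega :: "complex ^ 25 \<Rightarrow> complex ^ 25 \<Rightarrow> complex ^ 25" where
  "L25_omega x y = (\<Sum>(i, j, c, k)\<leftarrow>L25_omega_table.
     (of_int c * (x $ of_nat i * y $ of_nat j - x $ of_nat j * y $ of_nat i)) *s L25_e k)"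

lemma L25_omega_nth:
  assumes "m \<in> {1..25}"
  shows "L25_omega x y $ of_nat m = (\<Sum>(i, j, c, k)\<leftarrow>L25_omega_table.
    if k = m then of_int c * (x $ of_nat i * y $ of_nat j - x $ of_nat j * y $ of_nat i) else 0)"
proof -
  have *: "(\<Sum>t\<leftarrow>ts. f t) $ n = (\<Sum>t\<leftarrow>ts. f t $ n)" for f :: "'t \<Rightarrow> complex ^ 25" and ts n
    by (induction ts) auto
  have range: "list_all (\<lambda>(i, j, c, k). k \<in> {1..25}) L25_omega_table"
    by (simp add: L25_omega_table_def)
  show ?thesis
    unfolding L25_omega_def *
  proof (intro arg_cong[of _ _ sum_list] map_cong refl, clarify)
    fix i j c k assume "(i, j, c, k) \<in> set L25_omega_table"
    then have "k \<in> {1..25}"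
      using range by (auto simp: list_all_iff)
    then show "((of_int c * (x $ of_nat i * y $ of_nat j - x $ of_nat j * y $ of_nat i)) *s L25_e k) $ of_nat m =
        (if k = m then of_int c * (x $ of_nat i * y $ of_nat j - x $ of_nat j * y $ of_nat i) else 0)"
      using assms by (auto simp: L25_e_nth)
  qed
qed

context
  notes L25_omega_table_def [simp]
begin

lemmas L25_omega_nth_simps =
  L25_omega_nth[of 1, simplified] L25_omega_nth[of 2, simplified]
  L25_omega_nth[of 3, simplified] L25_omega_nth[of 4, simplified]
  L25_omega_nth[of 5, simplified] L25_omega_nth[of 6, simplified]
  L25_omega_nth[of 7, simplified] L25_omega_nth[of 8, simplified]
  L25_omega_nth[of 9, simplified] L25_omega_nth[of 10, simplified]
  L25_omega_nth[of 11, simplified] L25_omega_nth[of 12, simplified]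
  L25_omega_nth[of 13, simplified] L25_omega_nth[of 14, simplified]
  L25_omega_nth[of 15, simplified] L25_omega_nth[of 16, simplified]
  L25_omega_nth[of 17, simplified] L25_omega_nth[of 18, simplified]
  L25_omega_nth[of 19, simplified] L25_omega_nth[of 20, simplified]
  L25_omega_nth[of 21, simplified] L25_omega_nth[of 22, simplified]
  L25_omega_nth[of 23, simplified] L25_omega_nth[of 24, simplified]
  L25_omega_nth[of 25, simplified]

end

lemma alternating_L25_omega: "L25_adjoint.alternating_map L25_omega"
proof -
  have sum_list_scale: "a *s (\<Sum>t\<leftarrow>ts. f t) = (\<Sum>t\<leftarrow>ts. a *s f t)" for a and f :: "'t \<Rightarrow> complex ^ 25" and ts
    by (induction ts) (auto simp: vector_add_ldistrib)
  have "L25_omega x (y + z) = L25_omega x y + L25_omega x z"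
    "L25_omega (y + z) x = L25_omega y x + L25_omega z x" for x y z
    unfolding L25_omega_def sum_list_addf[symmetric]
    by (intro arg_cong[of _ _ sum_list] map_cong refl; force simp: algebra_simps vector_add_ldistrib Finite_Cartesian_Product.vec_eq_iff)+
  moreover have "L25_omega x (a *s y) = a *s L25_omega x y"
    "L25_omega (a *s y) x = a *s L25_omega y x" for a x y
    unfolding L25_omega_def sum_list_scale
    by (intro arg_cong[of _ _ sum_list] map_cong refl; force simp: algebra_simps Finite_Cartesian_Product.vec_eq_iff)+
  moreover have "L25_omega x x = 0" for x
  proof -
    have "(\<Sum>(i, j, c, k)\<leftarrow>ts. (of_int c * (x $ of_nat i * x $ of_nat j - x $ of_nat j * x $ of_nat i)) *s L25_e k) = 0" for ts
      by (induction ts) auto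
    then show ?thesis
      by (simp add: L25_omega_def)
  qed
  ultimately show ?thesis
    by (simp add: L25_adjoint.alternating_map_def L25_adjoint.linear_map_iff)
qed

lemma diff2_L25_omega: "L25_adjoint.diff2 L25_omega x y z = 0" (is "?J = 0")
proof -
  have "?J $ 1 = 0" "?J $ 2 = 0" "?J $ 3 = 0" "?J $ 4 = 0" "?J $ 5 = 0" "?J $ 6 = 0" "?J $ 7 = 0" "?J $ 8 =
    0" "?J $ 9 = 0" "?J $ 10 = 0" "?J $ 11 = 0" "?J $ 12 = 0" "?J $ 13 = 0" "?J $ 14 = 0" "?J $ 15 = 0"
    "?J $ 16 = 0" "?J $ 17 = 0" "?J $ 18 = 0" "?J $ 19 = 0" "?J $ 20 = 0" "?J $ 21 = 0" "?J $ 22 = 0"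
    "?J $ 23 = 0" "?J $ 24 = 0" "?J $ 25 = 0"
    unfolding L25_adjoint.diff2_def vector_add_component vector_minus_component L25_bracket_nth_simps L25_omega_nth_simps
    by Groebner_Basis.algebra+
  then have "list_all (\<lambda>m. ?J $ of_nat m = 0) [1..<26]"
    by (simp add: upt_rec)
  then have "?J $ of_nat m = 0 $ of_nat m" if "m \<in> {1..25}" for m
    using that by (auto simp: list_all_iff)
  then show ?thesis
    by (rule L25_vec_eqI)
qed

text \<open>Since \<open>e\<^sub>4\<close> and \<open>e\<^sub>1\<^sub>4\<close> commute and no bracket with either of them has an \<open>e\<^sub>1\<^sub>1\<close>-component, every coboundary has
  vanishing \<open>e\<^sub>1\<^sub>1\<close>-component at \<open>(e\<^sub>4, e\<^sub>1\<^sub>4)\<close>.\<close>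

lemma L25_omega_not_coboundary:
  assumes "L25_linear f"
  shows "L25_adjoint.diff1 f \<noteq> L25_omega"
proof
  assume eq: "L25_adjoint.diff1 f = L25_omega"
  have "L25_bracket (L25_e 4) (L25_e 14) = 0"
    by (rule L25_bracket_not_table) (auto simp: L25_table_def L25_sl2_action_def upt_rec)
  then have "L25_adjoint.diff1 f (L25_e 4) (L25_e 14) $ 11 = 0"
    using L25_adjoint.linear_mapD(3)[OF assms]
    by (simp add: L25_adjoint.diff1_def L25_bracket_nth_simps L25_e_def axis_def)
  moreover have "L25_omega (L25_e 4) (L25_e 14) $ 11 = 45"
    by (simp add: L25_omega_nth_simps L25_e_def axis_def)
  ultimately show False
    by (simp add: eq)
qed

section \<open>Compositions of invariant maps and the cocycle condition in terms of
  couplings\<close>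

lemma coupled_coord_eq_0: "block_top C < k \<Longrightarrow> coupled_coord p A i B j C k = 0"
  by (simp add: coupled_coord_def)

text \<open>By weight, each block \<open>M\<close> contributes only the vector with index
  \<open>i + j - n\<close>. If this subtraction truncates or the index lies beyond the block, the
  factor \<open>coupled_coord\<close> is zero.\<close>

lemma invariant2_block_vec:
  assumes w: "invariant2 w" and A: "A < 5" and B: "B < 5" and "i \<le> block_top A" "j \<le> block_top B"
  shows "w (block_vec A i) (block_vec B j) =
    (\<Sum>M<5. coupled_coord (coupling w) A i B j M (i + j - coupling_degree A B M) *s block_vec M (i + j - coupling_degree A B M))"
proof (rule block_coord_eqI)
  fix C k assume C: "C < 5" "k \<le> block_top C"
  have "block_coord C k (coupled_coord (coupling w) A i B j M (i + j - coupling_degree A B M) *s block_vec M (i + j - coupling_degree A B M)) =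
      (if M = C then coupled_coord (coupling w) A i B j C k else 0)" if "M < 5" for M
  proof (cases "i + j - coupling_degree A B M \<le> block_top M")
    case True
    then show ?thesis
      using that C by (auto simp: block_coord_linear block_coord_vec coupled_coord_def)
  next
    case False
    then show ?thesis
      using that C by (auto simp: block_coord_linear coupled_coord_def)
  qed
  then show "block_coord C k (w (block_vec A i) (block_vec B j)) = block_coord C k
      (\<Sum>M<5. coupled_coord (coupling w) A i B j M (i + j - coupling_degree A B M) *s block_vec M (i + j - coupling_degree A B M))"
    using C assms by (simp add: invariant2_coord block_coord_sum)
qed

text \<open>The coefficient of \<open>q (p x y) z\<close> at \<open>f\<^sub>l\<close> in block \<open>L\<close> for basis vectors \<open>x\<close>, \<open>y\<close>, \<open>z\<close>, where \<open>p\<close> and \<open>q\<close> are invariant maps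
  given by their coupling constants.\<close>

definition coupled_comp ::
  "(nat \<Rightarrow> nat \<Rightarrow> nat \<Rightarrow> complex) \<Rightarrow> (nat \<Rightarrow> nat \<Rightarrow> nat \<Rightarrow> complex) \<Rightarrow> nat \<Rightarrow> nat \<Rightarrow> nat \<Rightarrow> nat \<Rightarrow> nat \<Rightarrow> nat \<Rightarrow> nat \<Rightarrow> nat \<Rightarrow> complex" where
  "coupled_comp p q A i B j C k L l =
    (\<Sum>M<5. coupled_coord p A i B j M (i + j - coupling_degree A B M) *
       coupled_coord q M (i + j - coupling_degree A B M) C k L l)"

lemma invariant2_comp:
  assumes v: "invariant2 v" and w: "invariant2 w" and A: "A < 5" "i \<le> block_top A" and B: "B < 5" "j \<le> block_top B"
    and C: "C < 5" "k \<le> block_top C" and L: "L < 5" "l \<le> block_top L"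
  shows "block_coord L l (w (v (block_vec A i) (block_vec B j)) (block_vec C k)) =
    coupled_comp (coupling v) (coupling w) A i B j C k L l"
proof -
  note lin = L25_adjoint.linear_mapD[OF L25_adjoint.alternating_mapD(2), of w]
  have alt: "L25_adjoint.alternating_map w"
    using w by (simp add: invariant2_def)
  have sum: "w (sum g S) y = (\<Sum>x\<in>S. w (g x) y)" for g :: "'x \<Rightarrow> complex ^ 25" and S y
    by (induction S rule: infinite_finite_induct) (auto simp: lin[OF alt])
  have "block_coord L l (w (coupled_coord (coupling v) A i B j M (i + j - coupling_degree A B M) *s block_vec M (i + j - coupling_degree A B M)) (block_vec C k)) =
      coupled_coord (coupling v) A i B j M (i + j - coupling_degree A B M) *
       coupled_coord (coupling w) M (i + j - coupling_degree A B M) C k L l" if "M < 5" for M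
  proof (cases "i + j - coupling_degree A B M \<le> block_top M")
    case True
    then show ?thesis
      using that C L by (simp add: lin[OF alt] block_coord_linear invariant2_coord[OF w])
  next
    case False
    then show ?thesis
      by (simp add: coupled_coord_eq_0 lin[OF alt] block_coord_linear)
  qed
  then show ?thesis
    by (simp add: invariant2_block_vec[OF v A(1) B(1) A(2) B(2)] sum block_coord_sum coupled_comp_def)
qed

text \<open>By the Jacobi identity the bracket is itself an invariant alternating map, so the
  cocycle condition of an invariant cochain involves couplings only.\<close>

lemma invariant2_L25_bracket: "invariant2 L25_bracket"
  unfolding invariant2_def L25_adjoint.alternating_map_def
  by (simp add: L25_adjoint.linear_act_right L25_adjoint.linear_act_left L25_bracket_self L25_adjoint.act_bracket)

text \<open>Skew-symmetry brings every term to the shape \<open>q (p x y) z\<close>, at the price of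
  an overall sign. The result is symmetric in \<open>p\<close> and \<open>q\<close>: it is the
  linearised Jacobi identity for a deformation of \<open>q\<close> in the direction
  \<open>p\<close>.\<close>

definition coupled_diff2 where
  "coupled_diff2 p q A i B j C k L l = coupled_comp p q A i B j C k L l + coupled_comp q p A i B j C k L l
     - coupled_comp p q A i C k B j L l - coupled_comp q p A i C k B j L l
     + coupled_comp p q B j C k A i L l + coupled_comp q p B j C k A i L l"

lemma invariant2_diff2:
  assumes w: "invariant2 w" and A: "A < 5" "i \<le> block_top A" and B: "B < 5" "j \<le> block_top B"
    and C: "C < 5" "k \<le> block_top C" and L: "L < 5" "l \<le> block_top L"
  shows "block_coord L l (L25_adjoint.diff2 w (block_vec A i) (block_vec B j) (block_vec C k)) =
    - coupled_diff2 (coupling w) (coupling L25_bracket) A i B j C k L l"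
proof -
  have "L25_adjoint.diff2 w x y z = - (L25_bracket (w x y) z + w (L25_bracket x y) z - L25_bracket (w x z) y
      - w (L25_bracket x z) y + L25_bracket (w y z) x + w (L25_bracket y z) x)" for x y z
    using lie_algebra.bracket_skew[OF lie_algebra_L25, of x "w y z"]
      lie_algebra.bracket_skew[OF lie_algebra_L25, of y "w x z"] lie_algebra.bracket_skew[OF lie_algebra_L25, of z "w x y"]
    by (simp add: L25_adjoint.diff2_def)
  then show ?thesis
    using assms by (simp add: block_coord_linear invariant2_comp invariant2_L25_bracket coupled_diff2_def)
qed

section \<open>Skew-symmetry of couplings, and the couplings of the bracket\<close>

lemma coupling_degree_commute: "coupling_degree B A C = coupling_degree A B C"
  by (simp add: coupling_degree_def add.commute)

text \<open>The defining argument \<open>f_n\<close> of block \<open>B\<close> is zero. For highest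
  weights \<open>a\<close>, \<open>b\<close>, \<open>c\<close> this happens when
  \<open>c < a - b\<close>, one half of the triangle condition; the other half follows by exchanging
  \<open>A\<close> and \<open>B\<close>.\<close>

lemma coupling_eq_0: "block_top B < coupling_degree A B C \<Longrightarrow> invariant2 w \<Longrightarrow> coupling w A B C = 0"
  using L25_adjoint.linear_mapD(3)[OF L25_adjoint.alternating_mapD(1), of w]
  by (simp add: coupling_def block_coord_linear invariant2_def)

text \<open>Exchanging the arguments evaluates \<open>w\<close> at \<open>f_n\<close> of
  \<open>B\<close> and \<open>f_0\<close> of \<open>A\<close>, an entry that is expressed by the
  transvectant of the exchanged pair.\<close>

lemma coupling_commute:
  assumes w: "invariant2 w" and "A < 5" "B < 5" "C < 5" "block_top C \<le> block_top A + block_top B"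
  shows "coupling w A B C = (if block_top B < coupling_degree A B C then 0
    else - coupling w B A C * transvectant (block_top B) (block_top A) (block_top C) (coupling_degree A B C) (coupling_degree A B C) 0)"
proof (cases "block_top B < coupling_degree A B C")
  case False
  have "coupling w A B C = - block_coord C 0 (w (block_vec B (coupling_degree A B C)) (block_vec A 0))"
    using w L25_adjoint.alternating_mapD(4)[of w "block_vec A 0" "block_vec B (coupling_degree A B C)"]
    by (simp add: coupling_def invariant2_def block_coord_linear)
  then show ?thesis
    using False assms(2-)
    by (simp add: invariant2_coord[OF w] coupled_coord_def coupling_degree_commute[of B A] add.commute)
qed (simp add: coupling_eq_0 w)

text \<open>Each value is the coefficient of \<open>[f_0, f_n]\<close> at \<open>f_0\<close>, with
  \<open>n\<close> the coupling degree; for example, 60 at \<open>(1, 2, 4)\<close> is read from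
  \<open>[e4, e15] = 60 e23\<close>. In block 0 the vector \<open>f_1\<close> is
  \<open>- e3 / 2\<close>, so that bracketing \<open>f_0\<close> with it gives half the highest
  weight.\<close>

definition bracket_coupling :: "nat \<Rightarrow> nat \<Rightarrow> nat \<Rightarrow> complex" where
  "bracket_coupling A B C =
     (if A = 0 then if B = C then 1 else 0
      else if B = 0 then if A = C then of_nat (block_top A) / 2 else 0
      else if A = 1 then if B = 1 \<and> C = 3 then 3 else if B = 2 \<and> C = 4 then 60 else if B = 3 \<and> C = 4 then 15 else 0
      else if A = 2 then if B = 1 \<and> C = 4 then - 4 else if B = 2 \<and> C = 4 then 2 else 0
      else if A = 3 then if B = 1 \<and> C = 4 then 15 else 0
      else 0)"

lemma all_less_5: "(\<forall>A<5. P A) \<longleftrightarrow> P 0 \<and> P 1 \<and> P 2 \<and> P 3 \<and> P (4 :: nat)"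
  by (simp add: numeral_eq_Suc All_less_Suc conj_ac)

lemma coupling_bracket:
  assumes "A < 5" "B < 5" "C < 5"
  shows "coupling L25_bracket A B C = bracket_coupling A B C"
proof -
  have "\<forall>A<5. \<forall>B<5. \<forall>C<5. coupling L25_bracket A B C = bracket_coupling A B C"
    unfolding all_less_5
    by (intro conjI; simp add: coupling_def coupling_degree_def bracket_coupling_def block_top_def block_vec_def block_coord_def
        L25_e_def axis_def L25_bracket_nth_simps)
  then show ?thesis
    using assms by blast
qed

section \<open>The cocycle equations\<close>

lemma sum_less_5: "(\<Sum>M<5. f M) = f 0 + f (Suc 0) + f 2 + f 3 + f (4 :: nat)"
  by (simp add: numeral_eq_Suc lessThan_Suc add_ac)

lemma block_top_simps:
  "block_top 0 = 2" "block_top (Suc 0) = 6" "block_top 2 = 4" "block_top 3 = 6" "block_top 4 = 2"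
  by (simp_all add: block_top_def)

lemma binomial_numeral:
  "numeral m choose numeral n = (pred_numeral m choose pred_numeral n) + (pred_numeral m choose numeral n)"
  "Suc k choose numeral n = (k choose pred_numeral n) + (k choose numeral n)" "0 choose numeral n = 0"
  by (simp_all add: numeral_eq_Suc)

lemma transvectant_numeral:
  "transvectant a b c n (numeral i) j =
     ((of_nat c + of_nat n - of_nat (pred_numeral i) - of_nat j) * transvectant a b c n (pred_numeral i) j
      - (of_nat b - of_nat j) * transvectant a b c n (pred_numeral i) (Suc j)) / (of_nat a - of_nat (pred_numeral i))"
  by (simp add: numeral_eq_Suc)

lemmas coupled_diff2_eval = coupled_diff2_def coupled_comp_def sum_less_5 coupled_coord_def transvectant_numeral binomial_numeral
  block_top_simps coupling_degree_def bracket_coupling_def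

text \<open>The conclusion of \<open>coupling_commute\<close> for a bare array of numbers, so that
  the equations can be solved without reference to a cochain.\<close>

definition skew_coupling :: "(nat \<Rightarrow> nat \<Rightarrow> nat \<Rightarrow> complex) \<Rightarrow> bool" where
  "skew_coupling p \<longleftrightarrow> (\<forall>A<5. \<forall>B<5. \<forall>C<5. block_top C \<le> block_top A + block_top B \<longrightarrow>
     p A B C = (if block_top B < coupling_degree A B C then 0 else - p B A C *
       transvectant (block_top B) (block_top A) (block_top C) (coupling_degree A B C) (coupling_degree A B C) 0))"

text \<open>Couplings with \<open>A > B\<close> are eliminated in favour of \<open>A < B\<close>. A
  coupling vanishes for one of two reasons: either a block is paired with itself in even degree,
  where the transvectant is symmetric, or the three highest weights violate the triangle
  condition.\<close>

lemma skew_coupling_simps: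
  assumes "skew_coupling p"
  shows
    "p 0 0 2 = 0" "p 0 (Suc 0) 0 = 0" "p 0 (Suc 0) 4 = 0" "p 0 3 0 = 0" "p 0 3 4 = 0" "p (Suc 0) 0 0 = 0"
    "p (Suc 0) 0 (Suc 0) = 3 * p 0 (Suc 0) (Suc 0)" "p (Suc 0) 0 2 = - 15 * p 0 (Suc 0) 2"
    "p (Suc 0) 0 3 = 3 * p 0 (Suc 0) 3" "p (Suc 0) 0 4 = 0" "p (Suc 0) (Suc 0) 2 = 0" "p (Suc 0) 4 0 = 0"
    "p (Suc 0) 4 4 = 0" "p 2 0 0 = - 6 * p 0 2 0" "p 2 0 (Suc 0) = - p 0 2 (Suc 0)"
    "p 2 0 2 = 2 * p 0 2 2" "p 2 0 3 = - p 0 2 3" "p 2 0 4 = - 6 * p 0 2 4"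
    "p 2 (Suc 0) 0 = - (1 / 15) * p (Suc 0) 2 0" "p 2 (Suc 0) (Suc 0) = - (2 / 5) * p (Suc 0) 2 (Suc 0)"
    "p 2 (Suc 0) 2 = (1 / 5) * p (Suc 0) 2 2" "p 2 (Suc 0) 3 = - (2 / 5) * p (Suc 0) 2 3"
    "p 2 (Suc 0) 4 = - (1 / 15) * p (Suc 0) 2 4" "p 2 2 2 = 0" "p 3 0 0 = 0"
    "p 3 0 (Suc 0) = 3 * p 0 3 (Suc 0)" "p 3 0 2 = - 15 * p 0 3 2" "p 3 0 3 = 3 * p 0 3 3" "p 3 0 4 = 0"
    "p 3 (Suc 0) 0 = p (Suc 0) 3 0" "p 3 (Suc 0) (Suc 0) = p (Suc 0) 3 (Suc 0)"
    "p 3 (Suc 0) 2 = - p (Suc 0) 3 2" "p 3 (Suc 0) 3 = p (Suc 0) 3 3" "p 3 (Suc 0) 4 = p (Suc 0) 3 4"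
    "p 3 2 0 = - 15 * p 2 3 0" "p 3 2 (Suc 0) = - (5 / 2) * p 2 3 (Suc 0)" "p 3 2 2 = 5 * p 2 3 2"
    "p 3 2 3 = - (5 / 2) * p 2 3 3" "p 3 2 4 = - 15 * p 2 3 4" "p 3 3 2 = 0" "p 3 4 0 = 0" "p 3 4 4 = 0"
    "p 4 0 0 = p 0 4 0" "p 4 0 2 = - p 0 4 2" "p 4 0 4 = p 0 4 4" "p 4 (Suc 0) 0 = 0"
    "p 4 (Suc 0) (Suc 0) = (1 / 3) * p (Suc 0) 4 (Suc 0)" "p 4 (Suc 0) 2 = - (1 / 15) * p (Suc 0) 4 2"
    "p 4 (Suc 0) 3 = (1 / 3) * p (Suc 0) 4 3" "p 4 (Suc 0) 4 = 0" "p 4 2 0 = - (1 / 6) * p 2 4 0"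
    "p 4 2 (Suc 0) = - p 2 4 (Suc 0)" "p 4 2 2 = (1 / 2) * p 2 4 2" "p 4 2 3 = - p 2 4 3"
    "p 4 2 4 = - (1 / 6) * p 2 4 4" "p 4 3 0 = 0" "p 4 3 (Suc 0) = (1 / 3) * p 3 4 (Suc 0)"
    "p 4 3 2 = - (1 / 15) * p 3 4 2" "p 4 3 3 = (1 / 3) * p 3 4 3" "p 4 3 4 = 0" "p 4 4 2 = 0"
proof -
  have *: "p A B C = (if block_top B < coupling_degree A B C then 0 else - p B A C *
      transvectant (block_top B) (block_top A) (block_top C) (coupling_degree A B C) (coupling_degree A B C) 0)"
    if "A < 5" "B < 5" "C < 5" "block_top C \<le> block_top A + block_top B" for A B C
    using assms that unfolding skew_coupling_def by blast
  note eval = coupling_degree_def block_top_simps transvectant_numeral binomial_numeral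
  show "p 0 0 2 = 0"
    using *[of 0 0 2] by (simp add: eval)
  \<comment> \<open>The degree 3 exceeds the weight 2 of the first block but not the weight 6 of the
    second, so the vanishing is inherited from the exchanged pair.\<close>
  show "p 0 (Suc 0) 0 = 0"
    using *[of 0 "Suc 0" 0] *[of "Suc 0" 0 0] by (simp add: eval)
  show "p 0 (Suc 0) 4 = 0"
    using *[of 0 "Suc 0" 4] *[of "Suc 0" 0 4] by (simp add: eval)
  show "p 0 3 0 = 0"
    using *[of 0 3 0] *[of 3 0 0] by (simp add: eval)
  show "p 0 3 4 = 0"
    using *[of 0 3 4] *[of 3 0 4] by (simp add: eval)
  show "p (Suc 0) 0 0 = 0"
    using *[of "Suc 0" 0 0] by (simp add: eval)
  show "p (Suc 0) 0 (Suc 0) = 3 * p 0 (Suc 0) (Suc 0)"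
    using *[of "Suc 0" 0 "Suc 0"] by (simp add: eval)
  show "p (Suc 0) 0 2 = - 15 * p 0 (Suc 0) 2"
    using *[of "Suc 0" 0 2] by (simp add: eval)
  show "p (Suc 0) 0 3 = 3 * p 0 (Suc 0) 3"
    using *[of "Suc 0" 0 3] by (simp add: eval)
  show "p (Suc 0) 0 4 = 0"
    using *[of "Suc 0" 0 4] by (simp add: eval)
  show "p (Suc 0) (Suc 0) 2 = 0"
    using *[of "Suc 0" "Suc 0" 2] by (simp add: eval)
  show "p (Suc 0) 4 0 = 0"
    using *[of "Suc 0" 4 0] by (simp add: eval)
  show "p (Suc 0) 4 4 = 0"
    using *[of "Suc 0" 4 4] by (simp add: eval)
  show "p 2 0 0 = - 6 * p 0 2 0"
    using *[of 2 0 0] by (simp add: eval)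
  show "p 2 0 (Suc 0) = - p 0 2 (Suc 0)"
    using *[of 2 0 "Suc 0"] by (simp add: eval)
  show "p 2 0 2 = 2 * p 0 2 2"
    using *[of 2 0 2] by (simp add: eval)
  show "p 2 0 3 = - p 0 2 3"
    using *[of 2 0 3] by (simp add: eval)
  show "p 2 0 4 = - 6 * p 0 2 4"
    using *[of 2 0 4] by (simp add: eval)
  show "p 2 (Suc 0) 0 = - (1 / 15) * p (Suc 0) 2 0"
    using *[of 2 "Suc 0" 0] by (simp add: eval)
  show "p 2 (Suc 0) (Suc 0) = - (2 / 5) * p (Suc 0) 2 (Suc 0)"
    using *[of 2 "Suc 0" "Suc 0"] by (simp add: eval)
  show "p 2 (Suc 0) 2 = (1 / 5) * p (Suc 0) 2 2"
    using *[of 2 "Suc 0" 2] by (simp add: eval)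
  show "p 2 (Suc 0) 3 = - (2 / 5) * p (Suc 0) 2 3"
    using *[of 2 "Suc 0" 3] by (simp add: eval)
  show "p 2 (Suc 0) 4 = - (1 / 15) * p (Suc 0) 2 4"
    using *[of 2 "Suc 0" 4] by (simp add: eval)
  show "p 2 2 2 = 0"
    using *[of 2 2 2] by (simp add: eval)
  show "p 3 0 0 = 0"
    using *[of 3 0 0] by (simp add: eval)
  show "p 3 0 (Suc 0) = 3 * p 0 3 (Suc 0)"
    using *[of 3 0 "Suc 0"] by (simp add: eval)
  show "p 3 0 2 = - 15 * p 0 3 2"
    using *[of 3 0 2] by (simp add: eval)
  show "p 3 0 3 = 3 * p 0 3 3"
    using *[of 3 0 3] by (simp add: eval)
  show "p 3 0 4 = 0"
    using *[of 3 0 4] by (simp add: eval)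
  show "p 3 (Suc 0) 0 = p (Suc 0) 3 0"
    using *[of 3 "Suc 0" 0] by (simp add: eval)
  show "p 3 (Suc 0) (Suc 0) = p (Suc 0) 3 (Suc 0)"
    using *[of 3 "Suc 0" "Suc 0"] by (simp add: eval)
  show "p 3 (Suc 0) 2 = - p (Suc 0) 3 2"
    using *[of 3 "Suc 0" 2] by (simp add: eval)
  show "p 3 (Suc 0) 3 = p (Suc 0) 3 3"
    using *[of 3 "Suc 0" 3] by (simp add: eval)
  show "p 3 (Suc 0) 4 = p (Suc 0) 3 4"
    using *[of 3 "Suc 0" 4] by (simp add: eval)
  show "p 3 2 0 = - 15 * p 2 3 0"
    using *[of 3 2 0] by (simp add: eval)
  show "p 3 2 (Suc 0) = - (5 / 2) * p 2 3 (Suc 0)"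
    using *[of 3 2 "Suc 0"] by (simp add: eval)
  show "p 3 2 2 = 5 * p 2 3 2"
    using *[of 3 2 2] by (simp add: eval)
  show "p 3 2 3 = - (5 / 2) * p 2 3 3"
    using *[of 3 2 3] by (simp add: eval)
  show "p 3 2 4 = - 15 * p 2 3 4"
    using *[of 3 2 4] by (simp add: eval)
  show "p 3 3 2 = 0"
    using *[of 3 3 2] by (simp add: eval)
  show "p 3 4 0 = 0"
    using *[of 3 4 0] by (simp add: eval)
  show "p 3 4 4 = 0"
    using *[of 3 4 4] by (simp add: eval)
  show "p 4 0 0 = p 0 4 0"
    using *[of 4 0 0] by (simp add: eval)
  show "p 4 0 2 = - p 0 4 2"
    using *[of 4 0 2] by (simp add: eval)
  show "p 4 0 4 = p 0 4 4"
    using *[of 4 0 4] by (simp add: eval)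
  show "p 4 (Suc 0) 0 = 0"
    using *[of 4 "Suc 0" 0] *[of "Suc 0" 4 0] by (simp add: eval)
  show "p 4 (Suc 0) (Suc 0) = (1 / 3) * p (Suc 0) 4 (Suc 0)"
    using *[of 4 "Suc 0" "Suc 0"] by (simp add: eval)
  show "p 4 (Suc 0) 2 = - (1 / 15) * p (Suc 0) 4 2"
    using *[of 4 "Suc 0" 2] by (simp add: eval)
  show "p 4 (Suc 0) 3 = (1 / 3) * p (Suc 0) 4 3"
    using *[of 4 "Suc 0" 3] by (simp add: eval)
  show "p 4 (Suc 0) 4 = 0"
    using *[of 4 "Suc 0" 4] *[of "Suc 0" 4 4] by (simp add: eval)
  show "p 4 2 0 = - (1 / 6) * p 2 4 0"
    using *[of 4 2 0] by (simp add: eval)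
  show "p 4 2 (Suc 0) = - p 2 4 (Suc 0)"
    using *[of 4 2 "Suc 0"] by (simp add: eval)
  show "p 4 2 2 = (1 / 2) * p 2 4 2"
    using *[of 4 2 2] by (simp add: eval)
  show "p 4 2 3 = - p 2 4 3"
    using *[of 4 2 3] by (simp add: eval)
  show "p 4 2 4 = - (1 / 6) * p 2 4 4"
    using *[of 4 2 4] by (simp add: eval)
  show "p 4 3 0 = 0"
    using *[of 4 3 0] *[of 3 4 0] by (simp add: eval)
  show "p 4 3 (Suc 0) = (1 / 3) * p 3 4 (Suc 0)"
    using *[of 4 3 "Suc 0"] by (simp add: eval)
  show "p 4 3 2 = - (1 / 15) * p 3 4 2"
    using *[of 4 3 2] by (simp add: eval)
  show "p 4 3 3 = (1 / 3) * p 3 4 3"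
    using *[of 4 3 3] by (simp add: eval)
  show "p 4 3 4 = 0"
    using *[of 4 3 4] *[of 3 4 4] by (simp add: eval)
  show "p 4 4 2 = 0"
    using *[of 4 4 2] by (simp add: eval)
qed

text \<open>The equations are ordered so that each one contains a single new unknown.\<close>

lemma coupling_rigid:
  assumes p: "skew_coupling p"
    and eq: "\<And>A i B j C k L l. A < 5 \<Longrightarrow> i \<le> block_top A \<Longrightarrow> B < 5 \<Longrightarrow> j \<le> block_top B \<Longrightarrow> C < 5 \<Longrightarrow> k \<le> block_top C \<Longrightarrow>
      L < 5 \<Longrightarrow> l \<le> block_top L \<Longrightarrow> coupled_diff2 p bracket_coupling A i B j C k L l = 0"
    and [simp]: "p 0 0 4 = 0" "p 0 4 4 = 0" "p (Suc 0) (Suc 0) 3 = 0" "p (Suc 0) (Suc 0) 4 = 0" "p (Suc 0) 2 4 = 0" "p (Suc 0) 3 4 = 0" "p 2 2 4 = 0" "p 3 4 3 = 0" "p (Suc 0) 3 3 = 0" "p 2 3 4 = 0"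
  shows "\<forall>A<5. \<forall>B<5. \<forall>C<5. block_top C \<le> block_top A + block_top B \<longrightarrow> p A B C = 0"
proof -
  note eval = coupled_diff2_eval skew_coupling_simps[OF p]
  \<comment> \<open>The index pairs name three basis vectors and an output coordinate of the total
    weight; for any other output weight the equation is trivial. Here \<open>0 0\<close> and
    \<open>0 (Suc 0)\<close> stand for \<open>e1\<close> and \<open>- e3 / 2\<close>.\<close>
  have [simp]: "p 0 (Suc 0) 3 = 0"
    using eq[of 0 0 0 "Suc 0" "Suc 0" "Suc 0" 3 0] by (simp add: eval)
  have [simp]: "p 0 (Suc 0) 2 = 0"
    using eq[of 0 0 0 "Suc 0" "Suc 0" 2 2 0] by (simp add: eval)
  have [simp]: "p 0 2 (Suc 0) = 0"
    using eq[of 0 0 0 "Suc 0" 2 0 "Suc 0" 0] by (simp add: eval)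
  have [simp]: "p 0 2 3 = 0"
    using eq[of 0 0 0 "Suc 0" 2 0 3 0] by (simp add: eval)
  have [simp]: "p 0 2 0 = 0"
    using eq[of 0 0 0 "Suc 0" 2 2 0 0] by (simp add: eval)
  have [simp]: "p 0 2 4 = 0"
    using eq[of 0 0 0 "Suc 0" 2 2 4 0] by (simp add: eval)
  have [simp]: "p 0 3 (Suc 0) = 0"
    using eq[of 0 0 0 "Suc 0" 3 "Suc 0" "Suc 0" 0] by (simp add: eval)
  have [simp]: "p 0 3 2 = 0"
    using eq[of 0 0 0 "Suc 0" 3 2 2 0] by (simp add: eval)
  have [simp]: "p 0 4 2 = 0"
    using eq[of 0 0 0 "Suc 0" 4 0 2 0] by (simp add: eval)
  have [simp]: "p 0 4 0 = 0"
    using eq[of 0 0 0 "Suc 0" 4 "Suc 0" 0 0] by (simp add: eval)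
  have [simp]: "p 0 0 0 = 0"
    using eq[of 0 0 0 "Suc 0" 4 "Suc 0" 4 0] by (simp add: eval)
  \<comment> \<open>Both \<open>e1\<close> and \<open>e16\<close> are highest weight vectors, on
    which couplings of positive degree vanish; this keeps the still undetermined
    \<open>p 0 3 3\<close> out of the equation.\<close>
  have [simp]: "p 0 (Suc 0) (Suc 0) = 0"
    using eq[of 0 0 "Suc 0" 6 3 0 4 0] by (simp add: eval)
  have [simp]: "p (Suc 0) (Suc 0) (Suc 0) = 0"
    using eq[of "Suc 0" 0 "Suc 0" "Suc 0" "Suc 0" 5 3 0] by (simp add: eval)
  have [simp]: "p (Suc 0) 3 2 = 0"
    using eq[of "Suc 0" 0 "Suc 0" "Suc 0" "Suc 0" 6 2 0] by (simp add: eval)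
  have [simp]: "p (Suc 0) 4 2 = 0"
    using eq[of "Suc 0" 0 2 2 2 3 2 0] by (simp add: eval)
  have [simp]: "p 2 3 0 = 0"
    using eq[of "Suc 0" 0 2 "Suc 0" 3 4 "Suc 0" 0] by (simp add: eval)
  have [simp]: "p 3 3 (Suc 0) = 0"
    using eq[of "Suc 0" 0 "Suc 0" 3 3 3 "Suc 0" 0] by (simp add: eval)
  have [simp]: "p 3 3 0 = 0"
    using eq[of "Suc 0" 0 3 2 3 4 "Suc 0" 0] by (simp add: eval)
  have [simp]: "p 3 4 (Suc 0) = 0"
    using eq[of "Suc 0" 0 "Suc 0" 3 4 "Suc 0" "Suc 0" 0] by (simp add: eval)
  have [simp]: "p (Suc 0) 4 (Suc 0) = 0"
    using eq[of "Suc 0" 0 "Suc 0" 3 4 "Suc 0" 3 0] by (simp add: eval)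
  have [simp]: "p 3 4 2 = 0"
    using eq[of "Suc 0" 0 "Suc 0" 3 4 2 2 0] by (simp add: eval)
  have [simp]: "p 2 3 (Suc 0) = 0"
    using eq[of "Suc 0" 0 2 "Suc 0" 3 4 3 0] by (simp add: eval)
  have [simp]: "p 2 3 3 = 0"
    using eq[of "Suc 0" 0 "Suc 0" 5 2 3 3 3] by (simp add: eval)
  have [simp]: "p 2 4 0 = 0"
    using eq[of "Suc 0" 0 2 "Suc 0" 4 2 "Suc 0" 0] by (simp add: eval)
  have [simp]: "p 2 4 (Suc 0) = 0"
    using eq[of "Suc 0" 0 2 "Suc 0" 4 2 3 0] by (simp add: eval)
  have [simp]: "p 2 4 3 = 0"
    using eq[of 2 0 2 "Suc 0" 2 2 3 0] by (simp add: eval)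
  have [simp]: "p 4 4 0 = 0"
    using eq[of "Suc 0" 0 4 0 4 2 "Suc 0" 0] by (simp add: eval)
  have [simp]: "p (Suc 0) 3 0 = 0"
    using eq[of "Suc 0" "Suc 0" 3 "Suc 0" 3 4 3 0] by (simp add: eval)
  have [simp]: "p (Suc 0) 4 3 = 0"
    using eq[of "Suc 0" "Suc 0" "Suc 0" 4 2 2 3 2] by (simp add: eval)
  have [simp]: "p (Suc 0) 2 0 = 0"
    using eq[of "Suc 0" 2 2 2 3 "Suc 0" 3 0] by (simp add: eval)
  have [simp]: "p 2 2 0 = 0"
    using eq[of 2 0 2 3 3 "Suc 0" 3 0] by (simp add: eval)
  have [simp]: "p 0 2 2 = 0"
    using eq[of 0 0 0 "Suc 0" 2 "Suc 0" 2 0] by (simp add: eval)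
  have [simp]: "p 0 3 3 = 0"
    using eq[of 0 0 0 "Suc 0" 3 "Suc 0" 3 0] by (simp add: eval)
  have [simp]: "p (Suc 0) 2 (Suc 0) = 0"
    using eq[of "Suc 0" 0 "Suc 0" "Suc 0" 2 4 3 0] by (simp add: eval)
  have [simp]: "p (Suc 0) 3 (Suc 0) = 0"
    using eq[of "Suc 0" 0 "Suc 0" "Suc 0" 3 5 3 0] by (simp add: eval)
  have [simp]: "p 2 3 2 = 0"
    using eq[of "Suc 0" 0 "Suc 0" 3 2 3 2 0] by (simp add: eval)
  have [simp]: "p 3 3 4 = 0"
    using eq[of "Suc 0" 0 "Suc 0" 3 3 5 4 0] by (simp add: eval)
  have [simp]: "p (Suc 0) (Suc 0) 0 = 0"
    using eq[of "Suc 0" "Suc 0" "Suc 0" 4 2 "Suc 0" 2 0] by (simp add: eval)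
  have [simp]: "p (Suc 0) 2 3 = 0"
    using eq[of "Suc 0" "Suc 0" "Suc 0" 5 2 "Suc 0" 4 0] by (simp add: eval)
  have [simp]: "p 2 2 (Suc 0) = 0"
    using eq[of "Suc 0" 0 2 "Suc 0" 2 3 3 0] by (simp add: eval)
  have [simp]: "p 2 4 2 = 0"
    using eq[of "Suc 0" 3 2 0 2 2 2 0] by (simp add: eval)
  have [simp]: "p 4 4 4 = 0"
    using eq[of "Suc 0" 6 3 0 4 0 4 0] by (simp add: eval)
  have [simp]: "p (Suc 0) 2 2 = 0"
    using eq[of "Suc 0" "Suc 0" "Suc 0" 5 2 2 4 "Suc 0"] by (simp add: eval)
  have [simp]: "p 3 3 3 = 0"
    using eq[of "Suc 0" 0 "Suc 0" 3 3 3 3 0] by (simp add: eval)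
  have [simp]: "p 2 4 4 = 0"
    using eq[of 2 0 2 "Suc 0" 2 4 4 0] by (simp add: eval)
  have [simp]: "p 2 2 3 = 0"
    using eq[of "Suc 0" 0 2 2 2 4 4 0] by (simp add: eval)
  show ?thesis
    unfolding all_less_5 by (simp add: block_top_simps skew_coupling_simps[OF p])
qed

section \<open>Invariant derivations and coboundaries\<close>

lemma coupled_coord_cong: "p A B C = p' A B C \<Longrightarrow> coupled_coord p A i B j C k = coupled_coord p' A i B j C k"
  by (simp add: coupled_coord_def)

lemma coupled_comp_cong:
  assumes "\<And>A B C. A < 5 \<Longrightarrow> B < 5 \<Longrightarrow> C < 5 \<Longrightarrow> p A B C = p' A B C"
    and "\<And>A B C. A < 5 \<Longrightarrow> B < 5 \<Longrightarrow> C < 5 \<Longrightarrow> q A B C = q' A B C"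
    and "A < 5" "B < 5" "C < 5" "L < 5"
  shows "coupled_comp p q A i B j C k L l = coupled_comp p' q' A i B j C k L l"
  unfolding coupled_comp_def
  by (intro sum.cong refl arg_cong2[of _ _ _ _ "(*)"] coupled_coord_cong) (use assms in auto)

lemma invariant2_eq_0:
  assumes w: "invariant2 w"
    and 0: "\<And>A B C. A < 5 \<Longrightarrow> B < 5 \<Longrightarrow> C < 5 \<Longrightarrow> block_top C \<le> block_top A + block_top B \<Longrightarrow> coupling w A B C = 0"
  shows "w x y = 0"
proof -
  have alt: "L25_adjoint.alternating_map w"
    using w by (simp add: invariant2_def)
  have "w (block_vec A i) (block_vec B j) = 0" if "A < 5" "i \<le> block_top A" "B < 5" "j \<le> block_top B" for A i B j
  proof (rule block_coord_eqI)
    fix C k assume "C < 5" "k \<le> block_top C"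
    then show "block_coord C k (w (block_vec A i) (block_vec B j)) = block_coord C k 0"
      using that 0[of A B C] by (auto simp: invariant2_coord[OF w] block_coord_zero coupled_coord_def)
  qed
  then have "w (block_vec A i) y = 0" if "A < 5" "i \<le> block_top A" for A i
    using linear_block_eq_0[OF L25_adjoint.alternating_mapD(1)[OF alt]] that by blast
  then show ?thesis
    using linear_block_eq_0[OF L25_adjoint.alternating_mapD(2)[OF alt]] by simp
qed

text \<open>By \<open>invariant1_coord\<close> this is the scalar of the component of
  \<open>f\<close> from block \<open>A\<close> to block \<open>C\<close>. The tops agree only within
  the classes \<open>{0, 4}\<close>, \<open>{1, 3}\<close> and \<open>{2}\<close>, which leaves nine
  scalars.\<close>

definition multiplier :: "(complex ^ 25 \<Rightarrow> complex ^ 25) \<Rightarrow> nat \<Rightarrow> nat \<Rightarrow> complex" where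
  "multiplier f A C = (if block_top A = block_top C then block_coord C 0 (f (block_vec A 0)) else 0)"

lemma invariant1_block_vec:
  assumes f: "invariant1 f" and A: "A < 5" "i \<le> block_top A"
  shows "f (block_vec A i) = (\<Sum>D<5. multiplier f A D *s block_vec D i)"
proof (rule block_coord_eqI)
  fix C k assume C: "C < 5" "k \<le> block_top C"
  have "block_coord C k (multiplier f A D *s block_vec D i) = (if D = C then if k = i then multiplier f A C else 0 else 0)" if "D < 5" for D
    using that A C by (cases "i \<le> block_top D") (auto simp: block_coord_linear block_coord_vec multiplier_def)
  then show "block_coord C k (f (block_vec A i)) = block_coord C k (\<Sum>D<5. multiplier f A D *s block_vec D i)"
    using A C by (simp add: invariant1_coord[OF f] block_coord_sum multiplier_def)
qed

lemma invariant1_eq_0: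
  assumes f: "invariant1 f" and "\<And>A C. A < 5 \<Longrightarrow> C < 5 \<Longrightarrow> multiplier f A C = 0"
  shows "f x = 0"
proof (rule linear_block_eq_0[of f])
  show "L25_linear f"
    using f by (simp add: invariant1_def)
  show "f (block_vec A i) = 0" if "A < 5" "i \<le> block_top A" for A i
    using that assms(2) by (simp add: invariant1_block_vec[OF f])
qed

lemma invariant1_coord_top:
  assumes f: "invariant1 f" and C: "C < 5"
  shows "block_coord C 0 (f v) = (\<Sum>D<5. multiplier f D C * block_coord D 0 v)"
proof -
  have lin: "L25_linear f"
    using f by (simp add: invariant1_def)
  have "block_coord C 0 (f v) - (\<Sum>D<5. multiplier f D C * block_coord D 0 v) = 0"
  proof -
    let ?h = "\<lambda>v. block_coord C 0 (f v) - (\<Sum>D<5. multiplier f D C * block_coord D 0 v)"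
    \<comment> \<open>\<open>linear_block_eq_0\<close> concerns maps into the algebra, so the scalar
      map is multiplied by a fixed nonzero vector.\<close>
    let ?g = "\<lambda>v. ?h v *s block_vec 0 0"
    have "?h (v + v') = ?h v + ?h v'" for v v'
      by (simp add: L25_adjoint.linear_mapD[OF lin] block_coord_linear distrib_left sum.distrib)
    moreover have "?h (c *s v) = c * ?h v" for c v
      by (simp add: L25_adjoint.linear_mapD[OF lin] block_coord_linear right_diff_distrib sum_distrib_left mult.left_commute)
    ultimately have "L25_linear ?g"
      by (simp only: L25_adjoint.linear_map_iff vector_sadd_rdistrib vector_smult_assoc simp_thms)
    moreover have "?g (block_vec A i) = 0" if "A < 5" "i \<le> block_top A" for A i
    proof -
      have "(\<Sum>D<5. multiplier f D C * block_coord D 0 (block_vec A i)) = (\<Sum>D<5. if D = A then if i = 0 then multiplier f A C else 0 else 0)"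
        using that by (intro sum.cong) (auto simp: block_coord_vec)
      then show ?thesis
        using that C by (auto simp: invariant1_coord[OF f] multiplier_def)
    qed
    ultimately have "?g v = 0"
      by (rule linear_block_eq_0)
    moreover have "block_vec 0 0 \<noteq> 0"
      using block_coord_vec[of 0 0 0 0] by (auto simp: block_coord_zero)
    ultimately show ?thesis
      by simp
  qed
  then show ?thesis
    by simp
qed

lemma coupling_diff1:
  assumes f: "invariant1 f" and A: "A < 5" and B: "B < 5" and C: "C < 5" and n: "coupling_degree A B C \<le> block_top B"
  shows "coupling (L25_adjoint.diff1 f) A B C =
    (\<Sum>D<5. multiplier f B D * coupled_coord (coupling L25_bracket) A 0 D (coupling_degree A B C) C 0
       - multiplier f A D * coupled_coord (coupling L25_bracket) B (coupling_degree A B C) D 0 C 0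
       - multiplier f D C * coupled_coord (coupling L25_bracket) A 0 B (coupling_degree A B C) D 0)"
proof -
  let ?n = "coupling_degree A B C"
  have sum: "L25_bracket x (sum g S) = (\<Sum>y\<in>S. L25_bracket x (g y))" for x and g :: "'x \<Rightarrow> complex ^ 25" and S
    by (induction S rule: infinite_finite_induct) (auto simp: L25_bracket_add L25_adjoint.act_zero)
  note coord = invariant2_coord[OF invariant2_L25_bracket]
  have "(\<Sum>D<5. multiplier f B D * block_coord C 0 (L25_bracket (block_vec A 0) (block_vec D ?n))) =
      (\<Sum>D<5. multiplier f B D * coupled_coord (coupling L25_bracket) A 0 D ?n C 0)"
    using A C n by (intro sum.cong refl) (auto simp: coord multiplier_def)
  moreover have "(\<Sum>D<5. multiplier f A D * block_coord C 0 (L25_bracket (block_vec B ?n) (block_vec D 0))) =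
      (\<Sum>D<5. multiplier f A D * coupled_coord (coupling L25_bracket) B ?n D 0 C 0)"
    using B C n by (intro sum.cong refl) (simp add: coord)
  moreover have "(\<Sum>D<5. multiplier f D C * block_coord D 0 (L25_bracket (block_vec A 0) (block_vec B ?n))) =
      (\<Sum>D<5. multiplier f D C * coupled_coord (coupling L25_bracket) A 0 B ?n D 0)"
    using A B n by (intro sum.cong refl) (simp add: coord)
  ultimately show ?thesis
    using A B C n
    by (simp add: coupling_def L25_adjoint.diff1_def block_coord_linear invariant1_coord_top[OF f] invariant1_block_vec[OF f]
        sum L25_bracket_scale sum_subtractf)
qed

text \<open>The converse of \<open>multiplier\<close>: blocks of equal top are identified through
  their basis indices, and any prescribed scalars are realised by an invariant map.\<close>

definition block_map :: "(nat \<Rightarrow> nat \<Rightarrow> complex) \<Rightarrow> complex ^ 25 \<Rightarrow> complex ^ 25" where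
  "block_map r x = (\<Sum>A<5. \<Sum>C<5. \<Sum>i\<le>block_top A.
     (if block_top A = block_top C then r A C * block_coord A i x else 0) *s block_vec C i)"

lemma linear_block_map: "L25_linear (block_map r)"
proof -
  have "block_map r (x + y) = block_map r x + block_map r y" for x y
    unfolding block_map_def sum.distrib[symmetric]
    by (intro sum.cong refl) (auto simp: block_coord_linear algebra_simps vector_sadd_rdistrib)
  moreover have "block_map r (c *s x) = c *s block_map r x" for c x
    unfolding block_map_def vec.scale_sum_right
    by (intro sum.cong refl) (auto simp: block_coord_linear vector_smult_assoc)
  ultimately show ?thesis
    by (simp add: L25_adjoint.linear_map_iff)
qed

lemma block_map_block_vec:
  assumes "A < 5" "i \<le> block_top A"
  shows "block_map r (block_vec A i) = (\<Sum>C<5. (if block_top A = block_top C then r A C else 0) *s block_vec C i)"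
proof -
  have "(\<Sum>C<5. \<Sum>j\<le>block_top B. (if block_top B = block_top C then r B C * block_coord B j (block_vec A i) else 0) *s block_vec C j) =
     (if B = A then \<Sum>C<5. (if block_top A = block_top C then r A C else 0) *s block_vec C i else 0)" if "B < 5" for B
  proof (cases "B = A")
    case True
    have "(\<Sum>j\<le>block_top A. (if block_top A = block_top C then r A C * block_coord A j (block_vec A i) else 0) *s block_vec C j) =
       (\<Sum>j\<le>block_top A. if j = i then (if block_top A = block_top C then r A C else 0) *s block_vec C i else 0)" for C
      using assms by (intro sum.cong) (auto simp: block_coord_vec)
    then show ?thesis
      unfolding True using assms(2) by simp
  next
    case False
    then show ?thesis
      using assms that by (auto simp: block_coord_vec intro!: sum.neutral)
  qed
  then show ?thesis
    using assms by (simp add: block_map_def)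
qed

lemma invariant1_block_map: "invariant1 (block_map r)"
proof -
  note lin = L25_adjoint.linear_mapD[OF linear_block_map]
  have sum: "L25_bracket x (sum g S) = (\<Sum>y\<in>S. L25_bracket x (g y))" for x and g :: "'x \<Rightarrow> complex ^ 25" and S
    by (induction S rule: infinite_finite_induct) (auto simp: L25_bracket_add L25_adjoint.act_zero)
  have eq: "L25_bracket (L25_e a) (block_map r (block_vec A i)) = block_map r (L25_bracket (L25_e a) (block_vec A i))"
    if a: "a \<in> {1, 2, 3}" and A: "A < 5" "i \<le> block_top A" for a A i
  proof -
    let ?s = "\<lambda>C. if block_top A = block_top C then r A C else 0"
    \<comment> \<open>On all blocks of equal top a generator acts with the same shift and the same
      factor \<open>c\<close>, which is why the basis of block 0 was rescaled. For \<open>e2\<close>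
      at the end of a block the shift would leave the range, so this case is recorded as
      multiplication by zero.\<close>
    consider (1) c where "\<And>C. C < 5 \<Longrightarrow> block_top A = block_top C \<Longrightarrow> L25_bracket (L25_e a) (block_vec C i) = c *s block_vec C (i - 1)"
      | (2) c where "i < block_top A" "\<And>C. C < 5 \<Longrightarrow> block_top A = block_top C \<Longrightarrow> L25_bracket (L25_e a) (block_vec C i) = c *s block_vec C (i + 1)"
      | (3) c where "\<And>C. C < 5 \<Longrightarrow> block_top A = block_top C \<Longrightarrow> L25_bracket (L25_e a) (block_vec C i) = c *s block_vec C i"
    proof (cases "a = 1")
      case True
      then show ?thesis
        using A by (intro that(1)[of "of_nat i"]) (simp only: bracket_block_vec(1))
    next
      case False
      then consider "a = 2" "i < block_top A" | "a = 2" "i = block_top A" | "a = 3"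
        using a A by fastforce
      then show ?thesis
      proof cases
        case 1
        then show ?thesis
          using A by (intro that(2)[of "of_nat (block_top A - i)"]) (simp_all add: bracket_block_vec(2))
      next
        case 2
        then show ?thesis
          using A by (intro that(3)[of 0]) (simp add: bracket_block_vec(2))
      next
        case 3
        then show ?thesis
          using A by (intro that(3)[of "of_int (block_weight A i)"]) (simp add: bracket_block_vec(3) block_weight_def)
      qed
    qed
    then obtain j c where j: "j \<le> block_top A"
      "\<And>C. C < 5 \<Longrightarrow> block_top A = block_top C \<Longrightarrow> L25_bracket (L25_e a) (block_vec C i) = c *s block_vec C j"
    proof cases
      case (1 c)
      then show ?thesis using A by (intro that[of "i - 1" c]) auto
    next
      case (2 c)
      then show ?thesis by (intro that[of "i + 1" c]) auto
    next
      case (3 c)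
      then show ?thesis using A by (intro that[of i c]) auto
    qed
    have "L25_bracket (L25_e a) (block_map r (block_vec A i)) = (\<Sum>C<5. ?s C *s L25_bracket (L25_e a) (block_vec C i))"
      using A by (simp add: block_map_block_vec sum L25_bracket_scale)
    also have "\<dots> = (\<Sum>C<5. c *s (?s C *s block_vec C j))"
      using j(2) by (intro sum.cong) (auto simp: vector_smult_assoc mult.commute)
    also have "\<dots> = block_map r (L25_bracket (L25_e a) (block_vec A i))"
      using j A by (simp add: lin block_map_block_vec vec.scale_sum_right)
    finally show ?thesis .
  qed
  have "L25_bracket (L25_e a) (block_map r x) = block_map r (L25_bracket (L25_e a) x)" if "a \<in> {1, 2, 3}" for a x
  proof -
    have "L25_linear (L25_adjoint.lie1 (L25_e a) (block_map r))"
      by (rule L25_adjoint.linear_lie1[OF linear_block_map])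
    then have "L25_adjoint.lie1 (L25_e a) (block_map r) x = 0"
      by (rule linear_block_eq_0) (use eq[OF that] in \<open>simp add: L25_adjoint.lie1_def\<close>)
    then show ?thesis
      by (simp add: L25_adjoint.lie1_def)
  qed
  then show ?thesis
    by (simp add: invariant1_def linear_block_map)
qed

lemma multiplier_block_map: "A < 5 \<Longrightarrow> C < 5 \<Longrightarrow> block_top A = block_top C \<Longrightarrow> multiplier (block_map r) A C = r A C"
proof -
  assume A: "A < 5" and C: "C < 5" "block_top A = block_top C"
  have "block_coord C 0 (block_map r (block_vec A 0)) =
      (\<Sum>D<5. (if block_top A = block_top D then r A D else 0) * (if C = D then 1 else 0))"
    using A C(1) by (simp add: block_map_block_vec block_coord_linear block_coord_vec)
  also have "\<dots> = (\<Sum>D<5. if D = C then r A C else 0)"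
    using C by (intro sum.cong) auto
  finally have "block_coord C 0 (block_map r (block_vec A 0)) = r A C"
    using C(1) by simp
  then show ?thesis
    using C by (simp add: multiplier_def)
qed

section \<open>Invariant 2-cochains: coboundaries, linear combinations, cocycles\<close>

lemma invariant2_iff_lie2:
  "invariant2 w \<longleftrightarrow> L25_adjoint.alternating_map w \<and> (\<forall>a\<in>{1, 2, 3}. \<forall>x y. L25_adjoint.lie2 (L25_e a) w x y = 0)"
  unfolding invariant2_def L25_adjoint.lie2_def diff_diff_add right_minus_eq ..

lemma invariant2_diff1:
  assumes f: "invariant1 f"
  shows "invariant2 (L25_adjoint.diff1 f)"
proof -
  have lin: "L25_linear f"
    using f by (simp add: invariant1_def)
  have "L25_adjoint.lie2 (L25_e a) (L25_adjoint.diff1 f) x y = 0" if "a \<in> {1, 2, 3}" for a x y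
  proof -
    have "L25_adjoint.lie1 (L25_e a) f = (\<lambda>_. 0)"
      using f that by (auto simp: invariant1_def L25_adjoint.lie1_def)
    then show ?thesis
      by (simp add: L25_adjoint.lie2_diff1[OF lin]) (simp add: L25_adjoint.diff1_def L25_adjoint.act_zero)
  qed
  then show ?thesis
    unfolding invariant2_iff_lie2 using L25_adjoint.alternating_diff1[OF lin] by blast
qed

lemma invariant2_lincomb:
  assumes v: "invariant2 v" and w: "invariant2 w"
  shows "invariant2 (\<lambda>x y. v x y + c *s w x y)"
proof -
  have "L25_adjoint.alternating_map (\<lambda>x y. v x y + c *s w x y)"
    using v w unfolding invariant2_def L25_adjoint.alternating_map_def
    by (auto intro!: L25_adjoint.linear_addI L25_adjoint.linear_scaleI)
  then show ?thesis
    using v w by (auto simp: invariant2_def L25_bracket_add L25_bracket_scale vector_add_ldistrib)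
qed

lemma coupling_lincomb: "coupling (\<lambda>x y. v x y + c *s w x y) A B C = coupling v A B C + c * coupling w A B C"
  by (simp add: coupling_def block_coord_linear)

lemma diff2_lincomb: "L25_adjoint.diff2 (\<lambda>x y. v x y + c *s w x y) x y z = L25_adjoint.diff2 v x y z + c *s L25_adjoint.diff2 w x y z"
  by (simp add: L25_adjoint.diff2_def L25_bracket_add L25_bracket_scale vector_add_ldistrib vector_ssub_ldistrib)

text \<open>By Cartan's formula the Lie derivative of a cocycle along \<open>e_a\<close> is the
  coboundary of \<open>w (L25_e a)\<close>, which is zero here. Invariance of
  \<open>L25_omega\<close> thus follows from its being a cocycle that vanishes on block 0.\<close>

lemma invariant2_cocycleI:
  assumes "L25_adjoint.alternating_map w" "\<And>x y z. L25_adjoint.diff2 w x y z = 0" "\<And>a x. a \<in> {1, 2, 3} \<Longrightarrow> w (L25_e a) x = 0"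
  shows "invariant2 w"
proof -
  have "L25_adjoint.lie2 (L25_e a) w x y = 0" if "a \<in> {1, 2, 3}" for a x y
    using that assms by (simp add: L25_adjoint.cartan_lie2 L25_adjoint.diff1_def L25_adjoint.act_zero)
  then show ?thesis
    unfolding invariant2_iff_lie2 using assms(1) by blast
qed

section \<open>Cohomology of $L_{25}$\<close>

lemma skew_coupling_coupling: "invariant2 w \<Longrightarrow> skew_coupling (coupling w)"
  unfolding skew_coupling_def by (simp add: coupling_commute)

lemma coupled_diff2_cocycle:
  assumes w: "invariant2 w" and "\<And>x y z. L25_adjoint.diff2 w x y z = 0"
    and A: "A < 5" "i \<le> block_top A" and B: "B < 5" "j \<le> block_top B"
    and C: "C < 5" "k \<le> block_top C" and L: "L < 5" "l \<le> block_top L"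
  shows "coupled_diff2 (coupling w) bracket_coupling A i B j C k L l = 0"
proof -
  have "coupled_diff2 (coupling w) (coupling L25_bracket) A i B j C k L l = 0"
    using invariant2_diff2[OF w A B C L] assms(2) by (simp add: block_coord_zero)
  moreover have "coupled_diff2 (coupling w) (coupling L25_bracket) A i B j C k L l =
      coupled_diff2 (coupling w) bracket_coupling A i B j C k L l"
    unfolding coupled_diff2_def using A B C L
    by (intro arg_cong2[of _ _ _ _ "(+)"] arg_cong2[of _ _ _ _ "(-)"] coupled_comp_cong) (simp_all add: coupling_bracket)
  ultimately show ?thesis
    by simp
qed

text \<open>The first nine of the listed couplings determine the scalars of an invariant coboundary,
  as \<open>coupling_diff1_values\<close> shows; the last one, at \<open>(2, 3, 4)\<close>, detects
  \<open>L25_omega\<close>.\<close>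

lemma invariant2_cocycle_eq_0:
  assumes w: "invariant2 w" and "\<And>x y z. L25_adjoint.diff2 w x y z = 0"
    and "coupling w 0 0 4 = 0" "coupling w 0 4 4 = 0" "coupling w 1 1 3 = 0" "coupling w 1 1 4 = 0"
      "coupling w 1 2 4 = 0" "coupling w 1 3 4 = 0" "coupling w 2 2 4 = 0" "coupling w 3 4 3 = 0"
      "coupling w 1 3 3 = 0" "coupling w 2 3 4 = 0"
  shows "w x y = 0"
proof (rule invariant2_eq_0[OF w])
  have "\<forall>A<5. \<forall>B<5. \<forall>C<5. block_top C \<le> block_top A + block_top B \<longrightarrow> coupling w A B C = 0"
    by (rule coupling_rigid[OF skew_coupling_coupling[OF w] coupled_diff2_cocycle[OF w assms(2)]]) (use assms in simp_all)
  then show "coupling w A B C = 0" if "A < 5" "B < 5" "C < 5" "block_top C \<le> block_top A + block_top B" for A B C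
    using that by blast
qed

text \<open>Diagonal scalars multiply a coupling of the bracket at \<open>(A, B, C)\<close> by
  \<open>r A A + r B B - r C C\<close>. Off-diagonal scalars transport a coupling of the bracket
  from another triple: \<open>- 4\<close> at \<open>(2, 3, 4)\<close> comes from the bracket at
  \<open>(2, 1, 4)\<close>.\<close>

lemma coupling_diff1_values:
  assumes f: "invariant1 f"
  defines "r \<equiv> multiplier f"
  shows "coupling (L25_adjoint.diff1 f) 0 0 4 = r 0 4"
    and "coupling (L25_adjoint.diff1 f) 0 4 4 = r 0 0"
    and "coupling (L25_adjoint.diff1 f) 1 1 3 = 6 * r 1 1 - 3 * r 3 3"
    and "coupling (L25_adjoint.diff1 f) 1 1 4 = 30 * r 1 3"
    and "coupling (L25_adjoint.diff1 f) 1 2 4 = 60 * (r 1 1 + r 2 2 - r 4 4)"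
    and "coupling (L25_adjoint.diff1 f) 1 3 4 = 15 * (r 1 1 + r 3 3 - r 4 4)"
    and "coupling (L25_adjoint.diff1 f) 2 2 4 = 4 * r 2 2 - 2 * r 4 4"
    and "coupling (L25_adjoint.diff1 f) 3 4 3 = 3 * r 4 0"
    and "coupling (L25_adjoint.diff1 f) 1 3 3 = 3 * r 3 1"
    and "coupling (L25_adjoint.diff1 f) 2 3 4 = - 4 * r 3 1"
proof -
  have 0: "multiplier f A C = 0" if "block_top A \<noteq> block_top C" for A C
    using that by (simp add: multiplier_def)
  note eval = coupling_diff1[OF f] sum_less_5 coupled_coord_def coupling_degree_def block_top_simps transvectant_numeral
    binomial_numeral coupling_bracket bracket_coupling_def 0 r_def
  show "coupling (L25_adjoint.diff1 f) 0 0 4 = r 0 4" by (simp add: eval)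
  show "coupling (L25_adjoint.diff1 f) 0 4 4 = r 0 0" by (simp add: eval)
  show "coupling (L25_adjoint.diff1 f) 1 1 3 = 6 * r 1 1 - 3 * r 3 3" by (simp add: eval)
  show "coupling (L25_adjoint.diff1 f) 1 1 4 = 30 * r 1 3" by (simp add: eval)
  show "coupling (L25_adjoint.diff1 f) 1 2 4 = 60 * (r 1 1 + r 2 2 - r 4 4)" by (simp add: eval)
  show "coupling (L25_adjoint.diff1 f) 1 3 4 = 15 * (r 1 1 + r 3 3 - r 4 4)" by (simp add: eval)
  show "coupling (L25_adjoint.diff1 f) 2 2 4 = 4 * r 2 2 - 2 * r 4 4" by (simp add: eval)
  show "coupling (L25_adjoint.diff1 f) 3 4 3 = 3 * r 4 0" by (simp add: eval)
  show "coupling (L25_adjoint.diff1 f) 1 3 3 = 3 * r 3 1" by (simp add: eval)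
  show "coupling (L25_adjoint.diff1 f) 2 3 4 = - 4 * r 3 1" by (simp add: eval)
qed

lemma invariant2_L25_omega: "invariant2 L25_omega"
proof (rule invariant2_cocycleI[OF alternating_L25_omega diff2_L25_omega])
  fix a x assume a: "a \<in> {1 :: nat, 2, 3}"
  have range: "list_all (\<lambda>(i, j, c, k). i \<in> {4..25} \<and> j \<in> {4..25}) L25_omega_table"
    by (simp add: L25_omega_table_def)
  have sum_list_0: "sum_list (map g ts) = 0" if "\<And>t. t \<in> set ts \<Longrightarrow> g t = 0" for g :: "'t \<Rightarrow> complex ^ 25" and ts
    using that by (induction ts) auto
  show "L25_omega (L25_e a) x = 0"
    unfolding L25_omega_def
  proof (rule sum_list_0, clarify)
    fix i j c k assume "(i, j, c, k) \<in> set L25_omega_table"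
    then have "i \<in> {1..25}" "j \<in> {1..25}" "a \<in> {1..25}" "a \<noteq> i" "a \<noteq> j"
      using range a by (auto simp: list_all_iff)
    then show "(of_int c * (L25_e a $ of_nat i * x $ of_nat j - L25_e a $ of_nat j * x $ of_nat i)) *s L25_e k = 0"
      by (simp add: L25_e_nth)
  qed
qed

lemma coupling_L25_omega:
  "coupling L25_omega 0 0 4 = 0" "coupling L25_omega 0 4 4 = 0" "coupling L25_omega 1 1 3 = 0"
  "coupling L25_omega 1 1 4 = 0" "coupling L25_omega 1 2 4 = 0" "coupling L25_omega 1 3 4 = 0"
  "coupling L25_omega 2 2 4 = 0" "coupling L25_omega 3 4 3 = 0" "coupling L25_omega 1 3 3 = 0"
  "coupling L25_omega 2 3 4 = - 40"
  by (simp_all add: coupling_def coupling_degree_def block_top_simps block_vec_def block_coord_def L25_e_def axis_def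
      L25_omega_nth_simps)

lemma invariant2_cocycle_decomp:
  assumes w: "invariant2 w" and cocycle: "\<And>x y z. L25_adjoint.diff2 w x y z = 0"
  shows "\<exists>f c. invariant1 f \<and> (\<forall>x y. w x y = L25_adjoint.diff1 f x y + c *s L25_omega x y)"
proof -
  define p where "p = coupling w"
  \<comment> \<open>These values and the diagonal entries of \<open>r\<close> at blocks 3 and 4
    solve the four equations of \<open>coupling_diff1_values\<close> at \<open>(1, 1, 3)\<close>,
    \<open>(1, 2, 4)\<close>, \<open>(1, 3, 4)\<close> and \<open>(2, 2, 4)\<close>. Each of the
    other five scalars is fixed by a single coupling.\<close>
  define r11 where "r11 = p 1 3 4 / 15 + p 1 1 3 / 3 + p 2 2 4 / 2 - p 1 2 4 / 30"
  define r22 where "r22 = r11 - p 1 2 4 / 60 + p 2 2 4 / 2"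
  define r :: "nat \<Rightarrow> nat \<Rightarrow> complex" where "r = (\<lambda>A C.
    if A = 0 then if C = 0 then p 0 4 4 else p 0 0 4
    else if A = 1 then if C = 1 then r11 else p 1 1 4 / 30
    else if A = 2 then r22
    else if A = 3 then if C = 1 then p 1 3 3 / 3 else 2 * r11 - p 1 1 3 / 3
    else if C = 0 then p 3 4 3 / 3 else 2 * r22 - p 2 2 4 / 2)"
  define f where "f = block_map r"
  \<comment> \<open>At \<open>(2, 3, 4)\<close> the coboundary contributes
    \<open>- 4 * r 3 1\<close> and \<open>L25_omega\<close> contributes \<open>- 40\<close>; this
    choice makes the last of the ten couplings of \<open>v\<close> vanish.\<close>
  define c where "c = - (p 2 3 4 + 4 * r 3 1) / 40"
  define v where "v = (\<lambda>x y. (w x y + (- 1) *s L25_adjoint.diff1 f x y) + (- c) *s L25_omega x y)"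
  have f: "invariant1 f"
    unfolding f_def by (rule invariant1_block_map)
  then have lin: "L25_linear f"
    by (simp add: invariant1_def)
  have mult: "multiplier f A C = r A C" if "A < 5" "C < 5" "block_top A = block_top C" for A C
    using that unfolding f_def by (rule multiplier_block_map)
  note mults = mult[of 0 0] mult[of 0 4] mult[of 4 0] mult[of 4 4] mult[of 1 1] mult[of 1 3] mult[of 3 1] mult[of 3 3] mult[of 2 2]
  have coupling_v: "coupling v A B C = p A B C - coupling (L25_adjoint.diff1 f) A B C - c * coupling L25_omega A B C" for A B C
    unfolding v_def coupling_lincomb p_def by simp
  note params = coupling_v coupling_diff1_values[OF f, simplified] coupling_L25_omega[simplified] mults[simplified]
    block_top_simps r_def c_def r11_def r22_def
  have "v x y = 0" for x y
  proof (rule invariant2_cocycle_eq_0[of v])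
    show "invariant2 v"
      unfolding v_def by (intro invariant2_lincomb w invariant2_diff1 f invariant2_L25_omega)
    show "L25_adjoint.diff2 v x y z = 0" for x y z
      unfolding v_def diff2_lincomb by (simp add: cocycle L25_adjoint.diff2_diff1[OF lin] diff2_L25_omega)
  qed (simp_all add: params, simp_all add: field_simps)
  then have "w x y = L25_adjoint.diff1 f x y + c *s L25_omega x y" for x y
    unfolding v_def by (simp add: algebra_simps add_eq_0_iff)
  then show ?thesis
    using f by blast
qed

text \<open>For a cocycle \<open>v\<close>, Cartan's formula gives
  \<open>lie2 a v = diff1 (v a)\<close>. Hence every correction made by
  \<open>exists_invariant\<close> is a coboundary, and the predicate \<open>P\<close>, being a
  cocycle cohomologous to \<open>w\<close>, is preserved.\<close>

lemma exists_invariant_cohomologous2: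
  assumes w: "L25_adjoint.alternating_map w" "\<And>x y z. L25_adjoint.diff2 w x y z = 0"
  shows "\<exists>v g. invariant2 v \<and> (\<forall>x y z. L25_adjoint.diff2 v x y z = 0) \<and> L25_linear g \<and> (\<forall>x y. w x y = v x y + L25_adjoint.diff1 g x y)"
proof -
  define P where "P v \<longleftrightarrow> (\<forall>x y z. L25_adjoint.diff2 v x y z = 0) \<and> (\<exists>g. L25_linear g \<and> (\<forall>x y. w x y = v x y + L25_adjoint.diff1 g x y))" for v
  have P_diff: "P (v - (\<lambda>x y. c *s L25_adjoint.diff1 h x y))" if "P v" "L25_linear h" for v h c
  proof -
    have eq: "v - (\<lambda>x y. c *s L25_adjoint.diff1 h x y) = (\<lambda>x y. v x y + (- c) *s L25_adjoint.diff1 h x y)"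
      by (simp add: fun_eq_iff)
    from that(1) obtain g where g: "L25_linear g" "\<forall>x y. w x y = v x y + L25_adjoint.diff1 g x y"
      unfolding P_def by blast
    have "L25_linear (\<lambda>x. g x + c *s h x)"
      by (intro L25_adjoint.linear_addI L25_adjoint.linear_scaleI g that)
    moreover have "w x y = v x y + (- c) *s L25_adjoint.diff1 h x y + L25_adjoint.diff1 (\<lambda>x. g x + c *s h x) x y" for x y
      by (simp add: g(2) L25_adjoint.diff1_def L25_bracket_add L25_bracket_scale vector_ssub_ldistrib)
    ultimately show ?thesis
      using that(1) unfolding P_def eq diff2_lincomb by (auto simp: L25_adjoint.diff2_diff1[OF that(2)])
  qed
  have lie2_eq: "L25_adjoint.lie2 a v = L25_adjoint.diff1 (v a)" if "L25_adjoint.alternating_map v" "\<And>x y z. L25_adjoint.diff2 v x y z = 0" for a v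
    by (intro ext) (simp add: L25_adjoint.cartan_lie2[OF that(1)] that(2))
  have "\<exists>v\<in>{v. L25_adjoint.alternating_map v}. P v \<and> L25_adjoint.lie2 (L25_e 1) v = 0 \<and> L25_adjoint.lie2 (L25_e 2) v = 0 \<and> L25_adjoint.lie2 (L25_e 3) v = 0"
  proof (rule sl2_weight_module.exists_invariant[OF sl2_weight_module_lie2])
    show "w \<in> {v. L25_adjoint.alternating_map v}" "P w"
      using w by (auto simp: P_def L25_adjoint.diff1_def L25_adjoint.act_zero intro!: exI[of _ "\<lambda>_. 0"] L25_adjoint.linear_zeroI)
    fix c v assume v: "v \<in> {v. L25_adjoint.alternating_map v}" "P v"
    then have alt: "L25_adjoint.alternating_map v" and cocycle: "\<And>x y z. L25_adjoint.diff2 v x y z = 0"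
      by (auto simp: P_def)
    note lin = L25_adjoint.alternating_mapD(1)[OF alt]
    show "P (v - (\<lambda>x y. c *s L25_adjoint.lie2 (L25_e 3) v x y))"
      unfolding lie2_eq[OF alt cocycle] by (rule P_diff[OF v(2) lin])
    show "P (v - (\<lambda>x y. c *s L25_adjoint.lie2 (L25_e 2) (L25_adjoint.lie2 (L25_e 1) v) x y))"
      unfolding lie2_eq[OF alt cocycle]
      \<comment> \<open>The inner Lie derivative is already a coboundary, hence a cocycle, so that
        Cartan's formula applies a second time.\<close>
      unfolding lie2_eq[OF L25_adjoint.alternating_diff1[OF lin] L25_adjoint.diff2_diff1[OF lin]]
      by (rule P_diff[OF v(2) L25_adjoint.alternating_mapD(1)[OF L25_adjoint.alternating_diff1[OF lin]]])
  qed
  then obtain v where v: "L25_adjoint.alternating_map v" "P v" "\<forall>a\<in>{1, 2, 3}. L25_adjoint.lie2 (L25_e a) v = 0"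
    by auto
  then have "invariant2 v"
    unfolding invariant2_iff_lie2 by simp
  then show ?thesis
    using v(2) unfolding P_def by blast
qed

lemma exists_invariant_cohomologous1:
  assumes f: "L25_linear f" "\<And>x y. L25_adjoint.diff1 f x y = 0"
  shows "\<exists>g m. invariant1 g \<and> (\<forall>x y. L25_adjoint.diff1 g x y = 0) \<and> (\<forall>x. f x = g x + L25_bracket x m)"
proof -
  define P where "P g \<longleftrightarrow> (\<forall>x y. L25_adjoint.diff1 g x y = 0) \<and> (\<exists>m. \<forall>x. f x = g x + L25_bracket x m)" for g
  have P_diff: "P (g - (\<lambda>x. c *s L25_bracket x u))" if "P g" for g u c
  proof -
    from that obtain m where m: "\<forall>x. f x = g x + L25_bracket x m"
      unfolding P_def by blast
    have "f x = (g - (\<lambda>x. c *s L25_bracket x u)) x + L25_bracket x (m + c *s u)" for x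
      by (simp add: m L25_bracket_add L25_bracket_scale)
    moreover have "L25_adjoint.diff1 (g - (\<lambda>x. c *s L25_bracket x u)) x y = L25_adjoint.diff1 g x y" for x y
      by (simp add: L25_adjoint.diff1_def L25_adjoint.act_diff L25_bracket_scale L25_adjoint.act_bracket vector_ssub_ldistrib)
    ultimately show ?thesis
      using that unfolding P_def by auto
  qed
  have lie1_eq: "L25_adjoint.lie1 a g = (\<lambda>x. L25_bracket x (g a))" if "P g" for a g
    using that by (auto simp: L25_adjoint.cartan_lie1 P_def)
  have "\<exists>g\<in>{g. L25_linear g}. P g \<and> L25_adjoint.lie1 (L25_e 1) g = 0 \<and> L25_adjoint.lie1 (L25_e 2) g = 0 \<and> L25_adjoint.lie1 (L25_e 3) g = 0"
  proof (rule sl2_weight_module.exists_invariant[OF sl2_weight_module_lie1])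
    show "f \<in> {g. L25_linear g}" "P f"
      using f by (auto simp: P_def L25_adjoint.act_zero intro!: exI[of _ 0])
    fix c g assume g: "g \<in> {g. L25_linear g}" "P g"
    show "P (g - (\<lambda>x. c *s L25_adjoint.lie1 (L25_e 3) g x))"
      unfolding lie1_eq[OF g(2)] by (rule P_diff[OF g(2)])
    \<comment> \<open>The Lie derivative of the inner derivation given by \<open>m\<close> is the
      inner derivation given by \<open>[e2, m]\<close>, so this correction is inner too.\<close>
    have "L25_adjoint.lie1 (L25_e 2) (\<lambda>x. L25_bracket x (g (L25_e 1))) = (\<lambda>x. L25_bracket x (L25_bracket (L25_e 2) (g (L25_e 1))))"
      by (rule ext) (simp add: L25_adjoint.lie1_def L25_adjoint.act_bracket)
    then show "P (g - (\<lambda>x. c *s L25_adjoint.lie1 (L25_e 2) (L25_adjoint.lie1 (L25_e 1) g) x))"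
      unfolding lie1_eq[OF g(2)] by (simp only: P_diff[OF g(2)])
  qed
  then obtain g where g: "L25_linear g" "P g" "\<forall>a\<in>{1, 2, 3}. L25_adjoint.lie1 (L25_e a) g = 0"
    by auto
  then have "L25_bracket (L25_e a) (g x) = g (L25_bracket (L25_e a) x)" if "a \<in> {1, 2, 3}" for a x
  proof -
    have "L25_adjoint.lie1 (L25_e a) g x = 0"
      using g(3) that by auto
    then show ?thesis
      by (simp add: L25_adjoint.lie1_def)
  qed
  then have "invariant1 g"
    using g(1) by (auto simp: invariant1_def)
  then show ?thesis
    using g(2) unfolding P_def by blast
qed

text \<open>Suppose that block 1 is scaled by \<open>t\<close>. The brackets into blocks 3 and 4
  then force \<open>2 t\<close> on block 3, \<open>3 t\<close> on block 4 and \<open>2 t\<close> on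
  block 2, whereas the bracket of block 2 with itself forces \<open>4 t\<close> on block 4; hence
  \<open>t = 0\<close>. The remaining scalars are isolated by single equations.\<close>

lemma invariant1_derivation_eq_0:
  assumes f: "invariant1 f" and cocycle: "\<And>x y. L25_adjoint.diff1 f x y = 0"
  shows "f x = 0"
proof (rule invariant1_eq_0[OF f])
  let ?r = "multiplier f"
  have c: "coupling (L25_adjoint.diff1 f) A B C = 0" for A B C
    by (simp add: coupling_def cocycle block_coord_zero)
  note r = coupling_diff1_values[OF f, unfolded c]
  have "?r 3 3 = 2 * ?r 1 1" "?r 4 4 = 2 * ?r 2 2" "?r 4 4 = ?r 1 1 + ?r 2 2" "?r 4 4 = ?r 1 1 + ?r 3 3"
    using r(3,5,6,7) by (simp_all add: algebra_simps)
  then have "?r 1 1 = 0" "?r 2 2 = 0" "?r 3 3 = 0" "?r 4 4 = 0"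
    by (Groebner_Basis.algebra+)
  then have "\<forall>A<5. \<forall>C<5. ?r A C = 0"
    unfolding all_less_5 using r by (simp add: multiplier_def block_top_def)
  then show "?r A C = 0" if "A < 5" "C < 5" for A C
    using that by blast
qed

text \<open>No block is the trivial module, so nothing is invariant even under block 0:
  \<open>E\<close> leaves only the coordinates at \<open>f_0\<close>, and there \<open>H\<close>
  acts by a positive weight.\<close>

lemma L25_center:
  assumes "\<And>x. L25_bracket x z = 0"
  shows "z = 0"
proof (rule block_coord_eqI)
  fix A k assume A: "A < 5" "k \<le> block_top A"
  have "block_top A > 0"
    using A(1) by (auto simp: block_top_def less_Suc_eq numeral_eq_Suc)
  show "block_coord A k z = block_coord A k 0"
  proof (cases k)
    case 0
    then show ?thesis
      using block_coord_bracket(3)[OF A, of z] \<open>block_top A > 0\<close> by (simp add: assms block_coord_zero)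
  next
    case (Suc l)
    then show ?thesis
      using block_coord_bracket(1)[of A l z] A by (simp add: assms block_coord_zero del: of_nat_Suc)
  qed
qed

text \<open>Since no block is trivial, \<open>f_0\<close> is a multiple of \<open>[e3, f_0]\<close>
  and every later basis vector is a multiple of some \<open>[e2, f_j]\<close>. Thus brackets span
  the algebra.\<close>

lemma L25_perfect:
  assumes f: "Vector_Spaces.linear (*s) (*) (f :: complex ^ 25 \<Rightarrow> complex)" and bracket: "\<And>x y. f (L25_bracket x y) = 0"
  shows "f x = 0"
proof -
  note lin = L25_trivial.linear_mapD[OF f]
  have "L25_linear (\<lambda>x. f x *s L25_e 1)"
    by (auto simp: L25_adjoint.linear_map_iff lin vector_sadd_rdistrib vector_smult_assoc)
  moreover have "f (block_vec A i) = 0" if A: "A < 5" "i \<le> block_top A" for A i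
  proof (cases i)
    case 0
    have "block_top A > 0"
      using A(1) by (auto simp: block_top_def less_Suc_eq numeral_eq_Suc)
    then show ?thesis
      using bracket[of "L25_e 3" "block_vec A 0"] bracket_block_vec(3)[of A 0] A \<open>i = 0\<close> by (simp add: lin block_weight_def)
  next
    case (Suc j)
    then show ?thesis
      using bracket[of "L25_e 2" "block_vec A j"] bracket_block_vec(2)[of A j] A by (simp add: lin of_nat_diff del: of_nat_diff)
  qed
  ultimately have "f x *s L25_e 1 = 0"
    using linear_block_eq_0[of "\<lambda>x. f x *s L25_e 1"] by simp
  moreover have "L25_e 1 \<noteq> 0"
    by (simp add: L25_e_def axis_eq_0_iff)
  ultimately show ?thesis
    by simp
qed

theorem theorem4p3:
  shows "carrier (L25_trivial.cohomology 1) = {\<zero>\<^bsub>L25_trivial.cohomology 1\<^esub>} \<and>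
    carrier (L25_adjoint.cohomology 0) = {\<zero>\<^bsub>L25_adjoint.cohomology 0\<^esub>} \<and>
    carrier (L25_adjoint.cohomology 1) = {\<zero>\<^bsub>L25_adjoint.cohomology 1\<^esub>} \<and>
    vectorspace.fin_dim class_ring (L25_adjoint.cohomology 2) \<and>
    vectorspace.dim class_ring (L25_adjoint.cohomology 2) = 1"
proof (intro conjI)
  show "carrier (L25_trivial.cohomology 1) = {\<zero>\<^bsub>L25_trivial.cohomology 1\<^esub>}"
  proof (rule L25_trivial.cohomology_eq_0I[OF L25_trivial.coboundaries_1_subset])
    show "L25_trivial.cocycles 1 \<subseteq> L25_trivial.coboundaries 1"
      unfolding L25_trivial.cocycles_1 L25_trivial.coboundaries_1
    proof (intro image_mono subsetI)
      fix f assume "f \<in> {f. L25_trivial.linear_map f \<and> (\<forall>x y. L25_trivial.diff1 f x y = 0)}"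
      then have "f = (\<lambda>_. 0)"
        using L25_perfect[of f] by (auto simp: L25_trivial.diff1_def)
      then show "f \<in> range (\<lambda>m x. 0)"
        by simp
    qed
  qed
  show "carrier (L25_adjoint.cohomology 0) = {\<zero>\<^bsub>L25_adjoint.cohomology 0\<^esub>}"
  proof (rule L25_adjoint.cohomology_eq_0I)
    show "L25_adjoint.coboundaries 0 \<subseteq> L25_adjoint.cocycles 0"
      using L25_adjoint.cocycles_zero by (simp add: L25_adjoint.coboundaries_def)
    show "L25_adjoint.cocycles 0 \<subseteq> L25_adjoint.coboundaries 0"
    proof
      fix \<phi> assume "\<phi> \<in> L25_adjoint.cocycles 0"
      then have \<phi>: "\<And>xs. xs \<noteq> [] \<Longrightarrow> \<phi> xs = 0" and d: "\<And>xs. L25_adjoint.coboundary 0 \<phi> xs = 0"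
        by (auto simp: L25_adjoint.cocycles_def L25_adjoint.cochains_0)
      have "L25_bracket x (\<phi> []) = 0" for x
        using d[of "[x]"] by (simp add: L25_adjoint.coboundary_0 L25_adjoint.cochain1_eq)
      then have "\<phi> [] = 0"
        by (rule L25_center)
      then have "\<phi> = (\<lambda>_. 0)"
        using \<phi> by metis
      then show "\<phi> \<in> L25_adjoint.coboundaries 0"
        by (simp add: L25_adjoint.coboundaries_def)
    qed
  qed
  show "carrier (L25_adjoint.cohomology 1) = {\<zero>\<^bsub>L25_adjoint.cohomology 1\<^esub>}"
  proof (rule L25_adjoint.cohomology_eq_0I[OF L25_adjoint.coboundaries_1_subset])
    show "L25_adjoint.cocycles 1 \<subseteq> L25_adjoint.coboundaries 1"
      unfolding L25_adjoint.cocycles_1 L25_adjoint.coboundaries_1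
    proof (intro image_mono subsetI)
      fix f assume "f \<in> {f. L25_linear f \<and> (\<forall>x y. L25_adjoint.diff1 f x y = 0)}"
      then obtain g m where g: "invariant1 g" "\<And>x y. L25_adjoint.diff1 g x y = 0" "\<And>x. f x = g x + L25_bracket x m"
        using exists_invariant_cohomologous1[of f] by blast
      then have "f = (\<lambda>x. L25_bracket x m)"
        using invariant1_derivation_eq_0[OF g(1,2)] by auto
      then show "f \<in> range (\<lambda>m x. L25_bracket x m)"
        by blast
    qed
  qed
  have "vectorspace.fin_dim class_ring (L25_adjoint.cohomology 2) \<and> vectorspace.dim class_ring (L25_adjoint.cohomology 2) = 1"
  proof (rule L25_adjoint.dim_cohomology_eq_1I[OF L25_adjoint.coboundaries_2_subset])
    show "L25_adjoint.cochain2 L25_omega \<in> L25_adjoint.cocycles 2"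
      unfolding L25_adjoint.cocycles_2 using alternating_L25_omega diff2_L25_omega by blast
    show "L25_adjoint.cochain2 L25_omega \<notin> L25_adjoint.coboundaries 2"
    proof
      assume "L25_adjoint.cochain2 L25_omega \<in> L25_adjoint.coboundaries 2"
      then obtain f where f: "L25_linear f" "L25_adjoint.cochain2 L25_omega = L25_adjoint.cochain2 (L25_adjoint.diff1 f)"
        unfolding L25_adjoint.coboundaries_2 by blast
      have "L25_adjoint.diff1 f x y = L25_omega x y" for x y
        using fun_cong[OF f(2), of "[x, y]"] by (simp add: L25_adjoint.cochain2_eq)
      then show False
        using L25_omega_not_coboundary[OF f(1)] by blast
    qed
    fix \<phi> assume "\<phi> \<in> L25_adjoint.cocycles 2"
    then obtain w where w: "L25_adjoint.alternating_map w" "\<And>x y z. L25_adjoint.diff2 w x y z = 0" "\<phi> = L25_adjoint.cochain2 w"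
      unfolding L25_adjoint.cocycles_2 by blast
    obtain v g where v: "invariant2 v" "\<And>x y z. L25_adjoint.diff2 v x y z = 0"
      and g: "L25_linear g" "\<And>x y. w x y = v x y + L25_adjoint.diff1 g x y"
      using exists_invariant_cohomologous2[OF w(1,2)] by blast
    obtain f c where f: "invariant1 f" "\<And>x y. v x y = L25_adjoint.diff1 f x y + c *s L25_omega x y"
      using invariant2_cocycle_decomp[OF v] by blast
    have lin: "L25_linear (\<lambda>x. f x + g x)"
      using f(1) g(1) by (intro L25_adjoint.linear_addI) (simp_all add: invariant1_def)
    have "w x y = L25_adjoint.diff1 (\<lambda>x. f x + g x) x y + c *s L25_omega x y" for x y
      by (simp add: g(2) f(2) L25_adjoint.diff1_def L25_bracket_add)
    then have "\<phi> = (\<lambda>xs. L25_adjoint.cochain2 (L25_adjoint.diff1 (\<lambda>x. f x + g x)) xs + c *s L25_adjoint.cochain2 L25_omega xs)"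
      by (auto simp: w(3) L25_adjoint.cochain2_def fun_eq_iff split: list.splits)
    then show "\<exists>c. \<exists>\<beta>\<in>L25_adjoint.coboundaries 2. \<phi> = (\<lambda>xs. \<beta> xs + c *s L25_adjoint.cochain2 L25_omega xs)"
      using lin unfolding L25_adjoint.coboundaries_2 by blast
  qed
  then show "vectorspace.fin_dim class_ring (L25_adjoint.cohomology 2)" "vectorspace.dim class_ring (L25_adjoint.cohomology 2) = 1"
    by simp_all
qed

end
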